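(* Let $(\Omega,\mathcal{F},(\mathcal{F}_t)_{t\ge 0},\mathbb{P})$ be a filtered probability space satisfying property (NP), let $(X_t)_{t\ge 0}$ be a submartingale of class $(\Sigma)$ on it with decomposition $X_t=N_t+A_t$, and let $\mathcal{Q}$ be the associated $\sigma$-finite measure. Suppose that $A_\infty=\infty$, $\mathbb{P}$-almost surely. Let $Z$ be a nonnegative, càdlàg $\mathbb{P}$-supermartingale, and denote by $Z_\infty$ the $\mathbb{P}$-almost sure limit of $Z_t$ when $t$ goes to infinity. Then, $\mathcal{Q}$-almost everywhere, the quotient $Z_t/X_t$ is well-defined for $t$ large enough and converges, when $t$ goes to infinity, to a limit $z_\infty$, integrable with respect to $\mathcal{Q}$, and $(Z_t)_{t\ge0}$ decomposes as $$\left(Z_t=M_t(z_\infty)+\mathbb{P}[Z_\infty|\mathcal{F}_t]+\xi_t\right)_{t\ge0},$$ where $(\mathbb{P}[Z_\infty|\mathcal{F}_t])_{t\ge0}$ denotes a càdlàg version of the conditional expectation of $Z_\infty$ with respect to $\mathcal{F}_t$, and $(\xi_t)_{t\ge0}$ is a nonnegative, càdlàg $\mathbb{P}$-supermartingale, such that: (i) $Z_\infty\in L^1_+(\mathcal{F},\mathbb{P})$, hence $\mathbb{P}[Z_\infty|\mathcal{F}_t]$ converges $\mathbb{P}$-almost surely and in $L^1(\mathcal{F},\mathbb{P})$ towards $Z_\infty$; (ii) $\dfrac{\mathbb{P}[Z_\infty|\mathcal{F}_t]+\xi_t}{X_t}\underset{t\to\infty}{\longrightarrow}0$, $\mathcal{Q}$-almost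 everywhere; (iii) $M_t(z_\infty)+\xi_t\underset{t\to\infty}{\longrightarrow}0$, $\mathbb{P}$-almost surely. Moreover, the decomposition is unique in the following sense: let $z'_\infty$ be a $\mathcal{Q}$-integrable, nonnegative functional, $Z'_\infty$ a $\mathbb{P}$-integrable, nonnegative random variable, $(\xi'_t)_{t\ge0}$ a càdlàg, nonnegative $\mathbb{P}$-supermartingale, and suppose that for all $t\ge0$, $$Z_t=M_t(z'_\infty)+\mathbb{P}[Z'_\infty|\mathcal{F}_t]+\xi'_t.$$ If, for $t$ going to infinity, $\xi'_t$ tends $\mathbb{P}$-almost surely to zero and $\xi'_t/X_t$ tends $\mathcal{Q}$-almost everywhere to zero, then $z'_\infty=z_\infty$ $\mathcal{Q}$-almost everywhere, $Z'_\infty=Z_\infty$ $\mathbb{P}$-almost surely, and $\xi'$ is $\mathbb{P}$-indistinguishable from $\xi$.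
   Context: Notation: $\mathbb{P}[Y]$ denotes the expectation of $Y$ under $\mathbb{P}$ (and $\mathcal{Q}[Y]$ the integral of $Y$ under $\mathcal{Q}$); for an increasing process $(A_t)$, $A_\infty=\lim_{t\to\infty}A_t$. Class $(\Sigma)$: a nonnegative submartingale $(X_t)_{t\ge0}$ is of class $(\Sigma)$ iff $X_t=N_t+A_t$ where $(N_t)$ and $(A_t)$ are adapted, $(N_t)$ is a càdlàg martingale, $(A_t)$ is a continuous increasing process with $A_0=0$, and the measure $(dA_t)$ is carried by $\{t\ge0: X_t=0\}$. (In particular $X_t$ is integrable for all $t$.) Natural conditions: $(\Omega,\mathcal{F},(\mathcal{F}_t),\mathbb{P})$ satisfies the natural conditions iff $(\mathcal{F}_t)$ is right-continuous and, for all $t\ge0$ and every $\mathbb{P}$-negligible $A\in\mathcal{F}_t$, all subsets of $A$ belong to $\mathcal{F}_0$. The natural enlargement of a filtered probability space is its smallest extension (same $\Omega$, larger $\sigma$-algebras, extended probability) satisfying the natural conditions; it exists and is unique. Property (P): a filtered measurable space $(\Omega,\mathcal{F},(\mathcal{F}_t))$ with $\mathcal{F}=\bigvee_{t\ge0}\mathcal{F}_t$ satisfies (P) iff (i) each $\mathcal{F}_t$ is countably generated; (ii) for each $t$ there are a Polish space $\Omega_t$ and a surjection $\pi_t:\Omega\to\Omega_t$ such that $\mathcal{F}_t$ is the $\sigma$-algebra of inverse images under $\pi_t$ of Borel sets of $\Omega_t$, and for all $B\in\mathcal{F}_t$, $\omega\in\Omega$, $\pi_t(\omega)\in\pi_t(B)$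 implies $\omega\in B$; (iii) if $(\omega_n)_{n\ge0}$ is a sequence in $\Omega$ with $\bigcap_{n=0}^N A_n(\omega_n)\ne\emptyset$ for all $N\ge0$, where $A_n(\omega_n)$ is the intersection of the sets of $\mathcal{F}_n$ containing $\omega_n$, then $\bigcap_{n=0}^\infty A_n(\omega_n)\neq\emptyset$. Property (NP): a filtered probability space satisfies (NP) iff it is the natural enlargement of a filtered probability space $(\Omega,\mathcal{F}^0,(\mathcal{F}^0_t),\mathbb{P}^0)$ such that $(\Omega,\mathcal{F}^0,(\mathcal{F}^0_t))$ satisfies (P). In this case $\mathcal{F}=\bigvee_{t\ge 0}\mathcal{F}_t$. The measure $\mathcal{Q}$ (known theorem): if $(X_t)$ is a submartingale of class $(\Sigma)$ on a space satisfying (NP) and $g:=\sup\{t\ge0: X_t=0\}$ (with $\sup\emptyset=0$), there is a unique $\sigma$-finite measure $\mathcal{Q}$ on $(\Omega,\mathcal{F})$ such that $\mathcal{Q}[g=\infty]=0$ and, for all $t\ge0$ and all bounded $\mathcal{F}_t$-measurable $F_t$, $\mathcal{Q}[F_t\mathds{1}_{g\le t}]=\mathbb{P}[F_tX_t]$. The martingale $M_t(F)$: for a nonnegative, $\mathcal{Q}$-integrable functional $F$ on $(\Omega,\mathcal{F})$, $(M_t(F))_{t\ge0}$ denotes the càdlàg $\mathbb{P}$-martingale, unique up to indistinguishability, such that $\mathcal{Q}[F\,\Gamma_t]=\mathbb{P}[\Gamma_tM_t(F)]$ for all $t\ge0$ and all bounded $\mathcal{F}_t$-measurable $\Gamma_t$.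 Since $(M_t(F))$ and càdlàg versions of conditional expectations are only defined up to $\mathbb{P}$-indistinguishability, in the decomposition they are understood as suitably chosen càdlàg versions. Processes that are $\mathbb{P}$-indistinguishable are also $\mathcal{Q}$-indistinguishable. *)

theory Defs
  imports "HOL-Probability.Probability"
begin

text \<open>
  Conventions. Time is the half-line \<open>t \<ge> 0\<close> inside \<^typ>\<open>real\<close>; values of processes and
  filtrations at negative times are irrelevant, and every condition is relativised to \<open>t \<ge> 0\<close>.
  A filtered probability space is given by a measure \<open>P\<close> (carrying the space, the
  \<open>\<sigma>\<close>-algebra and the probability) and a family \<open>F\<close> of which only the \<open>\<sigma>\<close>-algebras
  matter, as for the second argument of \<^const>\<open>subalgebra\<close>.

  Properties of paths (nonnegative, cadlag, continuous, increasing, ...) are required for every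
  point of the space. They must not be weakened to \<open>P\<close>-almost every point: such an exceptional
  set need not be negligible for the measure \<open>\<Q>\<close> below, which is in general singular to \<open>P\<close> on
  the full \<open>\<sigma>\<close>-algebra.
\<close>

subsection \<open>Filtered spaces\<close>

definition filtered_measurable_space :: "'a measure \<Rightarrow> (real \<Rightarrow> 'a measure) \<Rightarrow> bool" where
  "filtered_measurable_space M F \<longleftrightarrow>
     (\<forall>t\<ge>0. subalgebra M (F t)) \<and> (\<forall>s t. 0 \<le> s \<and> s \<le> t \<longrightarrow> subalgebra (F t) (F s))"

definition filtered_prob_space :: "'a measure \<Rightarrow> (real \<Rightarrow> 'a measure) \<Rightarrow> bool" where
  "filtered_prob_space P F \<longleftrightarrow> prob_space P \<and> filtered_measurable_space P F"

definition natural_conditions :: "'a measure \<Rightarrow> (real \<Rightarrow> 'a measure) \<Rightarrow> bool" where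
  "natural_conditions P F \<longleftrightarrow>
     (\<forall>t\<ge>0. sets (F t) = (\<Inter>u\<in>{t<..}. sets (F u))) \<and>
     (\<forall>t\<ge>0. \<forall>A \<in> sets (F t) \<inter> null_sets P. \<forall>B\<subseteq>A. B \<in> sets (F 0))"

definition filtered_extension ::
  "'a measure \<Rightarrow> (real \<Rightarrow> 'a measure) \<Rightarrow> 'a measure \<Rightarrow> (real \<Rightarrow> 'a measure) \<Rightarrow> bool" where
  "filtered_extension P0 F0 P F \<longleftrightarrow>
     filtered_prob_space P0 F0 \<and> filtered_prob_space P F \<and>
     space P = space P0 \<and> sets P0 \<subseteq> sets P \<and>
     (\<forall>t\<ge>0. sets (F0 t) \<subseteq> sets (F t)) \<and>
     (\<forall>A\<in>sets P0. emeasure P A = emeasure P0 A)"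

definition natural_enlargement ::
  "'a measure \<Rightarrow> (real \<Rightarrow> 'a measure) \<Rightarrow> 'a measure \<Rightarrow> (real \<Rightarrow> 'a measure) \<Rightarrow> bool" where
  "natural_enlargement P0 F0 P F \<longleftrightarrow>
     filtered_extension P0 F0 P F \<and> natural_conditions P F \<and>
     (\<forall>P' F'. filtered_extension P0 F0 P' F' \<and> natural_conditions P' F' \<longrightarrow>
        filtered_extension P F P' F')"

definition countably_generated :: "'a measure \<Rightarrow> bool" where
  "countably_generated M \<longleftrightarrow>
     (\<exists>G. countable G \<and> G \<subseteq> Pow (space M) \<and> sets M = sigma_sets (space M) G)"

definition polish_topology :: "'b topology \<Rightarrow> bool" where
  "polish_topology T \<longleftrightarrow> completely_metrizable_space T \<and> second_countable T"

definition borel_sets_of :: "'b topology \<Rightarrow> 'b set set" where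
  "borel_sets_of T = sigma_sets (topspace T) {U. openin T U}"

text \<open>The intersection of the measurable sets containing a point.\<close>

definition measurable_atom :: "'a measure \<Rightarrow> 'a \<Rightarrow> 'a set" where
  "measurable_atom M \<omega> = \<Inter>{B \<in> sets M. \<omega> \<in> B}"

text \<open>
  In (ii) the Polish space is a topology whose points are real numbers. This is no
  restriction: a Polish space has at most the cardinality of the continuum, so its
  topology can be transported along an injection into \<^typ>\<open>real\<close>.
\<close>

definition property_P :: "'a measure \<Rightarrow> (real \<Rightarrow> 'a measure) \<Rightarrow> bool" where
  "property_P M F \<longleftrightarrow>
     filtered_measurable_space M F \<and>
     sets M = sigma_sets (space M) (\<Union>t\<in>{0..}. sets (F t)) \<and>
     (\<forall>t\<ge>0. countably_generated (F t)) \<and>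
     (\<forall>t\<ge>0. \<exists>(T :: real topology) \<pi>.
        polish_topology T \<and> \<pi> ` space M = topspace T \<and>
        sets (F t) = {\<pi> -` B \<inter> space M | B. B \<in> borel_sets_of T} \<and>
        (\<forall>B\<in>sets (F t). \<forall>\<omega>\<in>space M. \<pi> \<omega> \<in> \<pi> ` B \<longrightarrow> \<omega> \<in> B)) \<and>
     (\<forall>w :: nat \<Rightarrow> 'a. range w \<subseteq> space M \<and>
        (\<forall>N. (\<Inter>n\<in>{..N}. measurable_atom (F (real n)) (w n)) \<noteq> {}) \<longrightarrow>
        (\<Inter>n. measurable_atom (F (real n)) (w n)) \<noteq> {})"

definition property_NP :: "'a measure \<Rightarrow> (real \<Rightarrow> 'a measure) \<Rightarrow> bool" where
  "property_NP P F \<longleftrightarrow> (\<exists>P0 F0. property_P P0 F0 \<and> natural_enlargement P0 F0 P F)"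

subsection \<open>Processes\<close>

definition adapted :: "(real \<Rightarrow> 'a measure) \<Rightarrow> (real \<Rightarrow> 'a \<Rightarrow> real) \<Rightarrow> bool" where
  "adapted F Y \<longleftrightarrow> (\<forall>t\<ge>0. Y t \<in> borel_measurable (F t))"

definition nonneg_process :: "'a measure \<Rightarrow> (real \<Rightarrow> 'a \<Rightarrow> real) \<Rightarrow> bool" where
  "nonneg_process P Y \<longleftrightarrow> (\<forall>\<omega>\<in>space P. \<forall>t\<ge>0. 0 \<le> Y t \<omega>)"

definition cadlag :: "'a measure \<Rightarrow> (real \<Rightarrow> 'a \<Rightarrow> real) \<Rightarrow> bool" where
  "cadlag P Y \<longleftrightarrow> (\<forall>\<omega>\<in>space P.
     (\<forall>t\<ge>0. ((\<lambda>s. Y s \<omega>) \<longlongrightarrow> Y t \<omega>) (at_right t)) \<and>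
     (\<forall>t>0. \<exists>l. ((\<lambda>s. Y s \<omega>) \<longlongrightarrow> l) (at_left t)))"

definition martingale ::
  "'a measure \<Rightarrow> (real \<Rightarrow> 'a measure) \<Rightarrow> (real \<Rightarrow> 'a \<Rightarrow> real) \<Rightarrow> bool" where
  "martingale P F Y \<longleftrightarrow> adapted F Y \<and> (\<forall>t\<ge>0. integrable P (Y t)) \<and>
     (\<forall>s t. 0 \<le> s \<and> s \<le> t \<longrightarrow> (AE \<omega> in P. real_cond_exp P (F s) (Y t) \<omega> = Y s \<omega>))"

definition submartingale ::
  "'a measure \<Rightarrow> (real \<Rightarrow> 'a measure) \<Rightarrow> (real \<Rightarrow> 'a \<Rightarrow> real) \<Rightarrow> bool" where
  "submartingale P F Y \<longleftrightarrow> adapted F Y \<and> (\<forall>t\<ge>0. integrable P (Y t)) \<and>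
     (\<forall>s t. 0 \<le> s \<and> s \<le> t \<longrightarrow> (AE \<omega> in P. Y s \<omega> \<le> real_cond_exp P (F s) (Y t) \<omega>))"

definition supermartingale ::
  "'a measure \<Rightarrow> (real \<Rightarrow> 'a measure) \<Rightarrow> (real \<Rightarrow> 'a \<Rightarrow> real) \<Rightarrow> bool" where
  "supermartingale P F Y \<longleftrightarrow> adapted F Y \<and> (\<forall>t\<ge>0. integrable P (Y t)) \<and>
     (\<forall>s t. 0 \<le> s \<and> s \<le> t \<longrightarrow> (AE \<omega> in P. real_cond_exp P (F s) (Y t) \<omega> \<le> Y s \<omega>))"

definition indistinguishable ::
  "'a measure \<Rightarrow> (real \<Rightarrow> 'a \<Rightarrow> real) \<Rightarrow> (real \<Rightarrow> 'a \<Rightarrow> real) \<Rightarrow> bool" where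
  "indistinguishable P Y Y' \<longleftrightarrow> (AE \<omega> in P. \<forall>t\<ge>0. Y t \<omega> = Y' t \<omega>)"

definition cadlag_cond_exp ::
  "'a measure \<Rightarrow> (real \<Rightarrow> 'a measure) \<Rightarrow> ('a \<Rightarrow> real) \<Rightarrow> (real \<Rightarrow> 'a \<Rightarrow> real) \<Rightarrow> bool" where
  "cadlag_cond_exp P F f Y \<longleftrightarrow> cadlag P Y \<and> adapted F Y \<and>
     (\<forall>t\<ge>0. AE \<omega> in P. Y t \<omega> = real_cond_exp P (F t) f \<omega>)"

subsection \<open>Class \<open>(\<Sigma>)\<close>, the measure \<open>\<Q>\<close> and the martingales \<open>M(F)\<close>\<close>

text \<open>
  \<open>class_Sigma P F X N A\<close>: \<open>X\<close> is of class \<open>(\<Sigma>)\<close> with decomposition \<open>X = N + A\<close>. The measure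
  \<open>dA\<close> is the Stieltjes measure of the path of \<open>A\<close>, extended by \<open>A 0 = 0\<close> to negative times,
  so that it does not charge them.
\<close>

definition class_Sigma ::
  "'a measure \<Rightarrow> (real \<Rightarrow> 'a measure) \<Rightarrow> (real \<Rightarrow> 'a \<Rightarrow> real) \<Rightarrow>
   (real \<Rightarrow> 'a \<Rightarrow> real) \<Rightarrow> (real \<Rightarrow> 'a \<Rightarrow> real) \<Rightarrow> bool" where
  "class_Sigma P F X N A \<longleftrightarrow>
     nonneg_process P X \<and> submartingale P F X \<and>
     (\<forall>\<omega>\<in>space P. \<forall>t\<ge>0. X t \<omega> = N t \<omega> + A t \<omega>) \<and>
     cadlag P N \<and> martingale P F N \<and>
     adapted F A \<and>
     (\<forall>\<omega>\<in>space P. continuous_on {0..} (\<lambda>t. A t \<omega>) \<and> mono_on {0..} (\<lambda>t. A t \<omega>) \<and> A 0 \<omega> = 0 \<and>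
        {t. 0 \<le> t \<and> X t \<omega> \<noteq> 0} \<in> null_sets (interval_measure (\<lambda>t. A (max 0 t) \<omega>)))"

text \<open>Since \<open>Sup {} = 0\<close> in \<^typ>\<open>ennreal\<close>, this is \<open>0\<close> when \<open>X\<close> has no zero.\<close>

definition last_zero :: "(real \<Rightarrow> 'a \<Rightarrow> real) \<Rightarrow> 'a \<Rightarrow> ennreal" where
  "last_zero X \<omega> = (SUP t\<in>{t. 0 \<le> t \<and> X t \<omega> = 0}. ennreal t)"

definition bounded_measurable :: "'a measure \<Rightarrow> ('a \<Rightarrow> real) \<Rightarrow> bool" where
  "bounded_measurable M \<Gamma> \<longleftrightarrow> \<Gamma> \<in> borel_measurable M \<and> bounded (\<Gamma> ` space M)"

text \<open>\<open>Q\<close> is the (unique) \<open>\<sigma>\<close>-finite measure \<open>\<Q>\<close> associated with \<open>X\<close>.\<close>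

definition associated_measure ::
  "'a measure \<Rightarrow> (real \<Rightarrow> 'a measure) \<Rightarrow> (real \<Rightarrow> 'a \<Rightarrow> real) \<Rightarrow> 'a measure \<Rightarrow> bool" where
  "associated_measure P F X Q \<longleftrightarrow>
     sets Q = sets P \<and> sigma_finite_measure Q \<and>
     {\<omega>\<in>space Q. last_zero X \<omega> = \<infinity>} \<in> null_sets Q \<and>
     (\<forall>t\<ge>0. \<forall>\<Gamma>. bounded_measurable (F t) \<Gamma> \<longrightarrow>
        has_bochner_integral Q (\<lambda>\<omega>. \<Gamma> \<omega> * indicator {\<omega>. last_zero X \<omega> \<le> ennreal t} \<omega>)
          (\<integral>\<omega>. \<Gamma> \<omega> * X t \<omega> \<partial>P))"

text \<open>\<open>Y\<close> is a version of the martingale \<open>M(f)\<close>, for a \<open>\<Q>\<close>-integrable functional \<open>f\<close>.\<close>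

definition M_martingale ::
  "'a measure \<Rightarrow> (real \<Rightarrow> 'a measure) \<Rightarrow> 'a measure \<Rightarrow> ('a \<Rightarrow> real) \<Rightarrow> (real \<Rightarrow> 'a \<Rightarrow> real) \<Rightarrow> bool" where
  "M_martingale P F Q f Y \<longleftrightarrow> cadlag P Y \<and> martingale P F Y \<and>
     (\<forall>t\<ge>0. \<forall>\<Gamma>. bounded_measurable (F t) \<Gamma> \<longrightarrow>
        (\<integral>\<omega>. f \<omega> * \<Gamma> \<omega> \<partial>Q) = (\<integral>\<omega>. \<Gamma> \<omega> * Y t \<omega> \<partial>P))"

definition nonneg_integrable :: "'a measure \<Rightarrow> ('a \<Rightarrow> real) \<Rightarrow> bool" where
  "nonneg_integrable M f \<longleftrightarrow> integrable M f \<and> (\<forall>\<omega>\<in>space M. 0 \<le> f \<omega>)"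

end

theory Submission
  imports Defs
begin

text \<open>
  Let \<open>g\<close> be the last zero of \<open>X\<close>. Since \<open>dA\<close> is carried by the zeros of \<open>X\<close>, the event \<open>g \<le> s\<close> coincides
  \<open>\<Q>\<close>-almost everywhere with \<open>g \<le> t\<close> and \<open>A t = A s\<close>, for each \<open>t \<ge> s\<close>. Hence \<open>\<Q>\<close> restricted to \<open>g \<le> s\<close>
  has density \<open>X t\<close> on \<open>A t = A s\<close> with respect to \<open>P\<close> on \<open>F t\<close>, and \<open>Z / X\<close> is a nonnegative
  supermartingale under this finite measure, so it converges. Splitting \<open>P[\<Gamma> Z n]\<close> according to whether
  \<open>A n = A s\<close>, Fatou's lemma under both measures gives
  \<open>\<Q>[\<Gamma> z\<^sub>\<infinity>] + P[\<Gamma> Z\<^sub>\<infinity>] \<le> P[\<Gamma> Z t]\<close>, which is the nonnegativity of \<open>\<xi>\<close>. Applied to the martingales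
  \<open>M(f)\<close> and \<open>P[f | F t]\<close> themselves, it shows that the former vanishes at infinity under \<open>P\<close> and that the
  latter divided by \<open>X\<close> vanishes under \<open>\<Q>\<close>; together with Levy's theorem under both measures this gives
  the limits in the statement and uniqueness.
\<close>

subsection \<open>Crossings of finite sequences and regularity of paths\<close>

text \<open>The obstacle is that \<open>P\<close> and \<open>Q\<close> live on disjoint sets:
  \<open>A\<close> is unbounded \<open>P\<close>-almost everywhere, but constant from some time on
  \<open>Q\<close>-almost everywhere. A \<open>P\<close>-null event may therefore carry all of
  \<open>Q\<close>, and an almost sure statement passes from \<open>P\<close> to \<open>Q\<close>
  only if its exceptional set lies in some \<open>F t\<close>. Hence regularity of paths is tested
  on bounded time windows, exceptional sets are collected in \<open>F 0\<close> by means of the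
  natural conditions, and versions of processes are altered on such sets only. The second obstacle
  is that the last zero is not a stopping time, so \<open>G s\<close> need not belong to any
  \<open>F t\<close>. The adapted events where \<open>A t = A s\<close> and
  \<open>X t \<noteq> 0\<close> stand in for it; they shrink as \<open>t\<close> grows because
  \<open>X\<close>, until \<open>A\<close> next increases, behaves like a nonnegative martingale and
  stays at zero once it is there. Stopping times are avoided throughout: upcrossings are counted on
  finite lists of times, and the first increase of \<open>A\<close> is approached along grids, where
  uniform continuity of the paths of \<open>A\<close> controls the error.\<close>

text \<open>\<open>crosses a b n xs\<close>: scanning \<open>xs\<close> greedily, \<open>n\<close> alternations below \<open>a\<close> and above \<open>b\<close> are found.
  The parity of \<open>n\<close> encodes which side is awaited, so that the last one found is above \<open>b\<close>.\<close>

fun crosses :: "real \<Rightarrow> real \<Rightarrow> nat \<Rightarrow> real list \<Rightarrow> bool" where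
  "crosses a b 0 xs \<longleftrightarrow> True"
| "crosses a b (Suc n) [] \<longleftrightarrow> False"
| "crosses a b (Suc n) (x # xs) \<longleftrightarrow>
     (if (if even n then b < x else x < a) then crosses a b n xs else crosses a b (Suc n) xs)"

text \<open>The scan may consume an inserted element; the awaited side then flips and the rest of
  the list owes one alternation less. Monotonicity in the list thus rests on monotonicity in the
  number, and conversely, so both are proved in one induction.\<close>

lemma crosses_Cons_aux:
  "(\<forall>n. crosses a b (Suc n) xs \<longrightarrow> crosses a b n xs) \<and>
   (\<forall>n x. crosses a b n xs \<longrightarrow> crosses a b n (x # xs))"
proof (induction xs)
  case Nil
  show ?case
  proof (intro conjI allI impI)
    fix n x assume "crosses a b n []"
    then show "crosses a b n [x]" by (cases n) auto
  qed auto
next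
  case (Cons y ys)
  have A: "crosses a b n (y # ys)" if "crosses a b (Suc n) (y # ys)" for n
    using that Cons by (auto split: if_splits)
  moreover have "crosses a b n (x # y # ys)" if "crosses a b n (y # ys)" for n x
    using that A by (cases n) auto
  ultimately show ?case by blast
qed

lemma crosses_Cons: "crosses a b n xs \<Longrightarrow> crosses a b n (x # xs)"
  using crosses_Cons_aux by blast

lemma crosses_filter:
  "crosses a b n (map f (filter Q xs)) \<Longrightarrow> crosses a b n (map f xs)"
proof (induction xs arbitrary: n)
  case (Cons x xs)
  show ?case
  proof (cases "Q x")
    case True
    with Cons show ?thesis by (cases n) (auto split: if_splits)
  next
    case False
    with Cons show ?thesis by (simp add: crosses_Cons)
  qed
qed simp

text \<open>An increasing list with entries in \<open>S\<close> is the sorted enumeration of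
  \<open>S\<close> with some entries filtered out. Finite sets of times can therefore replace
  arbitrary increasing lists.\<close>

lemma crosses_sorted_subset:
  assumes "crosses a b n (map f ts)" "sorted_wrt (<) ts" "set ts \<subseteq> S" "finite S"
  shows "crosses a b n (map f (sorted_list_of_set S))"
proof -
  have "ts = filter (\<lambda>t. t \<in> set ts) (sorted_list_of_set S)"
    using assms by (intro strict_sorted_equal) (auto intro: sorted_wrt_filter)
  with assms(1) show ?thesis by (metis crosses_filter)
qed

text \<open>Finitely many upcrossings and boundedness, phrased through finite lists, rational levels
  and natural bounds so that only countable operations occur when \<open>S\<close> is countable.
  Levels \<open>a > 0\<close> suffice for nonnegative paths, and they are the ones that Dubins'
  inequality controls.\<close>

definition tame_on :: "real set \<Rightarrow> (real \<Rightarrow> real) \<Rightarrow> bool" where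
  "tame_on S y \<longleftrightarrow>
     (\<forall>a\<in>\<rat>. \<forall>b\<in>\<rat>. 0 < a \<and> a < b \<longrightarrow>
        (\<exists>n. \<forall>ts. sorted_wrt (<) ts \<and> set ts \<subseteq> S \<longrightarrow> \<not> crosses a b n (map y ts))) \<and>
     (\<exists>c::nat. \<forall>t\<in>S. y t \<le> c)"

lemma tame_on_mono: "tame_on S y \<Longrightarrow> S' \<subseteq> S \<Longrightarrow> tame_on S' y"
  unfolding tame_on_def by (blast intro: order_trans)

lemma not_tame_increasing:
  fixes y :: "real \<Rightarrow> real"
  assumes "S \<noteq> {}" "a < b"
    and lo: "\<And>T. T \<in> S \<Longrightarrow> \<exists>t\<in>S. T < t \<and> y t < a"
    and hi: "\<And>T. T \<in> S \<Longrightarrow> \<exists>t\<in>S. T < t \<and> b < y t"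
  shows "\<exists>ts. sorted_wrt (<) ts \<and> set ts \<subseteq> S \<and> crosses a b n (map y ts)"
proof -
  have "\<exists>ts. sorted_wrt (<) ts \<and> set ts \<subseteq> S \<inter> {T<..} \<and> crosses a b n (map y ts)" if "T \<in> S" for T
    using that
  proof (induction n arbitrary: T)
    case 0
    show ?case by (intro exI[of _ "[]"]) auto
  next
    case (Suc n)
    obtain t where t: "t \<in> S" "T < t" "if even n then b < y t else y t < a"
      using lo[OF Suc.prems] hi[OF Suc.prems] by (cases "even n") auto
    obtain ts where ts: "sorted_wrt (<) ts" "set ts \<subseteq> S \<inter> {t<..}" "crosses a b n (map y ts)"
      using Suc.IH[OF t(1)] by blast
    have gt: "x \<in> S \<and> t < x \<and> T < x" if "x \<in> set ts" for x
      using subsetD[OF ts(2) that] less_trans[OF t(2), of x] by simp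
    show ?case
    proof (intro exI[of _ "t # ts"] conjI)
      show "sorted_wrt (<) (t # ts)" using ts(1) gt by simp
      show "set (t # ts) \<subseteq> S \<inter> {T<..}" using t(1,2) gt by auto
      show "crosses a b (Suc n) (map y (t # ts))" using t(3) ts(3) by simp
    qed
  qed
  with assms(1) show ?thesis by blast
qed

text \<open>The times are found from right to left and prepended. The scan need not be reversed,
  because the parity of the number of alternations fixes the side awaited at the head of the
  list.\<close>

lemma not_tame_decreasing:
  fixes y :: "real \<Rightarrow> real"
  assumes "S \<noteq> {}" "a < b"
    and lo: "\<And>T. T \<in> S \<Longrightarrow> \<exists>t\<in>S. t < T \<and> y t < a"
    and hi: "\<And>T. T \<in> S \<Longrightarrow> \<exists>t\<in>S. t < T \<and> b < y t"
  shows "\<exists>ts. sorted_wrt (<) ts \<and> set ts \<subseteq> S \<and> crosses a b n (map y ts)"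
proof -
  have "\<exists>ts. ts \<noteq> [] \<and> sorted_wrt (<) ts \<and> set ts \<subseteq> S \<and> crosses a b n (map y ts)"
  proof (induction n)
    case 0
    obtain t where "t \<in> S" using assms by auto
    then show ?case by (intro exI[of _ "[t]"]) auto
  next
    case (Suc n)
    then obtain u ts where ts: "sorted_wrt (<) (u # ts)" "set (u # ts) \<subseteq> S" "crosses a b n (map y (u # ts))"
      by (metis list.exhaust)
    then have "u \<in> S" by auto
    obtain t where t: "t \<in> S" "t < u" "if even n then b < y t else y t < a"
      using lo[OF \<open>u \<in> S\<close>] hi[OF \<open>u \<in> S\<close>] by (cases "even n") auto
    show ?case
    proof (intro exI[of _ "t # u # ts"] conjI)
      have "t < x" if "x \<in> set ts" for x using ts(1) that less_trans[OF t(2)] by simp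
      then show "sorted_wrt (<) (t # u # ts)" using ts(1) t(2) by simp
      show "set (t # u # ts) \<subseteq> S" using t(1) ts(2) by simp
      show "crosses a b (Suc n) (map y (t # u # ts))" using t(3) ts(3) by simp
    qed simp
  qed
  then show ?thesis by blast
qed

text \<open>Compactness of \<open>{0..c}\<close> supplies a cluster point. Between it and any other
  level lies a rational interval, and since values near the cluster point recur, only one
  alternative of \<open>osc\<close> remains for that interval.\<close>

lemma tendsto_if_no_oscillation:
  fixes y :: "'b \<Rightarrow> real"
  assumes ne: "Fi \<noteq> bot"
    and bd: "\<forall>\<^sub>F t in Fi. 0 \<le> y t \<and> y t \<le> c"
    and osc: "\<And>a b. a \<in> \<rat> \<Longrightarrow> b \<in> \<rat> \<Longrightarrow> 0 < a \<Longrightarrow> a < b \<Longrightarrow>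
      (\<forall>\<^sub>F t in Fi. a \<le> y t) \<or> (\<forall>\<^sub>F t in Fi. y t \<le> b)"
  shows "\<exists>l. (y \<longlongrightarrow> l) Fi"
proof -
  have "filtermap y Fi \<noteq> bot" "filtermap y Fi \<le> principal {0..c}"
    using ne bd by (auto simp: filtermap_bot_iff le_principal eventually_filtermap)
  then obtain x where x: "x \<in> {0..c}" "inf (nhds x) (filtermap y Fi) \<noteq> bot"
    using compact_Icc[of 0 c] unfolding compact_filter by (metis eventually_filtermap le_principal)
  have freq: "\<exists>\<^sub>F t in Fi. y t \<in> U" if "open U" "x \<in> U" for U
  proof (rule ccontr)
    assume "\<not> (\<exists>\<^sub>F t in Fi. y t \<in> U)"
    then have "eventually (\<lambda>z. z \<notin> U) (filtermap y Fi)"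
      by (simp add: not_frequently eventually_filtermap)
    moreover have "eventually (\<lambda>z. z \<in> U) (nhds x)" using that by (rule eventually_nhds_in_open)
    ultimately have "eventually (\<lambda>z. False) (inf (nhds x) (filtermap y Fi))"
      unfolding eventually_inf by (intro exI[of _ "\<lambda>z. z \<in> U"] exI[of _ "\<lambda>z. z \<notin> U"]) auto
    with x show False by (simp add: trivial_limit_def)
  qed
  have "(y \<longlongrightarrow> x) Fi"
  proof (rule order_tendstoI)
    fix z assume "z < x"
    show "\<forall>\<^sub>F t in Fi. z < y t"
    \<comment> \<open>Negative levels are handled by the lower bound on \<open>y\<close>, since
      \<open>osc\<close> speaks of positive \<open>a\<close> only.\<close>
    proof (cases "z < 0")
      case True
      show ?thesis using bd by eventually_elim (use True in auto)
    next
      case False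
      obtain a where a: "a \<in> \<rat>" "z < a" "a < x" using Rats_dense_in_real[OF \<open>z < x\<close>] by blast
      obtain b where b: "b \<in> \<rat>" "a < b" "b < x" using Rats_dense_in_real[OF a(3)] by blast
      have "\<not> (\<forall>\<^sub>F t in Fi. y t \<le> b)"
        using freq[of "{b<..}"] b by (simp add: frequently_def not_less)
      with osc[of a b] a b False have "\<forall>\<^sub>F t in Fi. a \<le> y t" by auto
      then show ?thesis by eventually_elim (use a in auto)
    qed
  next
    fix z assume "x < z"
    obtain b where b: "b \<in> \<rat>" "x < b" "b < z" using Rats_dense_in_real[OF \<open>x < z\<close>] by blast
    obtain a where a: "a \<in> \<rat>" "x < a" "a < b" using Rats_dense_in_real[OF b(2)] by blast
    have "\<not> (\<forall>\<^sub>F t in Fi. a \<le> y t)"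
      using freq[of "{..<a}"] a by (simp add: frequently_def not_less)
    with osc[of a b] a b x have "\<forall>\<^sub>F t in Fi. y t \<le> b" by auto
    then show "\<forall>\<^sub>F t in Fi. y t < z" by eventually_elim (use b in auto)
  qed
  then show ?thesis by blast
qed

text \<open>\<open>dir\<close> says that the filter moves past each point of \<open>S\<close>,
  upwards or downwards, so that a further alternation can always be found beyond the last chosen
  time. Right limits, left limits and limits at infinity are all instances.\<close>

lemma tame_on_tendsto:
  fixes y :: "real \<Rightarrow> real"
  assumes "tame_on S y" "\<forall>t\<in>S. 0 \<le> y t" "Fi \<noteq> bot" and S: "\<forall>\<^sub>F t in Fi. t \<in> S"
    and dir: "(\<forall>T\<in>S. \<forall>\<^sub>F t in Fi. T < t) \<or> (\<forall>T\<in>S. \<forall>\<^sub>F t in Fi. t < T)"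
  shows "\<exists>l. (y \<longlongrightarrow> l) Fi"
proof -
  obtain c :: nat where c: "\<forall>t\<in>S. y t \<le> c" using assms(1) unfolding tame_on_def by (elim conjE exE)
  have "S \<noteq> {}" 
  proof
    assume "S = {}"
    with S have "eventually (\<lambda>t. False) Fi" by simp
    with \<open>Fi \<noteq> bot\<close> show False by (simp add: eventually_False)
  qed
  show ?thesis
  proof (rule tendsto_if_no_oscillation[OF \<open>Fi \<noteq> bot\<close>])
    show "\<forall>\<^sub>F t in Fi. 0 \<le> y t \<and> y t \<le> c"
      using S by eventually_elim (use assms(2) c in auto)
  next
    fix a b :: real assume ab: "a \<in> \<rat>" "b \<in> \<rat>" "0 < a" "a < b"
    then obtain n where n: "\<forall>ts. sorted_wrt (<) ts \<and> set ts \<subseteq> S \<longrightarrow> \<not> crosses a b n (map y ts)"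
      using assms(1) unfolding tame_on_def by (elim conjE) (drule bspec, assumption, drule bspec, assumption, auto)
    show "(\<forall>\<^sub>F t in Fi. a \<le> y t) \<or> (\<forall>\<^sub>F t in Fi. y t \<le> b)"
    proof (rule ccontr)
      assume "\<not> ?thesis"
      then have lo: "\<exists>\<^sub>F t in Fi. y t < a" and hi: "\<exists>\<^sub>F t in Fi. b < y t"
        by (simp_all add: frequently_def not_less)
      have freq: "\<exists>t\<in>S. R t \<and> R' t" if "\<exists>\<^sub>F t in Fi. R' t" "\<forall>\<^sub>F t in Fi. R t" for R R'
        using frequently_ex[OF frequently_eventually_frequently[OF that(1) eventually_conj[OF S that(2)]]]
        by blast
      from dir have "\<exists>ts. sorted_wrt (<) ts \<and> set ts \<subseteq> S \<and> crosses a b n (map y ts)"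
      proof
        assume *: "\<forall>T\<in>S. \<forall>\<^sub>F t in Fi. T < t"
        show ?thesis
          by (rule not_tame_increasing[OF \<open>S \<noteq> {}\<close> \<open>a < b\<close>]; rule freq; use lo hi * in simp)
      next
        assume *: "\<forall>T\<in>S. \<forall>\<^sub>F t in Fi. t < T"
        show ?thesis
          by (rule not_tame_decreasing[OF \<open>S \<noteq> {}\<close> \<open>a < b\<close>]; rule freq; use lo hi * in simp)
      qed
      with n show False by blast
    qed
  qed
qed

section \<open>Limits of tame paths along rational times\<close>

lemma at_within_Rats_greater_neq_bot: "at (t::real) within (\<rat> \<inter> {t<..}) \<noteq> bot"
proof -
  have "\<exists>x\<in>\<rat> \<inter> {t<..}. dist x t < e" if e: "e > 0" for e
  proof -
    obtain r where "r \<in> \<rat>" "t < r" "r < t + e" using Rats_dense_in_real[of t "t + e"] e by auto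
    then show ?thesis by (intro bexI[of _ r]) (auto simp: dist_real_def)
  qed
  then show ?thesis by (auto simp: trivial_limit_within islimpt_approachable)
qed

lemma at_within_Rats_less_neq_bot: "at (t::real) within (\<rat> \<inter> {..<t}) \<noteq> bot"
proof -
  have "\<exists>x\<in>\<rat> \<inter> {..<t}. dist x t < e" if e: "e > 0" for e
  proof -
    obtain r where "r \<in> \<rat>" "t - e < r" "r < t" using Rats_dense_in_real[of "t - e" t] e by auto
    then show ?thesis by (intro bexI[of _ r]) (auto simp: dist_real_def)
  qed
  then show ?thesis by (auto simp: trivial_limit_within islimpt_approachable)
qed

lemma tame_on_tendsto_at_right:
  assumes "tame_on (\<rat> \<inter> {s..n}) y" "\<forall>t\<ge>s. 0 \<le> y t" "s \<le> t" "t < n"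
  shows "\<exists>l. (y \<longlongrightarrow> l) (at t within (\<rat> \<inter> {t<..}))"
proof (rule tame_on_tendsto)
  have "\<rat> \<inter> {t<..<n} \<subseteq> \<rat> \<inter> {s..n}" using assms by auto
  with assms(1) show "tame_on (\<rat> \<inter> {t<..<n}) y" by (rule tame_on_mono)
  have *: "\<forall>\<^sub>F x in at t within \<rat> \<inter> {t<..}. x \<in> \<rat> \<inter> {t<..<T}" if "t < T" for T
    unfolding eventually_at_filter
    using eventually_nhds_in_open[of "{..<T}" t] that by (auto elim!: eventually_mono)
  show "\<forall>\<^sub>F x in at t within \<rat> \<inter> {t<..}. x \<in> \<rat> \<inter> {t<..<n}" using * assms by blast
  show "(\<forall>T\<in>\<rat> \<inter> {t<..<n}. \<forall>\<^sub>F x in at t within \<rat> \<inter> {t<..}. T < x) \<or>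
    (\<forall>T\<in>\<rat> \<inter> {t<..<n}. \<forall>\<^sub>F x in at t within \<rat> \<inter> {t<..}. x < T)"
    by (intro disjI2 ballI eventually_mono[OF *]) auto
qed (use assms at_within_Rats_greater_neq_bot in auto)

lemma tame_on_tendsto_at_left:
  assumes "tame_on (\<rat> \<inter> {s..n}) y" "\<forall>t\<ge>s. 0 \<le> y t" "s < t" "t \<le> n"
  shows "\<exists>l. (y \<longlongrightarrow> l) (at t within (\<rat> \<inter> {..<t}))"
proof (rule tame_on_tendsto)
  have "\<rat> \<inter> {s<..<t} \<subseteq> \<rat> \<inter> {s..n}" using assms by auto
  with assms(1) show "tame_on (\<rat> \<inter> {s<..<t}) y" by (rule tame_on_mono)
  have *: "\<forall>\<^sub>F x in at t within \<rat> \<inter> {..<t}. x \<in> \<rat> \<inter> {T<..<t}" if "T < t" for T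
    unfolding eventually_at_filter
    using eventually_nhds_in_open[of "{T<..}" t] that by (auto elim!: eventually_mono)
  show "\<forall>\<^sub>F x in at t within \<rat> \<inter> {..<t}. x \<in> \<rat> \<inter> {s<..<t}" using * assms by blast
  show "(\<forall>T\<in>\<rat> \<inter> {s<..<t}. \<forall>\<^sub>F x in at t within \<rat> \<inter> {..<t}. T < x) \<or>
    (\<forall>T\<in>\<rat> \<inter> {s<..<t}. \<forall>\<^sub>F x in at t within \<rat> \<inter> {..<t}. x < T)"
    by (intro disjI1 ballI eventually_mono[OF *]) auto
qed (use assms at_within_Rats_less_neq_bot in auto)

text \<open>Tameness controls rational times; right-continuity carries the limit to real times. It
  is asked for strictly after \<open>s\<close> because the lemma serves ratios \<open>Z / X\<close>,
  where \<open>X\<close> may vanish at \<open>s\<close> itself.\<close>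

lemma tame_on_tendsto_at_top:
  assumes "tame_on (\<rat> \<inter> {s..}) y" "\<forall>t\<ge>s. 0 \<le> y t"
    and rc: "\<forall>t>s. (y \<longlongrightarrow> y t) (at_right t)"
  shows "\<exists>l. (y \<longlongrightarrow> l) at_top"
proof -
  define Fi :: "real filter" where "Fi = inf at_top (principal \<rat>)"
  have ev: "eventually R Fi \<longleftrightarrow> (\<exists>T. \<forall>t\<ge>T. t \<in> \<rat> \<longrightarrow> R t)" for R
    by (simp add: Fi_def eventually_inf_principal eventually_at_top_linorder)
  have "\<exists>l. (y \<longlongrightarrow> l) Fi"
  proof (rule tame_on_tendsto[OF assms(1)])
    have "\<exists>t\<ge>T. t \<in> \<rat>" for T :: real by (meson Rats_of_nat real_arch_simple)
    then show "Fi \<noteq> bot" by (auto simp: trivial_limit_def ev)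
    show "\<forall>\<^sub>F t in Fi. t \<in> \<rat> \<inter> {s..}" unfolding ev by auto
    have "\<forall>\<^sub>F t in Fi. T < t" for T unfolding ev by (intro exI[of _ "T + 1"]) auto
    then show "(\<forall>T\<in>\<rat> \<inter> {s..}. \<forall>\<^sub>F t in Fi. T < t) \<or> (\<forall>T\<in>\<rat> \<inter> {s..}. \<forall>\<^sub>F t in Fi. t < T)"
      by blast
  qed (use assms in auto)
  then obtain l where l: "(y \<longlongrightarrow> l) Fi" by blast
  have "(y \<longlongrightarrow> l) at_top"
  proof (rule tendstoI)
    fix e :: real assume "e > 0"
    then have "\<forall>\<^sub>F t in Fi. dist (y t) l < e / 2" using l by (intro tendstoD) auto
    then obtain T where T: "\<forall>t\<ge>T. t \<in> \<rat> \<longrightarrow> dist (y t) l < e / 2" unfolding ev by blast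
    have "dist (y t) l < e" if "t > max s T" for t
    proof -
      have "(y \<longlongrightarrow> y t) (at t within (\<rat> \<inter> {t<..}))"
        using rc that by (auto intro: tendsto_within_subset)
      moreover have "\<forall>\<^sub>F x in at t within (\<rat> \<inter> {t<..}). dist (y x) l \<le> e / 2"
        unfolding eventually_at_filter using T that by (intro always_eventually) (auto intro: less_imp_le)
      ultimately have "dist (y t) l \<le> e / 2"
        by (intro tendsto_upperbound[OF _ _ at_within_Rats_greater_neq_bot[of t]])
          (auto intro!: tendsto_intros)
      with \<open>e > 0\<close> show ?thesis by simp
    qed
    then show "\<forall>\<^sub>F t in at_top. dist (y t) l < e"
      by (intro eventually_mono[OF eventually_gt_at_top[of "max s T"]])
  qed
  then show ?thesis by blast
qed

text \<open>Exceeding \<open>b\<close> is the case of a single alternation, so the maximal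
  inequality comes out of the same estimate as the upcrossing bound.\<close>

lemma crosses_one: "crosses a b (Suc 0) xs \<longleftrightarrow> (\<exists>x\<in>set xs. b < x)"
  by (induction xs) auto

text \<open>The finite time sets on the right grow with \<open>m\<close>, so that finding
  \<open>n\<close> alternations becomes an increasing countable union: this yields measurability,
  and continuity from below of the measure.\<close>

lemma tame_on_range:
  "tame_on (range f) y \<longleftrightarrow>
     (\<forall>a\<in>\<rat>. \<forall>b\<in>\<rat>. 0 < a \<and> a < b \<longrightarrow>
        (\<exists>n. \<forall>m::nat. \<not> crosses a b n (map y (sorted_list_of_set (f ` {..m}))))) \<and>
     (\<exists>c::nat. \<forall>m. y (f m) \<le> c)"
proof -
  have "(\<exists>ts. sorted_wrt (<) ts \<and> set ts \<subseteq> range f \<and> crosses a b n (map y ts)) \<longleftrightarrow>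
    (\<exists>m::nat. crosses a b n (map y (sorted_list_of_set (f ` {..m}))))" for a b n
  proof safe
    fix ts assume ts: "sorted_wrt (<) ts" "set ts \<subseteq> range f" "crosses a b n (map y ts)"
    obtain C where C: "finite C" "set ts = f ` C"
      using finite_subset_image[OF _ ts(2)] by auto
    have "C \<subseteq> {..Max (insert 0 C)}" using C(1) by auto
    then have "set ts \<subseteq> f ` {..Max (insert 0 C)}" unfolding C(2) by (rule image_mono)
    from crosses_sorted_subset[OF ts(3,1) this]
    show "\<exists>m. crosses a b n (map y (sorted_list_of_set (f ` {..m})))" by blast
  next
    fix m assume "crosses a b n (map y (sorted_list_of_set (f ` {..m})))"
    then show "\<exists>ts. sorted_wrt (<) ts \<and> set ts \<subseteq> range f \<and> crosses a b n (map y ts)"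
      by (intro exI[of _ "sorted_list_of_set (f ` {..m})"]) auto
  qed
  then have "(\<exists>n. \<forall>ts. sorted_wrt (<) ts \<and> set ts \<subseteq> range f \<longrightarrow> \<not> crosses a b n (map y ts)) \<longleftrightarrow>
    (\<exists>n. \<forall>m. \<not> crosses a b n (map y (sorted_list_of_set (f ` {..m}))))" for a b
    by meson
  then show ?thesis unfolding tame_on_def by simp
qed

subsection \<open>Nonnegative supermartingales over a finite measure\<close>

text \<open>The inequality is expressed by set integrals over a finite measure instead of
  conditional expectations, so that it covers \<open>P\<close> as well as the restrictions of
  \<open>Q\<close>. The starting time is a parameter since, with \<open>Q\<close> restricted to
  \<open>G s\<close>, the ratio \<open>Z / X\<close> is a supermartingale from \<open>s\<close>
  on.\<close>

locale nonneg_supermartingale = finite_measure M for M :: "'a measure" +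
  fixes F :: "real \<Rightarrow> 'a measure" and Y :: "real \<Rightarrow> 'a \<Rightarrow> real" and s :: real
  assumes subalg: "\<And>t. s \<le> t \<Longrightarrow> subalgebra M (F t)"
    and filt: "\<And>u t. s \<le> u \<Longrightarrow> u \<le> t \<Longrightarrow> subalgebra (F t) (F u)"
    and adapt: "\<And>t. s \<le> t \<Longrightarrow> Y t \<in> borel_measurable (F t)"
    and nonneg: "\<And>t x. s \<le> t \<Longrightarrow> x \<in> space M \<Longrightarrow> 0 \<le> Y t x"
    and super: "\<And>u t B. s \<le> u \<Longrightarrow> u \<le> t \<Longrightarrow> B \<in> sets (F u) \<Longrightarrow>
      (\<integral>\<^sup>+x\<in>B. ennreal (Y t x) \<partial>M) \<le> (\<integral>\<^sup>+x\<in>B. ennreal (Y u x) \<partial>M)"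
    and fin: "(\<integral>\<^sup>+x. ennreal (Y s x) \<partial>M) < \<infinity>"
begin

lemma space_F: "s \<le> t \<Longrightarrow> space (F t) = space M"
  using subalg by (simp add: subalgebra_def)

lemma sets_F: "s \<le> t \<Longrightarrow> B \<in> sets (F t) \<Longrightarrow> B \<in> sets M"
  using subalg by (auto simp: subalgebra_def)

lemma adapt': "s \<le> u \<Longrightarrow> u \<le> t \<Longrightarrow> Y u \<in> borel_measurable (F t)"
  by (rule measurable_from_subalg[OF filt adapt])

lemma adapt_M: "s \<le> u \<Longrightarrow> Y u \<in> borel_measurable M"
  by (rule measurable_from_subalg[OF subalg adapt])

lemma crosses_measurable:
  assumes "set ts \<subseteq> {s..t}"
  shows "Measurable.pred (F t) (\<lambda>x. crosses a b n (map (\<lambda>u. Y u x) ts))"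
  using assms
proof (induction ts arbitrary: n)
  case Nil
  show ?case by (cases n) auto
next
  case (Cons u ts)
  have [measurable]: "Y u \<in> borel_measurable (F t)" using Cons by (intro adapt') auto
  have [measurable]: "Measurable.pred (F t) (\<lambda>x. crosses a b n (map (\<lambda>u. Y u x) ts))" for n
    using Cons by auto
  show ?case by (cases n) (auto, measurable)
qed

lemma tame_on_measurable:
  assumes "S \<subseteq> {s..t}" "countable S"
  shows "Measurable.pred (F t) (\<lambda>x. tame_on S (\<lambda>u. Y u x))"
proof (cases "S = {}")
  case True
  then show ?thesis by (cases "tame_on S (\<lambda>u. 0)") (auto simp: tame_on_def)
next
  case False
  then have S: "S = range (from_nat_into S)" using assms by (simp add: range_from_nat_into)
  have *: "from_nat_into S m \<in> {s..t}" for m using S assms(1) by blast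
  have [measurable]: "Y (from_nat_into S m) \<in> borel_measurable (F t)" for m
    using * by (intro adapt') auto
  have [measurable]: "Measurable.pred (F t)
      (\<lambda>x. crosses a b n (map (\<lambda>u. Y u x) (sorted_list_of_set (from_nat_into S ` {..m}))))" for a b n and m :: nat
    using * by (intro crosses_measurable) auto
  have [simp]: "countable (\<rat> :: real set)" by (rule countable_rat)
  show ?thesis
    by (subst S, subst tame_on_range) measurable
qed

text \<open>Dubins' inequality. The two cases alternate in an induction over the time list, so that no
  stopping times are needed.\<close>

lemma emeasure_crosses_le:
  assumes "0 < a" "a < b" "sorted (t0 # ts)" "s \<le> t0" "B \<in> sets (F t0)"
  shows "emeasure M (B \<inter> {x\<in>space M. crosses a b n (map (\<lambda>t. Y t x) ts)}) \<le>
    (if even n then ennreal ((a / b) ^ (n div 2)) * emeasure M B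
     else ennreal ((a / b) ^ (n div 2) / b) * (\<integral>\<^sup>+x\<in>B. ennreal (Y t0 x) \<partial>M))"
  using assms(3-)
proof (induction ts arbitrary: n t0 B)
  case Nil
  have "emeasure M (B \<inter> space M) \<le> emeasure M B"
    using Nil sets_F by (intro emeasure_mono) auto
  then show ?case by (cases n) auto
next
  case (Cons t ts)
  have t: "t0 \<le> t" "s \<le> t" and ts: "sorted (t # ts)" using Cons.prems by auto
  have BM: "B \<in> sets M" using Cons.prems sets_F by auto
  have BF: "B \<in> sets (F t)"
    using Cons.prems filt[of t0 t] t by (auto simp: subalgebra_def)
  show ?case
  proof (cases n)
    case 0
    have "emeasure M (B \<inter> space M) \<le> emeasure M B"
      using BM by (intro emeasure_mono) auto
    with 0 show ?thesis by simp
  next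
    case (Suc k)
    \<comment> \<open>The parity of \<open>k\<close> decides which side the value at
      \<open>t\<close> has to reach; on \<open>C\<close> it is consumed and \<open>k\<close>
      alternations remain, on \<open>D\<close> all \<open>Suc k\<close> do.\<close>
    define R where "R x \<longleftrightarrow> (if even k then b < Y t x else Y t x < a)" for x
    define C where "C = {x\<in>B. R x}"
    define D where "D = {x\<in>B. \<not> R x}"
    have [measurable]: "Y t \<in> borel_measurable (F t)" "B \<in> sets (F t)" "B \<in> sets M" "Y t \<in> borel_measurable M"
      using adapt adapt_M t BF BM by auto
    have CF [measurable]: "C \<in> sets (F t)" and DF [measurable]: "D \<in> sets (F t)"
      unfolding C_def D_def R_def by measurable
    have CM [measurable]: "C \<in> sets M" and DM [measurable]: "D \<in> sets M" using sets_F t CF DF by auto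
    have CD: "C \<union> D = B" "C \<inter> D = {}" unfolding C_def D_def by auto
    have [measurable]: "Measurable.pred M (\<lambda>x. crosses a b j (map (\<lambda>t. Y t x) ts))" for j
    proof -
      have "Measurable.pred (F (Max (set (t # ts)))) (\<lambda>x. crosses a b j (map (\<lambda>t. Y t x) ts))"
        using t ts by (intro crosses_measurable) auto
      moreover have "s \<le> Max (set (t # ts))" using t by (subst Max_ge_iff) auto
      ultimately show ?thesis using measurable_from_subalg[OF subalg] by blast
    qed
    have "emeasure M (B \<inter> {x\<in>space M. crosses a b (Suc k) (map (\<lambda>t. Y t x) (t # ts))}) \<le>
      emeasure M ((C \<inter> {x\<in>space M. crosses a b k (map (\<lambda>t. Y t x) ts)}) \<union>
                  (D \<inter> {x\<in>space M. crosses a b (Suc k) (map (\<lambda>t. Y t x) ts)}))"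
      by (intro emeasure_mono) (auto simp: C_def D_def R_def split: if_splits)
    also have "\<dots> \<le> emeasure M (C \<inter> {x\<in>space M. crosses a b k (map (\<lambda>t. Y t x) ts)}) +
        emeasure M (D \<inter> {x\<in>space M. crosses a b (Suc k) (map (\<lambda>t. Y t x) ts)})"
      by (intro emeasure_subadditive) auto
    finally have le: "emeasure M (B \<inter> {x\<in>space M. crosses a b n (map (\<lambda>t. Y t x) (t # ts))}) \<le> \<dots>"
      unfolding Suc .
    note IHC = Cons.IH[OF ts t(2) CF, of k] and IHD = Cons.IH[OF ts t(2) DF, of "Suc k"]
    have split: "(\<integral>\<^sup>+x\<in>C. ennreal (Y t x) \<partial>M) + (\<integral>\<^sup>+x\<in>D. ennreal (Y t x) \<partial>M) = (\<integral>\<^sup>+x\<in>B. ennreal (Y t x) \<partial>M)"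
      by (subst nn_integral_add[symmetric], measurable)
        (intro nn_integral_cong, use CD in \<open>auto simp: indicator_def\<close>)
    show ?thesis
    proof (cases "even k")
      case True
      \<comment> \<open>A value above \<open>b\<close> is awaited. Markov's inequality replaces the
        mass of \<open>C\<close> by \<open>1 / b\<close> times the integral of \<open>Y t\<close>,
        matching the bound on \<open>D\<close>; the supermartingale property then moves the sum from
        \<open>t\<close> back to \<open>t0\<close>.\<close>
      have "ennreal b * emeasure M C = (\<integral>\<^sup>+x. ennreal b * indicator C x \<partial>M)"
        by (simp add: nn_integral_cmult_indicator)
      also have "\<dots> \<le> (\<integral>\<^sup>+x\<in>C. ennreal (Y t x) \<partial>M)"
        by (intro nn_integral_mono) (use True in \<open>auto simp: C_def R_def indicator_def intro!: ennreal_leI\<close>)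
      finally have "ennreal ((a / b) ^ (k div 2) / b) * (ennreal b * emeasure M C) \<le>
          ennreal ((a / b) ^ (k div 2) / b) * (\<integral>\<^sup>+x\<in>C. ennreal (Y t x) \<partial>M)"
        by (intro mult_left_mono) auto
      moreover have "ennreal ((a / b) ^ (k div 2) / b) * (ennreal b * emeasure M C) = ennreal ((a / b) ^ (k div 2)) * emeasure M C"
        using assms(1,2) by (subst mult.assoc[symmetric], subst ennreal_mult[symmetric]) auto
      ultimately have "emeasure M (C \<inter> {x\<in>space M. crosses a b k (map (\<lambda>t. Y t x) ts)}) \<le>
          ennreal ((a / b) ^ (k div 2) / b) * (\<integral>\<^sup>+x\<in>C. ennreal (Y t x) \<partial>M)"
        using IHC True by simp
      moreover have "emeasure M (D \<inter> {x\<in>space M. crosses a b (Suc k) (map (\<lambda>t. Y t x) ts)}) \<le>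
          ennreal ((a / b) ^ (k div 2) / b) * (\<integral>\<^sup>+x\<in>D. ennreal (Y t x) \<partial>M)"
        using IHD True by simp
      ultimately have "emeasure M (B \<inter> {x\<in>space M. crosses a b n (map (\<lambda>t. Y t x) (t # ts))}) \<le>
          ennreal ((a / b) ^ (k div 2) / b) * (\<integral>\<^sup>+x\<in>B. ennreal (Y t x) \<partial>M)"
        unfolding split[symmetric] distrib_left using le by (meson add_mono order_trans)
      also have "\<dots> \<le> ennreal ((a / b) ^ (k div 2) / b) * (\<integral>\<^sup>+x\<in>B. ennreal (Y t0 x) \<partial>M)"
        using Cons.prems t by (intro mult_left_mono super) auto
      finally show ?thesis using True Suc by simp
    next
      case False
      then obtain j where j: "k = Suc (2 * j)" by (metis oddE Suc_eq_plus1)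
      \<comment> \<open>A value below \<open>a\<close> is awaited. On \<open>C\<close> the integral
        of \<open>Y t\<close> is at most \<open>a\<close> times the mass, which completes another
        factor \<open>a / b\<close> and returns to a bound by masses.\<close>
      have "(\<integral>\<^sup>+x\<in>C. ennreal (Y t x) \<partial>M) \<le> (\<integral>\<^sup>+x. ennreal a * indicator C x \<partial>M)"
        by (intro nn_integral_mono) (use False in \<open>auto simp: C_def R_def indicator_def intro!: ennreal_leI\<close>)
      also have "\<dots> = ennreal a * emeasure M C"
        by (simp add: nn_integral_cmult_indicator)
      finally have "ennreal ((a / b) ^ j / b) * (\<integral>\<^sup>+x\<in>C. ennreal (Y t x) \<partial>M) \<le>
          ennreal ((a / b) ^ j / b) * (ennreal a * emeasure M C)"
        by (intro mult_left_mono) auto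
      also have "\<dots> = ennreal ((a / b) ^ Suc j) * emeasure M C"
        using assms(1,2) by (subst mult.assoc[symmetric], subst ennreal_mult[symmetric]) (auto simp: mult.commute)
      finally have "emeasure M (C \<inter> {x\<in>space M. crosses a b k (map (\<lambda>t. Y t x) ts)}) \<le>
          ennreal ((a / b) ^ Suc j) * emeasure M C"
        using IHC j by (simp del: power_Suc)
      moreover have "emeasure M (D \<inter> {x\<in>space M. crosses a b (Suc k) (map (\<lambda>t. Y t x) ts)}) \<le>
          ennreal ((a / b) ^ Suc j) * emeasure M D"
        using IHD j by (simp del: power_Suc)
      ultimately have "emeasure M (B \<inter> {x\<in>space M. crosses a b n (map (\<lambda>t. Y t x) (t # ts))}) \<le>
          ennreal ((a / b) ^ Suc j) * (emeasure M C + emeasure M D)"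
        unfolding distrib_left using le by (meson add_mono order_trans)
      also have "emeasure M C + emeasure M D = emeasure M B"
        using CD by (subst plus_emeasure) auto
      finally show ?thesis using j Suc by (simp del: power_Suc)
    qed
  qed
qed

text \<open>For an even number of alternations the bound decays geometrically, so infinitely many of
  them have mass zero. For a single one it decays like the reciprocal of the level, which gives
  boundedness.\<close>

lemma AE_tame_on:
  assumes "S \<subseteq> {s..}" "countable S"
  shows "AE x in M. tame_on S (\<lambda>u. Y u x)"
proof (cases "S = {}")
  case True
  then show ?thesis by (auto simp: tame_on_def intro!: AE_I2 exI[of _ "Suc 0"])
next
  case False
  define f where "f = from_nat_into S"
  have S: "S = range f" using assms False by (simp add: f_def range_from_nat_into)
  have f: "s \<le> f m" for m using S assms(1) by blast
  define E where "E a b n m = {x\<in>space M. crosses a b n (map (\<lambda>u. Y u x) (sorted_list_of_set (f ` {..m})))}"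
    for a b n and m :: nat
  have E [measurable]: "E a b n m \<in> sets M" for a b n m
  proof -
    have "Measurable.pred (F (Max (f ` {..m}))) (\<lambda>x. crosses a b n (map (\<lambda>t. Y t x) (sorted_list_of_set (f ` {..m}))))"
      using f by (intro crosses_measurable) auto
    moreover have "s \<le> Max (f ` {..m})" using f by (auto simp: Max_ge_iff)
    ultimately show ?thesis unfolding E_def using measurable_from_subalg[OF subalg] by (metis pred_def)
  qed
  have bound: "emeasure M (\<Union>m. E a b n m) \<le>
    (if even n then ennreal ((a / b) ^ (n div 2)) * emeasure M (space M)
     else ennreal ((a / b) ^ (n div 2) / b) * (\<integral>\<^sup>+x. ennreal (Y s x) \<partial>M))" (is "_ \<le> ?c")
    if ab: "0 < a" "a < b" for a b n
  proof -
    have "incseq (E a b n)"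
    proof (rule incseq_SucI, safe)
      fix m x assume "x \<in> E a b n m"
      then show "x \<in> E a b n (Suc m)"
        unfolding E_def by (auto intro!: crosses_sorted_subset[where ts = "sorted_list_of_set (f ` {..m})"])
    qed
    then have "emeasure M (\<Union>m. E a b n m) = (SUP m. emeasure M (E a b n m))"
      by (intro SUP_emeasure_incseq[symmetric]) auto
    also have "\<dots> \<le> ?c"
    proof (rule SUP_least)
      fix m
      have "emeasure M (space M \<inter> E a b n m) \<le>
        (if even n then ennreal ((a / b) ^ (n div 2)) * emeasure M (space M)
         else ennreal ((a / b) ^ (n div 2) / b) * (\<integral>\<^sup>+x\<in>space M. ennreal (Y s x) \<partial>M))"
        unfolding E_def
        by (rule emeasure_crosses_le[OF ab]) (use f space_F[of s] sets.top[of "F s"] in auto)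
      also have "(\<integral>\<^sup>+x\<in>space M. ennreal (Y s x) \<partial>M) = (\<integral>\<^sup>+x. ennreal (Y s x) \<partial>M)"
        by (intro nn_integral_cong) auto
      finally show "emeasure M (E a b n m) \<le> ?c" by (simp add: E_def Int_def)
    qed
    finally show ?thesis .
  qed
  have "AE x in M. \<exists>n. \<forall>m. x \<notin> E a b n m" if ab: "0 < a" "a < b" for a b
  proof -
    define N where "N = (\<Inter>n. \<Union>m. E a b n m)"
    have N: "N \<in> sets M" unfolding N_def by measurable
    have "measure M N \<le> (a / b) ^ j * measure M (space M)" for j
    proof -
      have "emeasure M N \<le> emeasure M (\<Union>m. E a b (2 * j) m)"
        by (intro emeasure_mono) (auto simp: N_def)
      also have "\<dots> \<le> ennreal ((a / b) ^ j) * emeasure M (space M)"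
        using bound[OF ab, of "2 * j"] by simp
      finally show ?thesis using ab by (simp add: emeasure_eq_measure ennreal_mult[symmetric])
    qed
    moreover have "(\<lambda>j. (a / b) ^ j * measure M (space M)) \<longlonglongrightarrow> 0 * measure M (space M)"
      using ab by (intro tendsto_intros LIMSEQ_realpow_zero) auto
    ultimately have "measure M N \<le> 0 * measure M (space M)"
      by (intro LIMSEQ_le_const) auto
    then have "N \<in> null_sets M" using N by (intro null_setsI) (simp_all add: emeasure_eq_measure measure_le_0_iff)
    then show ?thesis by (rule AE_I') (auto simp: N_def)
  qed
  then have "AE x in M. \<forall>a\<in>\<rat>. \<forall>b\<in>\<rat>. 0 < a \<and> a < b \<longrightarrow> (\<exists>n. \<forall>m. x \<notin> E a b n m)"
    by (simp add: AE_ball_countable countable_rat)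
  moreover have "AE x in M. \<exists>c::nat. \<forall>m. Y (f m) x \<le> c"
  proof -
    define I where "I = enn2real (\<integral>\<^sup>+x. ennreal (Y s x) \<partial>M)"
    \<comment> \<open>The level \<open>1/2\<close> only has to satisfy \<open>0 < a < b\<close>; a
      single alternation does not involve the lower level.\<close>
    define N where "N = (\<Inter>c::nat. \<Union>m. E (1/2) (real (Suc c)) (Suc 0) m)"
    have N: "N \<in> sets M" unfolding N_def by measurable
    have "measure M N \<le> I / real (Suc c)" for c
    proof -
      have "emeasure M N \<le> emeasure M (\<Union>m. E (1/2) (real (Suc c)) (Suc 0) m)"
        by (intro emeasure_mono) (auto simp: N_def)
      also have "\<dots> \<le> ennreal (1 / real (Suc c)) * (\<integral>\<^sup>+x. ennreal (Y s x) \<partial>M)"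
        using bound[of "1/2" "real (Suc c)" "Suc 0"] by simp
      also have "(\<integral>\<^sup>+x. ennreal (Y s x) \<partial>M) = ennreal I" using fin by (simp add: I_def)
      finally show ?thesis by (simp add: emeasure_eq_measure ennreal_mult[symmetric] I_def)
    qed
    moreover have "(\<lambda>c. I / real (Suc c)) \<longlonglongrightarrow> 0"
      by (rule LIMSEQ_Suc[OF lim_const_over_n])
    ultimately have "measure M N \<le> 0" by (intro LIMSEQ_le_const) auto
    then have "N \<in> null_sets M" using N by (intro null_setsI) (simp_all add: emeasure_eq_measure measure_le_0_iff)
    then have "AE x in M. x \<notin> N" by (rule AE_not_in)
    then show ?thesis
    proof (rule AE_mp, intro AE_I2 impI)
      fix x assume "x \<in> space M" "x \<notin> N"
      then obtain c where "\<forall>m. x \<notin> E (1/2) (real (Suc c)) (Suc 0) m" unfolding N_def by blast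
      then have "\<forall>m. Y (f m) x \<le> Suc c"
        using \<open>x \<in> space M\<close> by (auto simp: E_def crosses_one not_less)
      then show "\<exists>c::nat. \<forall>m. Y (f m) x \<le> c" by blast
    qed
  qed
  ultimately show ?thesis
  proof (rule AE_mp[OF AE_conjI], intro AE_I2 impI)
    fix x assume "x \<in> space M"
      "(\<forall>a\<in>\<rat>. \<forall>b\<in>\<rat>. 0 < a \<and> a < b \<longrightarrow> (\<exists>n. \<forall>m. x \<notin> E a b n m)) \<and> (\<exists>c::nat. \<forall>m. Y (f m) x \<le> c)"
    then show "tame_on S (\<lambda>u. Y u x)" unfolding S tame_on_range E_def by simp
  qed
qed

lemma AE_convergent:
  assumes "AE x in M. \<forall>t>s. ((\<lambda>u. Y u x) \<longlongrightarrow> Y t x) (at_right t)"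
  shows "AE x in M. \<exists>l. ((\<lambda>u. Y u x) \<longlongrightarrow> l) at_top"
proof -
  have "AE x in M. tame_on (\<rat> \<inter> {s..}) (\<lambda>u. Y u x)"
    by (intro AE_tame_on) (auto intro: countable_rat)
  with assms show ?thesis
    by (rule AE_mp[OF AE_conjI], intro AE_I2 impI) (auto intro!: tame_on_tendsto_at_top nonneg)
qed

end

subsection \<open>Limits of nonnegative adapted sequences\<close>

lemma AE_le_of_set_nn_integral_le:
  fixes f g :: "'a \<Rightarrow> ennreal"
  assumes sub: "subalgebra M G" and [measurable]: "f \<in> borel_measurable G" "g \<in> borel_measurable G"
    and le: "\<And>B. B \<in> sets G \<Longrightarrow> (\<integral>\<^sup>+x\<in>B. f x \<partial>M) \<le> (\<integral>\<^sup>+x\<in>B. g x \<partial>M)"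
    and fin: "(\<integral>\<^sup>+x. g x \<partial>M) < \<infinity>"
  shows "AE x in M. f x \<le> g x"
proof -
  define B where "B = {x\<in>space G. g x < f x}"
  have BG: "B \<in> sets G" unfolding B_def by measurable
  have [measurable]: "f \<in> borel_measurable M" "g \<in> borel_measurable M"
    by (rule measurable_from_subalg[OF sub], measurable)+
  have [measurable]: "B \<in> sets M" using BG sub by (auto simp: subalgebra_def)
  have finB: "(\<integral>\<^sup>+x\<in>B. g x \<partial>M) \<noteq> \<infinity>"
  proof -
    have "(\<integral>\<^sup>+x\<in>B. g x \<partial>M) \<le> (\<integral>\<^sup>+x. g x \<partial>M)"
      by (intro nn_integral_mono) (auto simp: indicator_def)
    with fin show ?thesis by (auto simp: top_unique)
  qed
  have "(\<integral>\<^sup>+x. f x * indicator B x - g x * indicator B x \<partial>M) =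
      (\<integral>\<^sup>+x\<in>B. f x \<partial>M) - (\<integral>\<^sup>+x\<in>B. g x \<partial>M)"
  proof (rule nn_integral_diff[OF _ _ finB])
    show "AE x in M. g x * indicator B x \<le> f x * indicator B x"
      by (intro AE_I2) (auto simp: B_def indicator_def)
  qed measurable
  also have "\<dots> = 0" using le[OF BG] finB by (auto simp: diff_eq_0_iff_ennreal less_top[symmetric] top_unique)
  finally have "AE x in M. f x * indicator B x - g x * indicator B x = 0"
    by (subst (asm) nn_integral_0_iff_AE) auto
  then show ?thesis
  proof (rule AE_mp, intro AE_I2 impI)
    fix x assume x: "x \<in> space M" "f x * indicator B x - g x * indicator B x = 0"
    have "space G = space M" using sub by (simp add: subalgebra_def)
    show "f x \<le> g x"
    proof (rule ccontr)
      assume "\<not> f x \<le> g x"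
      then have "f x - g x = 0" "g x < f x"
        using x \<open>space G = space M\<close> by (auto simp: B_def indicator_def not_le)
      then show False by (auto simp: diff_eq_0_iff_ennreal)
    qed
  qed
qed

lemma AE_eq_of_le_of_nn_integral_le:
  fixes f g :: "'a \<Rightarrow> ennreal"
  assumes [measurable]: "f \<in> borel_measurable M" "g \<in> borel_measurable M"
    and le: "AE x in M. f x \<le> g x"
    and int: "(\<integral>\<^sup>+x. g x \<partial>M) \<le> (\<integral>\<^sup>+x. f x \<partial>M)" "(\<integral>\<^sup>+x. g x \<partial>M) < \<infinity>"
  shows "AE x in M. f x = g x"
proof -
  have "(\<integral>\<^sup>+x. f x \<partial>M) \<le> (\<integral>\<^sup>+x. g x \<partial>M)" by (rule nn_integral_mono_AE[OF le])
  with int have fin: "(\<integral>\<^sup>+x. f x \<partial>M) \<noteq> \<infinity>" by (auto simp: top_unique)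
  have "(\<integral>\<^sup>+x. g x - f x \<partial>M) = (\<integral>\<^sup>+x. g x \<partial>M) - (\<integral>\<^sup>+x. f x \<partial>M)"
    by (intro nn_integral_diff fin le) auto
  also have "\<dots> = 0" using int by (simp add: diff_eq_0_iff_ennreal)
  finally have "AE x in M. g x - f x = 0" by (subst (asm) nn_integral_0_iff_AE) auto
  with le show ?thesis
    by eventually_elim (auto simp: diff_eq_0_iff_ennreal intro: antisym)
qed

text \<open>Turns an identity on events of \<open>G\<close> into an equality of measures on
  \<open>G\<close>, from which integrals of all \<open>G\<close>-measurable functions can be read
  off.\<close>

lemma restr_to_subalg_eq_density:
  fixes y :: "'a \<Rightarrow> ennreal"
  assumes sub: "subalgebra \<nu> G" "subalgebra M G" and y [measurable]: "y \<in> borel_measurable G"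
    and eq: "\<And>B. B \<in> sets G \<Longrightarrow> emeasure \<nu> B = (\<integral>\<^sup>+x\<in>B. y x \<partial>M)"
  shows "restr_to_subalg \<nu> G = density (restr_to_subalg M G) y"
proof (rule measure_eqI)
  show "sets (restr_to_subalg \<nu> G) = sets (density (restr_to_subalg M G) y)"
    by (simp add: sets_restr_to_subalg sub)
  fix B assume "B \<in> sets (restr_to_subalg \<nu> G)"
  then have B: "B \<in> sets G" by (simp add: sets_restr_to_subalg[OF sub(1)])
  have "emeasure (restr_to_subalg \<nu> G) B = (\<integral>\<^sup>+x\<in>B. y x \<partial>M)"
    using eq[OF B] by (simp add: emeasure_restr_to_subalg[OF sub(1) B])
  also have "\<dots> = (\<integral>\<^sup>+x\<in>B. y x \<partial>restr_to_subalg M G)"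
    using B by (intro nn_integral_subalgebra2[symmetric] sub(2)) auto
  also have "\<dots> = emeasure (density (restr_to_subalg M G) y) B"
    using B measurable_in_subalg[OF sub(2) y]
    by (subst emeasure_density) (auto simp: sets_restr_to_subalg[OF sub(2)])
  finally show "emeasure (restr_to_subalg \<nu> G) B = \<dots>" .
qed

lemma set_nn_integral_liminf_le:
  fixes Y :: "nat \<Rightarrow> 'a \<Rightarrow> ennreal"
  assumes [measurable]: "\<And>n. Y n \<in> borel_measurable M" "B \<in> sets M"
    and lim: "AE x in M. (\<lambda>n. Y n x) \<longlonglongrightarrow> m x"
  shows "(\<integral>\<^sup>+x\<in>B. m x \<partial>M) \<le> liminf (\<lambda>n. \<integral>\<^sup>+x\<in>B. Y n x \<partial>M)"
proof -
  have "(\<integral>\<^sup>+x\<in>B. m x \<partial>M) = (\<integral>\<^sup>+x. liminf (\<lambda>n. Y n x * indicator B x) \<partial>M)"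
  proof (intro nn_integral_cong_AE)
    show "AE x in M. m x * indicator B x = liminf (\<lambda>n. Y n x * indicator B x)"
      using lim by eventually_elim (auto simp: indicator_def lim_imp_Liminf Liminf_const)
  qed
  also have "\<dots> \<le> liminf (\<lambda>n. \<integral>\<^sup>+x\<in>B. Y n x \<partial>M)"
    by (rule nn_integral_liminf) auto
  finally show ?thesis .
qed

text \<open>Truncating \<open>Y n\<close> at a constant and splitting along \<open>Y n \<le> c\<close> replaces uniform integrability.\<close>

lemma (in finite_measure) set_nn_integral_limit_ge:
  fixes Y :: "nat \<Rightarrow> 'a \<Rightarrow> ennreal"
  assumes sub: "\<And>n. subalgebra M (G n)" and adapt: "\<And>n. Y n \<in> borel_measurable (G n)"
    and [measurable]: "f \<in> borel_measurable M" "m \<in> borel_measurable M"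
    and lim: "AE x in M. (\<lambda>n. Y n x) \<longlonglongrightarrow> m x"
    and B: "\<And>n. B \<in> sets (G n)"
    and ge: "\<And>n C. C \<in> sets (G n) \<Longrightarrow> (\<integral>\<^sup>+x\<in>C. f x \<partial>M) \<le> (\<integral>\<^sup>+x\<in>C. Y n x \<partial>M)"
  shows "(\<integral>\<^sup>+x\<in>B. f x \<partial>M) \<le> (\<integral>\<^sup>+x\<in>B. m x \<partial>M)"
proof -
  have [measurable]: "B \<in> sets M" "Y n \<in> borel_measurable M" for n
    using B[of n] sub[of n] measurable_from_subalg[OF sub adapt] by (auto simp: subalgebra_def)
  have trunc: "(\<integral>\<^sup>+x\<in>B. min (f x) (of_nat c) \<partial>M) \<le> (\<integral>\<^sup>+x\<in>B. m x \<partial>M)" for c :: nat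
  proof -
    have *: "(\<integral>\<^sup>+x\<in>B. min (f x) (of_nat c) \<partial>M) \<le> (\<integral>\<^sup>+x\<in>B. min (Y n x) (of_nat c) \<partial>M)" for n
    proof -
      have [measurable]: "Y n \<in> borel_measurable (G n)" "B \<in> sets (G n)" using adapt B by auto
      \<comment> \<open>On \<open>C\<close> truncation leaves \<open>Y n\<close> unchanged and
        \<open>ge\<close> applies; on \<open>D\<close> the truncated \<open>Y n\<close> equals
        \<open>c\<close>, which dominates any truncated \<open>f\<close>.\<close>
      define C where "C = {x\<in>B. Y n x \<le> of_nat c}"
      define D where "D = {x\<in>B. \<not> Y n x \<le> of_nat c}"
      have CD: "C \<in> sets (G n)" "D \<in> sets (G n)" unfolding C_def D_def by measurable
      then have [measurable]: "C \<in> sets M" "D \<in> sets M" using sub[of n] by (auto simp: subalgebra_def)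
      have split: "(\<integral>\<^sup>+x\<in>B. h x \<partial>M) = (\<integral>\<^sup>+x\<in>C. h x \<partial>M) + (\<integral>\<^sup>+x\<in>D. h x \<partial>M)"
        if [measurable]: "h \<in> borel_measurable M" for h
        by (subst nn_integral_add[symmetric], measurable)
          (intro nn_integral_cong, auto simp: C_def D_def indicator_def)
      have "(\<integral>\<^sup>+x\<in>C. min (f x) (of_nat c) \<partial>M) \<le> (\<integral>\<^sup>+x\<in>C. f x \<partial>M)"
        by (intro nn_integral_mono mult_right_mono) auto
      also have "\<dots> \<le> (\<integral>\<^sup>+x\<in>C. Y n x \<partial>M)" using ge CD by blast
      also have "\<dots> = (\<integral>\<^sup>+x\<in>C. min (Y n x) (of_nat c) \<partial>M)"
        by (intro nn_integral_cong) (auto simp: C_def indicator_def min_absorb1)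
      finally have 1: "(\<integral>\<^sup>+x\<in>C. min (f x) (of_nat c) \<partial>M) \<le> (\<integral>\<^sup>+x\<in>C. min (Y n x) (of_nat c) \<partial>M)" .
      have 2: "(\<integral>\<^sup>+x\<in>D. min (f x) (of_nat c) \<partial>M) \<le> (\<integral>\<^sup>+x\<in>D. min (Y n x) (of_nat c) \<partial>M)"
      proof (intro nn_integral_mono)
        fix x
        show "min (f x) (of_nat c) * indicator D x \<le> min (Y n x) (of_nat c) * indicator D x"
        proof (cases "x \<in> D")
          case True
          then have "min (Y n x) (of_nat c) = of_nat c" by (simp add: D_def min_def)
          then show ?thesis by (simp add: True)
        qed simp
      qed
      show ?thesis using add_mono[OF 1 2] by (simp add: split)
    qed
    have "(\<lambda>n. \<integral>\<^sup>+x\<in>B. min (Y n x) (of_nat c) \<partial>M) \<longlonglongrightarrow> (\<integral>\<^sup>+x\<in>B. min (m x) (of_nat c) \<partial>M)"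
    proof (rule nn_integral_dominated_convergence[where w = "\<lambda>_. of_nat c"])
      show "(\<integral>\<^sup>+x. of_nat c \<partial>M) < \<infinity>"
        by (simp add: emeasure_eq_measure ennreal_mult_less_top of_nat_less_top)
      show "AE x in M. (\<lambda>n. min (Y n x) (of_nat c) * indicator B x) \<longlonglongrightarrow> min (m x) (of_nat c) * indicator B x"
        using lim by eventually_elim (auto simp: indicator_def intro!: tendsto_min)
    qed (auto simp: indicator_def)
    then have "(\<integral>\<^sup>+x\<in>B. min (f x) (of_nat c) \<partial>M) \<le> (\<integral>\<^sup>+x\<in>B. min (m x) (of_nat c) \<partial>M)"
      using * by (intro LIMSEQ_le_const) auto
    also have "\<dots> \<le> (\<integral>\<^sup>+x\<in>B. m x \<partial>M)" by (intro nn_integral_mono mult_right_mono) auto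
    finally show ?thesis .
  qed
  have "(\<lambda>c. \<integral>\<^sup>+x\<in>B. min (f x) (of_nat c) \<partial>M) \<longlonglongrightarrow> (\<integral>\<^sup>+x\<in>B. f x \<partial>M)"
  proof (rule nn_integral_LIMSEQ)
    show "incseq (\<lambda>c x. min (f x) (of_nat c) * indicator B x)"
      by (intro incseq_SucI le_funI mult_right_mono min.mono of_nat_mono) auto
    fix x
    have "(\<lambda>c. min (f x) (of_nat c)) \<longlonglongrightarrow> f x"
    proof (cases "f x = \<infinity>")
      case True
      then show ?thesis using of_nat_tendsto_top_ennreal by (simp add: min_absorb2)
    next
      case False
      then obtain k :: nat where k: "f x \<le> of_nat k"
        using ennreal_Ex_less_of_nat[of "f x"] by (auto simp: less_top intro: less_imp_le)
      show ?thesis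
      proof (rule tendsto_eventually, rule eventually_sequentiallyI[of k])
        fix c assume "k \<le> c"
        then have "f x \<le> of_nat c" using k by (meson of_nat_mono order_trans)
        then show "min (f x) (of_nat c) = f x" by (simp add: min_absorb1)
      qed
    qed
    then show "(\<lambda>c. min (f x) (of_nat c) * indicator B x) \<longlonglongrightarrow> f x * indicator B x"
      by (auto simp: indicator_def)
  qed auto
  then show ?thesis using trunc by (intro LIMSEQ_le_const2) auto
qed

text \<open>Levy's upward theorem for approximations that may exceed the conditional expectations of
  \<open>f\<close> as long as the excess vanishes in the limit. This slack is needed for
  \<open>Y / X\<close> under the restrictions of \<open>Q\<close>. The two hypotheses give equal
  integrals of \<open>f\<close> and \<open>m\<close> on a generating algebra.\<close>

lemma (in finite_measure) AE_eq_levy_limit: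
  fixes Y :: "nat \<Rightarrow> 'a \<Rightarrow> ennreal"
  assumes sub: "\<And>n. subalgebra M (G n)" and mono: "\<And>k n. k \<le> n \<Longrightarrow> sets (G k) \<subseteq> sets (G n)"
    and gen: "sets M = sigma_sets (space M) (\<Union>n. sets (G n))"
    and adapt: "\<And>n. Y n \<in> borel_measurable (G n)"
    and [measurable]: "f \<in> borel_measurable M" "m \<in> borel_measurable M"
    and fin: "(\<integral>\<^sup>+x. f x \<partial>M) < \<infinity>"
    and lim: "AE x in M. (\<lambda>n. Y n x) \<longlonglongrightarrow> m x"
    and ge: "\<And>n C. C \<in> sets (G n) \<Longrightarrow> (\<integral>\<^sup>+x\<in>C. f x \<partial>M) \<le> (\<integral>\<^sup>+x\<in>C. Y n x \<partial>M)"
    and le: "\<And>k C. C \<in> sets (G k) \<Longrightarrow> liminf (\<lambda>n. \<integral>\<^sup>+x\<in>C. Y n x \<partial>M) \<le> (\<integral>\<^sup>+x\<in>C. f x \<partial>M)"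
  shows "AE x in M. m x = f x"
proof -
  have sets: "C \<in> sets M" if "C \<in> sets (G k)" for C k using that sub[of k] by (auto simp: subalgebra_def)
  have [measurable]: "Y n \<in> borel_measurable M" for n using measurable_from_subalg[OF sub adapt] .
  have eq: "(\<integral>\<^sup>+x\<in>C. f x \<partial>M) = (\<integral>\<^sup>+x\<in>C. m x \<partial>M)" if C: "C \<in> sets (G k)" for C k
  proof (rule antisym)
    \<comment> \<open>Dropping the first \<open>k\<close> terms puts \<open>C\<close> into every
      sigma-algebra of the sequence.\<close>
    have lim': "AE x in M. (\<lambda>n. Y (n + k) x) \<longlonglongrightarrow> m x"
      using lim by eventually_elim (rule LIMSEQ_ignore_initial_segment)
    have "C \<in> sets (G (n + k))" for n using mono[of k "n + k"] C by auto
    then show "(\<integral>\<^sup>+x\<in>C. f x \<partial>M) \<le> (\<integral>\<^sup>+x\<in>C. m x \<partial>M)"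
      by (rule set_nn_integral_limit_ge[where G = "\<lambda>n. G (n + k)", OF sub adapt assms(5,6) lim' _ ge])
    have "(\<integral>\<^sup>+x\<in>C. m x \<partial>M) \<le> liminf (\<lambda>n. \<integral>\<^sup>+x\<in>C. Y n x \<partial>M)"
      by (rule set_nn_integral_liminf_le[OF _ _ lim]) (use sets[OF C] in auto)
    also have "\<dots> \<le> (\<integral>\<^sup>+x\<in>C. f x \<partial>M)" by (rule le[OF C])
    finally show "(\<integral>\<^sup>+x\<in>C. m x \<partial>M) \<le> (\<integral>\<^sup>+x\<in>C. f x \<partial>M)" .
  qed
  have "density M f = density M m"
  proof (rule measure_eqI_generator_eq[where E = "\<Union>n. sets (G n)" and \<Omega> = "space M" and A = "\<lambda>_. space M"])
    show "Int_stable (\<Union>n. sets (G n))"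
    proof (rule Int_stableI)
      fix a b assume "a \<in> (\<Union>n. sets (G n))" "b \<in> (\<Union>n. sets (G n))"
      then obtain i j where "a \<in> sets (G i)" "b \<in> sets (G j)" by auto
      then have "a \<in> sets (G (max i j))" "b \<in> sets (G (max i j))"
        using mono[of i "max i j"] mono[of j "max i j"] by auto
      then show "a \<inter> b \<in> (\<Union>n. sets (G n))" by auto
    qed
    show "(\<Union>n. sets (G n)) \<subseteq> Pow (space M)" using sets sets.sets_into_space by fastforce
    show "range (\<lambda>_. space M) \<subseteq> (\<Union>n. sets (G n))"
    proof -
      have "space M \<in> sets (G 0)" using sub[of 0] by (metis sets.top subalgebra_def)
      then show ?thesis by auto
    qed
    show "emeasure (density M f) C = emeasure (density M m) C" if "C \<in> (\<Union>n. sets (G n))" for C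
      using that eq sets by (auto simp: emeasure_density)
    show "emeasure (density M f) (space M) \<noteq> \<infinity>" for i :: nat
    proof -
      have "(\<integral>\<^sup>+x\<in>space M. f x \<partial>M) = (\<integral>\<^sup>+x. f x \<partial>M)" by (intro nn_integral_cong) auto
      with fin show ?thesis by (simp add: emeasure_density)
    qed
  qed (use gen in auto)
  then have "AE x in M. f x = m x" using fin by (subst (asm) finite_density_unique) auto
  then show ?thesis by eventually_elim simp
qed

subsection \<open>Cadlag modifications under the natural conditions\<close>

text \<open>Each value of \<open>y'\<close> is a limit of values of \<open>y\<close> at rationals
  immediately to the right, so a bound for \<open>y\<close> on the rationals of an open interval
  passes to \<open>y'\<close> on that interval. This is the fact \<open>close\<close>.\<close>

lemma cadlag_of_limits_along_Rats:
  fixes y y' :: "real \<Rightarrow> real"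
  assumes R: "\<And>t. 0 \<le> t \<Longrightarrow> (y \<longlongrightarrow> y' t) (at t within \<rat> \<inter> {t<..})"
    and L: "\<And>t. 0 < t \<Longrightarrow> \<exists>l. (y \<longlongrightarrow> l) (at t within \<rat> \<inter> {..<t})"
  shows "\<And>t. 0 \<le> t \<Longrightarrow> (y' \<longlongrightarrow> y' t) (at_right t)"
    and "\<And>t. 0 < t \<Longrightarrow> \<exists>l. (y' \<longlongrightarrow> l) (at_left t)"
proof -
  have close: "dist (y' u) l \<le> e"
    if "0 \<le> u" "u < v" "\<And>q. q \<in> \<rat> \<Longrightarrow> u < q \<Longrightarrow> q < v \<Longrightarrow> dist (y q) l \<le> e" for u v l e
  proof (rule tendsto_upperbound[OF _ _ at_within_Rats_greater_neq_bot[of u]])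
    show "((\<lambda>x. dist (y x) l) \<longlongrightarrow> dist (y' u) l) (at u within \<rat> \<inter> {u<..})"
      using R[OF \<open>0 \<le> u\<close>] by (intro tendsto_intros)
    show "\<forall>\<^sub>F x in at u within \<rat> \<inter> {u<..}. dist (y x) l \<le> e"
      unfolding eventually_at_filter
      by (rule eventually_mono[OF eventually_nhds_in_open[of "{..<v}" u]]) (use that in auto)
  qed
  show "(y' \<longlongrightarrow> y' t) (at_right t)" if t: "0 \<le> t" for t
  proof (rule tendstoI)
    fix e :: real assume "0 < e"
    then have "\<forall>\<^sub>F q in at t within \<rat> \<inter> {t<..}. dist (y q) (y' t) < e / 2"
      using R[OF t] by (intro tendstoD) auto
    then obtain d where d: "d > 0" "\<And>q. q \<in> \<rat> \<Longrightarrow> t < q \<Longrightarrow> q < t + d \<Longrightarrow> dist (y q) (y' t) < e / 2"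
      unfolding eventually_at by (auto simp: dist_real_def)
    have "dist (y' u) (y' t) < e" if "t < u" "u < t + d" for u
    proof -
      have "dist (y' u) (y' t) \<le> e / 2"
        by (rule close[of u "t + d"]) (use that t d in \<open>auto intro: less_imp_le\<close>)
      with \<open>0 < e\<close> show ?thesis by simp
    qed
    then show "\<forall>\<^sub>F u in at_right t. dist (y' u) (y' t) < e"
      unfolding eventually_at_right_field using d(1) by (intro exI[of _ "t + d"]) auto
  qed
  show "\<exists>l. (y' \<longlongrightarrow> l) (at_left t)" if t: "0 < t" for t
  proof -
    obtain l where l: "(y \<longlongrightarrow> l) (at t within \<rat> \<inter> {..<t})" using L[OF t] by blast
    have "(y' \<longlongrightarrow> l) (at_left t)"
    proof (rule tendstoI)
      fix e :: real assume "0 < e"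
      then have "\<forall>\<^sub>F q in at t within \<rat> \<inter> {..<t}. dist (y q) l < e / 2"
        using l by (intro tendstoD) auto
      then obtain d where d: "d > 0" "\<And>q. q \<in> \<rat> \<Longrightarrow> t - d < q \<Longrightarrow> q < t \<Longrightarrow> dist (y q) l < e / 2"
        unfolding eventually_at by (auto simp: dist_real_def)
      have "dist (y' u) l < e" if "max 0 (t - d) < u" "u < t" for u
      proof -
        have "dist (y' u) l \<le> e / 2"
          by (rule close[of u t]) (use that t d in \<open>auto intro: less_imp_le\<close>)
        with \<open>0 < e\<close> show ?thesis by simp
      qed
      then show "\<forall>\<^sub>F u in at_left t. dist (y' u) l < e"
        unfolding eventually_at_left_field using d(1) t by (intro exI[of _ "max 0 (t - d)"]) auto
    qed
    then show ?thesis by blast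
  qed
qed

locale natural_filtration = prob_space P for P :: "'a measure" +
  fixes F :: "real \<Rightarrow> 'a measure"
  assumes filtered: "filtered_measurable_space P F"
    and natural: "natural_conditions P F"
begin

lemma subalg: "0 \<le> t \<Longrightarrow> subalgebra P (F t)"
  and filt: "0 \<le> u \<Longrightarrow> u \<le> t \<Longrightarrow> subalgebra (F t) (F u)"
  using filtered by (auto simp: filtered_measurable_space_def)

lemma space_F: "0 \<le> t \<Longrightarrow> space (F t) = space P"
  using subalg by (simp add: subalgebra_def)

lemma sets_F: "0 \<le> t \<Longrightarrow> B \<in> sets (F t) \<Longrightarrow> B \<in> sets P"
  using subalg by (auto simp: subalgebra_def)

lemma space_in_F: "0 \<le> t \<Longrightarrow> space P \<in> sets (F t)"
  using sets.top[of "F t"] space_F[of t] by simp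

lemma sets_F_mono: "0 \<le> u \<Longrightarrow> u \<le> t \<Longrightarrow> B \<in> sets (F u) \<Longrightarrow> B \<in> sets (F t)"
  using filt by (auto simp: subalgebra_def)

lemma measurable_F_mono: "0 \<le> u \<Longrightarrow> u \<le> t \<Longrightarrow> f \<in> measurable (F u) N \<Longrightarrow> f \<in> measurable (F t) N"
  by (rule measurable_from_subalg[OF filt])

lemma measurable_F: "0 \<le> t \<Longrightarrow> f \<in> measurable (F t) N \<Longrightarrow> f \<in> measurable P N"
  by (rule measurable_from_subalg[OF subalg])

lemma sigma_finite_subalgebra_F: "0 \<le> t \<Longrightarrow> sigma_finite_subalgebra P (F t)"
  by (intro finite_measure_subalgebra_is_sigma_finite finite_measure_subalgebra.intro
      finite_measure_subalgebra_axioms.intro subalg finite_measure_axioms)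

lemma subset_null_F0:
  assumes "0 \<le> t" "A \<in> sets (F t)" "A \<in> null_sets P" "B \<subseteq> A"
  shows "B \<in> sets (F 0)"
proof -
  from natural have "\<forall>t\<ge>0. \<forall>A \<in> sets (F t) \<inter> null_sets P. \<forall>B\<subseteq>A. B \<in> sets (F 0)"
    unfolding natural_conditions_def by (rule conjunct2)
  with assms show ?thesis by blast
qed

lemma sets_F_right_continuous:
  assumes "0 \<le> t" "\<And>u. t < u \<Longrightarrow> B \<in> sets (F u)"
  shows "B \<in> sets (F t)"
proof -
  from natural have "\<forall>t\<ge>0. sets (F t) = (\<Inter>u\<in>{t<..}. sets (F u))"
    unfolding natural_conditions_def by (rule conjunct1)
  then have "sets (F t) = (\<Inter>u\<in>{t<..}. sets (F u))" using assms(1) by blast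
  with assms(2) show ?thesis by blast
qed

text \<open>The union may involve unboundedly late times and need not lie in any \<open>F t\<close>
  by construction. But the part of \<open>C\<close> inside \<open>B n\<close> is a subset of a null
  event of \<open>F (t n)\<close>, hence belongs to \<open>F 0\<close>, and countably many such
  parts make up \<open>C\<close>.\<close>

lemma null_sets_F0:
  assumes "\<And>n. 0 \<le> t n" "\<And>n. B n \<in> sets (F (t n))" "\<And>n. B n \<in> null_sets P"
    and "C \<subseteq> (\<Union>n::nat. B n)"
  shows "C \<in> sets (F 0)" "C \<in> null_sets P"
proof -
  have "C \<inter> B n \<in> sets (F 0)" for n
    using assms(1-3)[of n] by (auto intro: subset_null_F0)
  then have "(\<Union>n. C \<inter> B n) \<in> sets (F 0)" by (intro sets.countable_nat_UN) blast
  moreover have "(\<Union>n. C \<inter> B n) = C" using assms(4) by auto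
  ultimately show C: "C \<in> sets (F 0)" by simp
  have "(\<Union>n. B n) \<in> null_sets P" using assms(3) by (rule null_sets_UN)
  then show "C \<in> null_sets P" using sets_F[OF _ C] assms(4) by (auto elim!: null_sets_subset)
qed

lemma measurable_right_continuous:
  assumes "0 \<le> t" "\<And>u. t < u \<Longrightarrow> f \<in> borel_measurable (F u)"
  shows "f \<in> borel_measurable (F t)"
proof (rule measurableI)
  fix B :: "'b set" assume "B \<in> sets borel"
  then have "f -` B \<inter> space P \<in> sets (F u)" if "t < u" for u
    using measurable_sets[OF assms(2)[OF that], of B] space_F[of u] assms(1) that by simp
  then show "f -` B \<inter> space (F t) \<in> sets (F t)"
    using sets_F_right_continuous[OF assms(1)] space_F[OF assms(1)] by simp
qed auto

text \<open>The new process consists of right limits along the rationals, set to zero on the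
  exceptional set. Right-continuity of the filtration makes it adapted, and constancy of the
  integrals makes it agree with \<open>Y\<close> at each time.\<close>

lemma cadlag_modification:
  assumes adapt: "\<And>t. 0 \<le> t \<Longrightarrow> Y t \<in> borel_measurable (F t)"
    and nonneg: "\<And>t x. 0 \<le> t \<Longrightarrow> x \<in> space P \<Longrightarrow> 0 \<le> Y t x"
    and mart: "\<And>u t B. 0 \<le> u \<Longrightarrow> u \<le> t \<Longrightarrow> B \<in> sets (F u) \<Longrightarrow>
      (\<integral>\<^sup>+x\<in>B. ennreal (Y t x) \<partial>P) = (\<integral>\<^sup>+x\<in>B. ennreal (Y u x) \<partial>P)"
    and fin: "(\<integral>\<^sup>+x. ennreal (Y 0 x) \<partial>P) < \<infinity>"
  obtains Y' where "cadlag P Y'" "adapted F Y'" "nonneg_process P Y'"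
    "\<And>t. 0 \<le> t \<Longrightarrow> AE x in P. Y' t x = Y t x"
proof -
  interpret Y: nonneg_supermartingale P F Y 0
    by unfold_locales (rule subalg filt adapt nonneg mart[THEN eq_refl] fin; assumption)+
  \<comment> \<open>Tameness is tested on bounded windows because its failure on
    \<open>{0..n}\<close> is an event of \<open>F n\<close>, whereas failure over all rational times
    need not be an event of any \<open>F t\<close>.\<close>
  define bad where "bad = {x\<in>space P. \<exists>n::nat. \<not> tame_on (\<rat> \<inter> {0..real n}) (\<lambda>u. Y u x)}"
  define B where "B n = {x\<in>space P. \<not> tame_on (\<rat> \<inter> {0..real n}) (\<lambda>u. Y u x)}" for n
  have BF: "B n \<in> sets (F (real n))" for n
  proof -
    have "Measurable.pred (F (real n)) (\<lambda>x. tame_on (\<rat> \<inter> {0..real n}) (\<lambda>u. Y u x))"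
      by (intro Y.tame_on_measurable) (auto intro: countable_rat)
    then have "{x\<in>space (F (real n)). \<not> tame_on (\<rat> \<inter> {0..real n}) (\<lambda>u. Y u x)} \<in> sets (F (real n))"
      by measurable
    then show ?thesis by (simp add: space_F B_def)
  qed
  have BN: "B n \<in> null_sets P" for n
  proof -
    have "AE x in P. tame_on (\<rat> \<inter> {0..real n}) (\<lambda>u. Y u x)"
      by (intro Y.AE_tame_on) (auto intro: countable_rat)
    then show ?thesis
      unfolding B_def using sets_F[OF _ BF[of n]] by (subst (asm) AE_iff_null) (auto simp: B_def)
  qed
  have "bad \<subseteq> (\<Union>n. B n)" by (auto simp: bad_def B_def)
  note bad = null_sets_F0[of real B, OF _ BF BN this, simplified]
  define Y' where "Y' t x = (if x \<in> bad then 0 else Lim (at t within \<rat> \<inter> {t<..}) (\<lambda>u. Y u x))" for t x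
  have tame: "tame_on (\<rat> \<inter> {0..real n}) (\<lambda>u. Y u x)" if "x \<in> space P" "x \<notin> bad" for x n
    using that by (auto simp: bad_def)
  have right: "((\<lambda>u. Y u x) \<longlongrightarrow> Y' t x) (at t within \<rat> \<inter> {t<..})"
    if *: "x \<in> space P" "x \<notin> bad" "0 \<le> t" for x t
  proof -
    obtain n :: nat where "t < real n" using reals_Archimedean2 by blast
    moreover have "\<forall>t\<ge>0. 0 \<le> Y t x" using nonneg *(1) by auto
    ultimately obtain l where "((\<lambda>u. Y u x) \<longlongrightarrow> l) (at t within \<rat> \<inter> {t<..})"
      using tame_on_tendsto_at_right[OF tame[OF *(1,2), of n] _ *(3)] by blast
    moreover from this have "Y' t x = l"
      using *(2) by (simp add: Y'_def tendsto_Lim[OF at_within_Rats_greater_neq_bot])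
    ultimately show ?thesis by simp
  qed
  have left: "\<exists>l. ((\<lambda>u. Y u x) \<longlongrightarrow> l) (at t within \<rat> \<inter> {..<t})"
    if *: "x \<in> space P" "x \<notin> bad" "0 < t" for x t
  proof -
    obtain n :: nat where "t < real n" using reals_Archimedean2 by blast
    moreover have "\<forall>t\<ge>0. 0 \<le> Y t x" using nonneg *(1) by auto
    ultimately show ?thesis
      using tame_on_tendsto_at_left[OF tame[OF *(1,2), of n] _ *(3)] by simp
  qed
  have cadlag: "cadlag P Y'"
    unfolding cadlag_def
  proof (intro ballI)
    fix x assume x: "x \<in> space P"
    show "(\<forall>t\<ge>0. ((\<lambda>s. Y' s x) \<longlongrightarrow> Y' t x) (at_right t)) \<and>
      (\<forall>t>0. \<exists>l. ((\<lambda>s. Y' s x) \<longlongrightarrow> l) (at_left t))"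
    proof (cases "x \<in> bad")
      case True
      then have "Y' s x = 0" for s by (simp add: Y'_def)
      then show ?thesis by (auto intro!: tendsto_const)
    next
      case False
      show ?thesis
        using cadlag_of_limits_along_Rats[of "\<lambda>u. Y u x" "\<lambda>u. Y' u x", OF right[OF x False] left[OF x False]]
        by auto
    qed
  qed
  have nonneg': "nonneg_process P Y'"
    unfolding nonneg_process_def
  proof (intro ballI allI impI)
    fix x and t :: real assume "x \<in> space P" "0 \<le> t"
    show "0 \<le> Y' t x"
    proof (cases "x \<in> bad")
      case False
      have "\<forall>\<^sub>F u in at t within \<rat> \<inter> {t<..}. 0 \<le> Y u x"
        unfolding eventually_at_filter using \<open>0 \<le> t\<close> \<open>x \<in> space P\<close>
        by (intro always_eventually) (auto intro!: nonneg)
      then show ?thesis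
        by (rule tendsto_lowerbound[OF right[OF \<open>x \<in> space P\<close> False \<open>0 \<le> t\<close>] _
              at_within_Rats_greater_neq_bot])
    qed (simp add: Y'_def)
  qed
  have seq: "\<exists>q. (\<forall>n. t < q n \<and> q n < u) \<and> (\<forall>x\<in>space P - bad. (\<lambda>n. Y (q n) x) \<longlonglongrightarrow> Y' t x)"
    if "0 \<le> t" "t < u" for t u
  proof -
    have "\<exists>q. q \<in> \<rat> \<and> t < q \<and> q < t + (u - t) / real (Suc n)" for n :: nat
    proof -
      have "t < t + (u - t) / real (Suc n)" using \<open>t < u\<close> by simp
      from Rats_dense_in_real[OF this] show ?thesis by blast
    qed
    then obtain q where q: "\<And>n. q n \<in> \<rat>" "\<And>n::nat. t < q n" "\<And>n. q n < t + (u - t) / real (Suc n)"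
      by metis
    have "q \<longlonglongrightarrow> t"
    proof (rule tendsto_sandwich)
      show "\<forall>\<^sub>F n in sequentially. t \<le> q n" "\<forall>\<^sub>F n in sequentially. q n \<le> t + (u - t) / real (Suc n)"
        using q by (auto intro!: always_eventually less_imp_le)
      show "(\<lambda>n. t + (u - t) / real (Suc n)) \<longlonglongrightarrow> t"
        using tendsto_add[OF tendsto_const LIMSEQ_Suc[OF lim_const_over_n]] by force
    qed simp
    moreover have "q n \<in> \<rat> \<inter> {t<..} \<and> q n \<noteq> t" for n using q(1,2)[of n] by auto
    ultimately have lim: "filterlim q (at t within \<rat> \<inter> {t<..}) sequentially"
      unfolding filterlim_at by simp
    have "q n < u" for n
    proof -
      have "(u - t) / real (Suc n) \<le> u - t" using that by (simp add: divide_le_eq)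
      then show ?thesis using q(3)[of n] by linarith
    qed
    moreover have "(\<lambda>n. Y (q n) x) \<longlonglongrightarrow> Y' t x" if "x \<in> space P - bad" for x
      using filterlim_compose[OF right lim] that \<open>0 \<le> t\<close> by auto
    ultimately show ?thesis using q(2) by blast
  qed
  \<comment> \<open>For every \<open>u > t\<close> the limit is taken along times between
    \<open>t\<close> and \<open>u\<close>; right-continuity of the filtration then lets
    \<open>u\<close> decrease to \<open>t\<close>.\<close>
  have adapt': "Y' t \<in> borel_measurable (F t)" if t: "0 \<le> t" for t
  proof (rule measurable_right_continuous[OF t])
    fix u assume "t < u"
    then obtain q where q: "\<And>n. t < q n \<and> q n < u" "\<And>x. x \<in> space P - bad \<Longrightarrow> (\<lambda>n. Y (q n) x) \<longlonglongrightarrow> Y' t x"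
      using seq[OF t] by blast
    have [measurable]: "bad \<in> sets (F u)" using sets_F_mono[OF _ _ bad(1), of u] t \<open>t < u\<close> by auto
    have [measurable]: "Y (q n) \<in> borel_measurable (F u)" for n
      using q(1)[of n] t by (intro measurable_F_mono[OF _ _ adapt]) auto
    show "Y' t \<in> borel_measurable (F u)"
    proof (rule borel_measurable_LIMSEQ_real[where u = "\<lambda>n x. if x \<in> bad then 0 else Y (q n) x"])
      show "(\<lambda>n. if x \<in> bad then 0 else Y (q n) x) \<longlonglongrightarrow> Y' t x" if "x \<in> space (F u)" for x
        using q(2)[of x] that space_F[of u] t \<open>t < u\<close> by (auto simp: Y'_def)
    qed measurable
  qed
  have modif: "AE x in P. Y' t x = Y t x" if t: "0 \<le> t" for t
  proof -
    obtain q where q: "\<And>n. t < q n \<and> q n < t + 1" "\<And>x. x \<in> space P - bad \<Longrightarrow> (\<lambda>n. Y (q n) x) \<longlonglongrightarrow> Y' t x"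
      using seq[OF t, of "t + 1"] by auto
    have [measurable]: "Y' t \<in> borel_measurable (F t)" "Y t \<in> borel_measurable (F t)"
      "Y t \<in> borel_measurable P" "Y' t \<in> borel_measurable P" "Y (t + 1) \<in> borel_measurable P"
      "Y (q n) \<in> borel_measurable P" for n
      using adapt' adapt measurable_F[OF _ adapt] measurable_F[OF _ adapt'] t q(1)[of n] by auto
    have lim: "AE x in P. (\<lambda>n. ennreal (Y (q n) x)) \<longlonglongrightarrow> ennreal (Y' t x)"
    proof (rule AE_mp[OF AE_not_in[OF bad(2)]], intro AE_I2 impI)
      fix x assume "x \<in> space P" "x \<notin> bad"
      then show "(\<lambda>n. ennreal (Y (q n) x)) \<longlonglongrightarrow> ennreal (Y' t x)" using q(2) by (intro tendsto_ennrealI) auto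
    qed
    have fin': "(\<integral>\<^sup>+x. ennreal (Y t x) \<partial>P) < \<infinity>"
    proof -
      have "(\<integral>\<^sup>+x\<in>space P. ennreal (Y v x) \<partial>P) = (\<integral>\<^sup>+x. ennreal (Y v x) \<partial>P)" for v
        by (intro nn_integral_cong) auto
      then show ?thesis using mart[of 0 t "space P"] t fin sets.top[of "F 0"] space_F[of 0] by simp
    qed
    \<comment> \<open>Fatou's lemma along \<open>q\<close> gives one inequality almost surely;
      equality will follow from equality of means.\<close>
    have "AE x in P. ennreal (Y' t x) \<le> ennreal (Y t x)"
    proof (rule AE_le_of_set_nn_integral_le[OF subalg[OF t] _ _ _ fin'])
      fix B assume B: "B \<in> sets (F t)"
      have "(\<integral>\<^sup>+x\<in>B. ennreal (Y' t x) \<partial>P) \<le> liminf (\<lambda>n. \<integral>\<^sup>+x\<in>B. ennreal (Y (q n) x) \<partial>P)"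
        using sets_F[OF t B] by (intro set_nn_integral_liminf_le lim) auto
      also have "\<dots> = (\<integral>\<^sup>+x\<in>B. ennreal (Y t x) \<partial>P)"
      proof -
        have "(\<integral>\<^sup>+x\<in>B. ennreal (Y (q n) x) \<partial>P) = (\<integral>\<^sup>+x\<in>B. ennreal (Y t x) \<partial>P)" for n
          using q(1)[of n] by (intro mart[OF t _ B]) auto
        then show ?thesis by (simp add: Liminf_const)
      qed
      finally show "(\<integral>\<^sup>+x\<in>B. ennreal (Y' t x) \<partial>P) \<le> (\<integral>\<^sup>+x\<in>B. ennreal (Y t x) \<partial>P)" .
    qed auto
    \<comment> \<open>No mass is lost in the limit, because \<open>Y (t + 1)\<close> closes the
      martingale at all times \<open>q n\<close>, so the truncation argument applies with
      \<open>Y (t + 1)\<close> as lower bound.\<close>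
    moreover have "(\<integral>\<^sup>+x. ennreal (Y t x) \<partial>P) \<le> (\<integral>\<^sup>+x. ennreal (Y' t x) \<partial>P)"
    proof -
      have spq: "space P \<in> sets (F v)" if "0 \<le> v" for v
        using sets.top[of "F v"] space_F[OF that] by simp
      have "(\<integral>\<^sup>+x\<in>space P. ennreal (Y (t + 1) x) \<partial>P) \<le> (\<integral>\<^sup>+x\<in>space P. ennreal (Y' t x) \<partial>P)"
      proof (rule set_nn_integral_limit_ge[where G = "\<lambda>n. F (q n)", OF _ _ _ _ lim])
        fix n
        have qn: "0 \<le> q n" "q n \<le> t + 1" using q(1)[of n] t by auto
        show "subalgebra P (F (q n))" "space P \<in> sets (F (q n))" using subalg spq qn by auto
        show "(\<lambda>x. ennreal (Y (q n) x)) \<in> borel_measurable (F (q n))"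
          using adapt[OF qn(1)] by measurable
        show "(\<integral>\<^sup>+x\<in>C. ennreal (Y (t + 1) x) \<partial>P) \<le> (\<integral>\<^sup>+x\<in>C. ennreal (Y (q n) x) \<partial>P)"
          if "C \<in> sets (F (q n))" for C
          using mart[OF qn that] by (rule eq_refl)
      qed auto
      moreover have "(\<integral>\<^sup>+x\<in>space P. f x \<partial>P) = (\<integral>\<^sup>+x. f x \<partial>P)" for f :: "'a \<Rightarrow> ennreal"
        by (intro nn_integral_cong) auto
      ultimately show ?thesis using mart[OF t _ spq[OF t], of "t + 1"] by simp
    qed
    ultimately have "AE x in P. ennreal (Y' t x) = ennreal (Y t x)"
      by (intro AE_eq_of_le_of_nn_integral_le fin') auto
    then show ?thesis
      by (rule AE_mp, intro AE_I2 impI)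
        (use nonneg[OF t] nonneg' t in \<open>auto simp: nonneg_process_def\<close>)
  qed
  show thesis
    by (rule that[OF cadlag _ nonneg' modif]) (auto simp: adapted_def adapt')
qed

end

subsection \<open>The natural enlargement\<close>

lemma property_NP_natural_conditions: "property_NP P F \<Longrightarrow> natural_conditions P F"
  by (auto simp: property_NP_def natural_enlargement_def)

text \<open>The restriction of \<open>P\<close> to the generated \<open>\<sigma>\<close>-algebra is itself an extension satisfying the natural
  conditions, hence minimality of the enlargement applies.\<close>

lemma property_NP_generated:
  assumes "property_NP P F"
  shows "sets P = sigma_sets (space P) (\<Union>t\<in>{0..}. sets (F t))"
proof -
  obtain P0 F0 where P0: "property_P P0 F0" and ne: "natural_enlargement P0 F0 P F"
    using assms unfolding property_NP_def by (elim exE conjE)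
  have ext: "filtered_extension P0 F0 P F" and nat: "natural_conditions P F"
    and min: "\<And>P' F'. filtered_extension P0 F0 P' F' \<Longrightarrow> natural_conditions P' F' \<Longrightarrow> filtered_extension P F P' F'"
    using ne unfolding natural_enlargement_def by (elim conjE, simp)+
  have sub: "\<And>t. 0 \<le> t \<Longrightarrow> subalgebra P (F t)"
    and filt: "\<And>s t. 0 \<le> s \<Longrightarrow> s \<le> t \<Longrightarrow> subalgebra (F t) (F s)"
    and "prob_space P" and sp: "space P = space P0"
    and F0F: "\<And>t. 0 \<le> t \<Longrightarrow> sets (F0 t) \<subseteq> sets (F t)"
    and em: "\<And>A. A \<in> sets P0 \<Longrightarrow> emeasure P A = emeasure P0 A"
    and fp0: "filtered_prob_space P0 F0"
    using ext by (simp_all add: filtered_extension_def filtered_prob_space_def filtered_measurable_space_def)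
  define U where "U = (\<Union>t\<in>{0..}. sets (F t))"
  define S where "S = sigma (space P) U"
  have U: "U \<subseteq> sets P" "U \<subseteq> Pow (space P)"
  proof -
    show "U \<subseteq> sets P" using sub unfolding U_def by (auto simp: subalgebra_def)
    then show "U \<subseteq> Pow (space P)" using sets.space_closed by (rule subset_trans)
  qed
  have S: "sets S = sigma_sets (space P) U" "space S = space P"
    using U by (simp_all add: S_def)
  have subS: "subalgebra P S"
    using sets.sigma_sets_subset[OF U(1)] by (simp add: subalgebra_def S)
  define P' where "P' = restr_to_subalg P S"
  have P': "sets P' = sets S" "space P' = space P"
    and emP': "\<And>A. A \<in> sets S \<Longrightarrow> emeasure P' A = emeasure P A"
    unfolding P'_def by (simp_all add: sets_restr_to_subalg subS space_restr_to_subalg emeasure_restr_to_subalg)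
  have FS: "sets (F t) \<subseteq> sets S" if "0 \<le> t" for t
    using that by (auto simp: S U_def)
  have setsP0: "sets P0 \<subseteq> sets S"
  proof -
    have "sets P0 = sigma_sets (space P0) (\<Union>t\<in>{0..}. sets (F0 t))"
      using P0 unfolding property_P_def by (elim conjE)
    also have "\<dots> \<subseteq> sigma_sets (space P) U"
      unfolding sp by (intro sigma_sets_mono') (use F0F in \<open>auto simp: U_def\<close>)
    finally show ?thesis by (simp add: S)
  qed
  have "filtered_prob_space P' F"
    unfolding filtered_prob_space_def filtered_measurable_space_def
    using prob_space_restr_to_subalg[OF subS \<open>prob_space P\<close>] filt FS sub
    by (auto simp: P'_def[symmetric] subalgebra_def P')
  then have "filtered_extension P0 F0 P' F"
    unfolding filtered_extension_def using fp0 F0F setsP0 em emP' sp by (auto simp: P')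
  moreover have "natural_conditions P' F"
    unfolding natural_conditions_def
  proof (intro conjI)
    show "\<forall>t\<ge>0. sets (F t) = (\<Inter>u\<in>{t<..}. sets (F u))"
      using nat unfolding natural_conditions_def by (rule conjunct1)
    have "\<forall>t\<ge>0. \<forall>A \<in> sets (F t) \<inter> null_sets P. \<forall>B\<subseteq>A. B \<in> sets (F 0)"
      using nat unfolding natural_conditions_def by (rule conjunct2)
    moreover have "null_sets P' \<subseteq> null_sets P"
      unfolding P'_def null_sets_restr_to_subalg[OF subS] by simp
    ultimately show "\<forall>t\<ge>0. \<forall>A \<in> sets (F t) \<inter> null_sets P'. \<forall>B\<subseteq>A. B \<in> sets (F 0)" by blast
  qed
  ultimately have "filtered_extension P F P' F" by (rule min)
  then have "sets P \<subseteq> sets S" by (simp add: filtered_extension_def P')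
  with subS show ?thesis by (auto simp: subalgebra_def S U_def[symmetric])
qed

text \<open>Since \<open>a\<close> is nondecreasing and starts at or above \<open>c\<close>, the
  indices with \<open>a i = c\<close> form an initial segment. Along it all increments vanish except
  possibly the last, the one that leaves \<open>c\<close>.\<close>

lemma sum_constant_increments_le:
  fixes a :: "nat \<Rightarrow> real"
  assumes "\<And>i. i < k \<Longrightarrow> a i \<le> a (Suc i)" "\<And>i. i < k \<Longrightarrow> a (Suc i) - a i \<le> e" "0 \<le> e" "c \<le> a 0"
  shows "(\<Sum>i<k. if a i = c then a (Suc i) - a i else 0) \<le> e"
    and "a k = c \<Longrightarrow> (\<Sum>i<k. if a i = c then a (Suc i) - a i else 0) = 0"
proof -
  have "c \<le> a k \<and> (\<Sum>i<k. if a i = c then a (Suc i) - a i else 0) \<le> e \<and>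
    (a k = c \<longrightarrow> (\<Sum>i<k. if a i = c then a (Suc i) - a i else 0) = 0)"
    using assms
  proof (induction k)
    case (Suc k)
    then have IH: "c \<le> a k" "(\<Sum>i<k. if a i = c then a (Suc i) - a i else 0) \<le> e"
      "a k = c \<longrightarrow> (\<Sum>i<k. if a i = c then a (Suc i) - a i else 0) = 0"
      by auto
    have "a k \<le> a (Suc k)" "a (Suc k) - a k \<le> e" using Suc.prems by auto
    with IH show ?case by auto
  qed auto
  then show "(\<Sum>i<k. if a i = c then a (Suc i) - a i else 0) \<le> e"
    and "a k = c \<Longrightarrow> (\<Sum>i<k. if a i = c then a (Suc i) - a i else 0) = 0"
    by auto
qed

subsection \<open>The measure \<open>\<Q>\<close> and the process \<open>A\<close>\<close>

locale class_Sigma_measure = natural_filtration P F for P :: "'a measure" and F +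
  fixes X N A :: "real \<Rightarrow> 'a \<Rightarrow> real" and Q :: "'a measure"
  assumes Sigma: "class_Sigma P F X N A"
    and assoc: "associated_measure P F X Q"
    and generated: "sets P = sigma_sets (space P) (\<Union>t\<in>{0..}. sets (F t))"
begin

lemma X_nonneg: "0 \<le> t \<Longrightarrow> x \<in> space P \<Longrightarrow> 0 \<le> X t x"
  and X_adapt: "0 \<le> t \<Longrightarrow> X t \<in> borel_measurable (F t)"
  and X_int: "0 \<le> t \<Longrightarrow> integrable P (X t)"
  and X_eq: "\<And>t x. 0 \<le> t \<Longrightarrow> x \<in> space P \<Longrightarrow> X t x = N t x + A t x"
  and A_adapt: "0 \<le> t \<Longrightarrow> A t \<in> borel_measurable (F t)"
  and A_cont: "\<And>x. x \<in> space P \<Longrightarrow> continuous_on {0..} (\<lambda>t. A t x)"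
  and A_mono_on: "\<And>x. x \<in> space P \<Longrightarrow> mono_on {0..} (\<lambda>t. A t x)"
  and A_0: "\<And>x. x \<in> space P \<Longrightarrow> A 0 x = 0"
  and dA_carried: "\<And>x. x \<in> space P \<Longrightarrow> {t. 0 \<le> t \<and> X t x \<noteq> 0} \<in> null_sets (interval_measure (\<lambda>t. A (max 0 t) x))"
  and N_cadlag: "cadlag P N" and N_mart: "martingale P F N"
  using Sigma unfolding class_Sigma_def nonneg_process_def submartingale_def adapted_def by blast+

lemma A_mono: "x \<in> space P \<Longrightarrow> 0 \<le> s \<Longrightarrow> s \<le> t \<Longrightarrow> A s x \<le> A t x"
  using A_mono_on[of x] by (auto simp: mono_on_def)

lemma A_nonneg: "x \<in> space P \<Longrightarrow> 0 \<le> t \<Longrightarrow> 0 \<le> A t x"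
  using A_mono[of x 0 t] A_0[of x] by simp

lemma X_right_continuous:
  assumes "x \<in> space P" "0 \<le> t"
  shows "((\<lambda>u. X u x) \<longlongrightarrow> X t x) (at_right t)"
proof -
  have "((\<lambda>u. A u x) \<longlongrightarrow> A t x) (at t within {0..})"
    using A_cont[OF assms(1)] assms(2) by (simp add: continuous_on_def)
  then have "((\<lambda>u. A u x) \<longlongrightarrow> A t x) (at_right t)"
    by (rule tendsto_within_subset) (use assms in auto)
  moreover have "((\<lambda>u. N u x) \<longlongrightarrow> N t x) (at_right t)"
    using N_cadlag assms by (simp add: cadlag_def)
  ultimately have "((\<lambda>u. N u x + A u x) \<longlongrightarrow> N t x + A t x) (at_right t)"
    by (intro tendsto_add)
  then have "((\<lambda>u. N u x + A u x) \<longlongrightarrow> X t x) (at_right t)" using X_eq assms by simp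
  then show ?thesis
  proof (rule Lim_transform_eventually)
    show "\<forall>\<^sub>F u in at_right t. N u x + A u x = X u x"
      unfolding eventually_at_filter using assms X_eq by (intro always_eventually) auto
  qed
qed

lemma sets_Q [measurable_cong]: "sets Q = sets P"
  using assoc by (simp add: associated_measure_def)

lemma space_Q: "space Q = space P"
  by (rule sets_eq_imp_space_eq[OF sets_Q])

definition G :: "real \<Rightarrow> 'a set" where
  "G t = {x\<in>space P. last_zero X x \<le> ennreal t}"

lemma G_mono: "s \<le> t \<Longrightarrow> G s \<subseteq> G t"
  by (auto simp: G_def intro: order_trans ennreal_leI)

lemma has_integral_Q:
  assumes "0 \<le> t" "B \<in> sets (F t)"
  shows "has_bochner_integral Q (\<lambda>x. indicator B x * indicator {x. last_zero X x \<le> ennreal t} x :: real)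
          (\<integral>x. indicator B x * X t x \<partial>P)"
proof -
  have "bounded_measurable (F t) (indicator B)"
    using assms by (auto simp: bounded_measurable_def intro!: boundedI[of _ 1] simp: indicator_def)
  then show ?thesis using assoc assms(1) unfolding associated_measure_def by blast
qed

text \<open>The event is described by a supremum over uncountably many times. Its measurability is
  read off from the integrability of its indicator, which is part of the characterisation of
  \<open>Q\<close>.\<close>

lemma G_sets [measurable]:
  assumes "0 \<le> t"
  shows "G t \<in> sets P"
proof -
  have "space P \<in> sets (F t)" using sets.top[of "F t"] space_F[OF assms] by simp
  from has_integral_Q[OF assms this]
  have [measurable]: "(\<lambda>x. indicator (space P) x * indicator {x. last_zero X x \<le> ennreal t} x :: real) \<in> borel_measurable P"
    by (auto dest: borel_measurable_has_bochner_integral cong: measurable_cong_sets simp: measurable_cong_sets[OF sets_Q refl])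
  have "{x\<in>space P. indicator (space P) x * indicator {x. last_zero X x \<le> ennreal t} x = (1::real)} \<in> sets P"
    by measurable
  also have "{x\<in>space P. indicator (space P) x * indicator {x. last_zero X x \<le> ennreal t} x = (1::real)} = G t"
    by (auto simp: G_def indicator_def split: if_splits)
  finally show ?thesis .
qed

lemma AE_Q_in_G: "AE x in Q. \<exists>n::nat. x \<in> G (real n)"
proof -
  have "{x\<in>space Q. last_zero X x = \<infinity>} \<in> null_sets Q"
    using assoc by (simp add: associated_measure_def)
  then have "AE x in Q. x \<notin> {x\<in>space Q. last_zero X x = \<infinity>}" by (rule AE_not_in)
  then show ?thesis
  proof (rule AE_mp, intro AE_I2 impI)
    fix x assume x: "x \<in> space Q" "x \<notin> {x\<in>space Q. last_zero X x = \<infinity>}"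
    then have "last_zero X x < top" by (simp add: less_top)
    then obtain n where "last_zero X x < of_nat n" using ennreal_Ex_less_of_nat by blast
    then show "\<exists>n::nat. x \<in> G (real n)"
      using x(1) by (intro exI[of _ n]) (simp add: G_def space_Q ennreal_of_nat_eq_real_of_nat less_imp_le)
  qed
qed

lemma X_nonzero:
  assumes "x \<in> G s" "s < t" "0 \<le> s"
  shows "X t x \<noteq> 0"
proof
  assume "X t x = 0"
  then have "ennreal t \<le> last_zero X x"
    unfolding last_zero_def using assms by (intro SUP_upper) auto
  also have "\<dots> \<le> ennreal s" using assms by (simp add: G_def)
  finally show False using assms by (simp add: ennreal_le_iff)
qed

text \<open>After the last zero the interval \<open>{s<..t}\<close> avoids the zeros of
  \<open>X\<close>, so \<open>dA\<close> does not charge it. The left end is excluded because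
  \<open>X\<close> may vanish at \<open>s\<close>.\<close>

lemma A_constant:
  assumes "x \<in> G s" "0 \<le> s" "s \<le> t"
  shows "A t x = A s x"
proof -
  have x: "x \<in> space P" using assms by (simp add: G_def)
  define a where "a u = A (max 0 u) x" for u
  have "mono a" using A_mono[OF x] by (auto simp: mono_def a_def)
  moreover have "continuous_on UNIV a"
    unfolding a_def
    by (rule continuous_on_compose2[OF A_cont[OF x]]) (auto intro!: continuous_intros)
  then have "continuous (at_right u) a" for u
    by (simp add: continuous_on_eq_continuous_at continuous_at_imp_continuous_at_within)
  ultimately have "emeasure (interval_measure a) {s<..t} = ennreal (a t - a s)"
    using assms by (intro emeasure_interval_measure_Ioc) (auto simp: mono_def)
  moreover have "{s<..t} \<in> null_sets (interval_measure a)"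
  proof (rule null_sets_subset)
    show "{u. 0 \<le> u \<and> X u x \<noteq> 0} \<in> null_sets (interval_measure a)"
      using dA_carried[OF x] unfolding a_def .
    show "{s<..t} \<subseteq> {u. 0 \<le> u \<and> X u x \<noteq> 0}" using X_nonzero assms by auto
  qed simp
  ultimately have "ennreal (a t - a s) = 0" by (metis null_setsD1)
  then have "A t x \<le> A s x" using assms by (simp add: a_def ennreal_eq_0_iff)
  with A_mono[OF x assms(2,3)] show ?thesis by simp
qed

text \<open>On \<open>F t\<close>, the restriction of \<open>Q\<close> to \<open>G t\<close> has
  density \<open>X t\<close> with respect to \<open>P\<close>. Equality on events suffices once both
  measures are restricted to \<open>F t\<close>.\<close>

lemma nn_integral_Q_G:
  fixes h :: "'a \<Rightarrow> ennreal"
  assumes t: "0 \<le> t" and h: "h \<in> borel_measurable (F t)"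
  shows "(\<integral>\<^sup>+x\<in>G t. h x \<partial>Q) = (\<integral>\<^sup>+x. h x * ennreal (X t x) \<partial>P)"
proof -
  have [measurable]: "X t \<in> borel_measurable P" "X t \<in> borel_measurable (F t)" "h \<in> borel_measurable P"
    "G t \<in> sets Q" "G t \<in> sets P" "h \<in> borel_measurable Q" "h \<in> borel_measurable (F t)"
    using measurable_F[OF t X_adapt[OF t]] X_adapt[OF t] measurable_F[OF t h] G_sets[OF t] h
    by (simp_all add: sets_Q measurable_cong_sets[OF sets_Q refl])
  define \<nu> where "\<nu> = density Q (indicator (G t))"
  have sub\<nu>: "subalgebra \<nu> (F t)"
    using subalg[OF t] by (simp add: \<nu>_def subalgebra_def sets_Q space_Q)
  have "restr_to_subalg \<nu> (F t) = density (restr_to_subalg P (F t)) (\<lambda>x. ennreal (X t x))"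
  proof (rule restr_to_subalg_eq_density[OF sub\<nu> subalg[OF t]])
    fix B assume B: "B \<in> sets (F t)"
    then have [measurable]: "B \<in> sets P" "B \<in> sets Q" using sets_F[OF t] sets_Q by auto
    have BX: "integrable P (\<lambda>x. indicator B x * X t x)"
      using integrable_mult_indicator[OF \<open>B \<in> sets P\<close> X_int[OF t]] by simp
    have "emeasure \<nu> B = (\<integral>\<^sup>+x. indicator (G t) x * indicator B x \<partial>Q)"
      unfolding \<nu>_def by (subst emeasure_density) auto
    also have "\<dots> = (\<integral>\<^sup>+x. ennreal (indicator B x * indicator {x. last_zero X x \<le> ennreal t} x) \<partial>Q)"
      by (intro nn_integral_cong) (auto simp: G_def space_Q indicator_def)
    also have "\<dots> = ennreal (\<integral>x. indicator B x * X t x \<partial>P)"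
      using has_integral_Q[OF t B]
      by (subst nn_integral_eq_integral) (auto simp: has_bochner_integral_iff)
    also have "\<dots> = (\<integral>\<^sup>+x. ennreal (indicator B x * X t x) \<partial>P)"
      using BX X_nonneg[OF t] by (intro nn_integral_eq_integral[symmetric] AE_I2) auto
    also have "\<dots> = (\<integral>\<^sup>+x. ennreal (X t x) * indicator B x \<partial>P)"
      by (intro nn_integral_cong) (auto simp: indicator_def)
    finally show "emeasure \<nu> B = \<dots>" .
  qed measurable
  then have "(\<integral>\<^sup>+x. h x \<partial>restr_to_subalg \<nu> (F t)) =
    (\<integral>\<^sup>+x. h x \<partial>density (restr_to_subalg P (F t)) (\<lambda>x. ennreal (X t x)))" by simp
  also have "(\<integral>\<^sup>+x. h x \<partial>restr_to_subalg \<nu> (F t)) = (\<integral>\<^sup>+x. h x \<partial>\<nu>)"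
    by (rule nn_integral_subalgebra2[OF sub\<nu> h])
  also have "\<dots> = (\<integral>\<^sup>+x. indicator (G t) x * h x \<partial>Q)"
    unfolding \<nu>_def by (subst nn_integral_density) auto
  also have "\<dots> = (\<integral>\<^sup>+x\<in>G t. h x \<partial>Q)" by (simp add: mult.commute)
  also have "(\<integral>\<^sup>+x. h x \<partial>density (restr_to_subalg P (F t)) (\<lambda>x. ennreal (X t x))) =
      (\<integral>\<^sup>+x. ennreal (X t x) * h x \<partial>restr_to_subalg P (F t))"
    by (subst nn_integral_density) (auto intro: measurable_in_subalg[OF subalg[OF t]])
  also have "\<dots> = (\<integral>\<^sup>+x. ennreal (X t x) * h x \<partial>P)"
    by (intro nn_integral_subalgebra2 subalg[OF t]) auto
  finally show ?thesis by (simp add: mult.commute)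
qed

lemma emeasure_Q_G:
  assumes "0 \<le> t" "B \<in> sets (F t)"
  shows "emeasure Q (B \<inter> G t) = (\<integral>\<^sup>+x\<in>B. ennreal (X t x) \<partial>P)"
proof -
  have BG: "B \<inter> G t \<in> sets Q" using G_sets[OF assms(1)] sets_Q sets_F[OF assms] by auto
  have "emeasure Q (B \<inter> G t) = (\<integral>\<^sup>+x. indicator (B \<inter> G t) x \<partial>Q)"
    by (rule nn_integral_indicator[OF BG, symmetric])
  also have "\<dots> = (\<integral>\<^sup>+x\<in>G t. indicator B x \<partial>Q)"
    by (intro nn_integral_cong) (auto simp: indicator_def)
  also have "\<dots> = (\<integral>\<^sup>+x. indicator B x * ennreal (X t x) \<partial>P)"
    using assms by (intro nn_integral_Q_G) auto
  finally show ?thesis by (simp add: mult.commute)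
qed

text \<open>The gateway from \<open>P\<close> to \<open>Q\<close>: for every
  \<open>n \<ge> t\<close> the part of \<open>B\<close> in \<open>G n\<close> has
  \<open>Q\<close>-mass equal to an integral of \<open>X n\<close> over a \<open>P\<close>-null
  event, and the sets \<open>G n\<close> exhaust \<open>Q\<close>. An event lying in no
  \<open>F t\<close> escapes this argument.\<close>

lemma null_sets_Q:
  assumes "0 \<le> t" "B \<in> sets (F t)" "B \<in> null_sets P"
  shows "B \<in> null_sets Q"
proof -
  have [measurable]: "B \<in> sets Q" using assms(3) sets_Q by auto
  have "B \<inter> G n \<in> null_sets Q" if n: "t \<le> n" for n
  proof -
    have n0: "0 \<le> n" and BF: "B \<in> sets (F n)" using assms n sets_F_mono[OF assms(1) n] by auto
    have BG: "B \<inter> G n \<in> sets Q" using G_sets[OF n0] sets_Q \<open>B \<in> sets Q\<close> by auto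
    have "emeasure Q (B \<inter> G n) = (\<integral>\<^sup>+x\<in>B. ennreal (X n x) \<partial>P)" by (rule emeasure_Q_G[OF n0 BF])
    also have "\<dots> = 0" by (rule nn_integral_null_set[OF assms(3)])
    finally have "emeasure Q (B \<inter> G n) = 0" by simp
    then show ?thesis using BG by (rule null_setsI)
  qed
  then have "(\<Union>k::nat. B \<inter> G (t + real k)) \<in> null_sets Q" by (intro null_sets_UN) auto
  then have "AE x in Q. x \<notin> (\<Union>k::nat. B \<inter> G (t + real k))" by (rule AE_not_in)
  with AE_Q_in_G have "AE x in Q. x \<notin> B"
  proof eventually_elim
    fix x assume "\<exists>n::nat. x \<in> G (real n)" "x \<notin> (\<Union>k::nat. B \<inter> G (t + real k))"
    then obtain n :: nat where "x \<in> G (real n)" by blast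
    then have "x \<in> G (t + real n)" using G_mono[of "real n" "t + real n"] assms(1) by auto
    then show "x \<notin> B" using \<open>x \<notin> (\<Union>k::nat. B \<inter> G (t + real k))\<close> by blast
  qed
  then show ?thesis by (simp add: AE_iff_null_sets)
qed

section \<open>The submartingale \<open>X\<close> until the next increase of
  \<open>A\<close>\<close>

lemma X_meas: "0 \<le> t \<Longrightarrow> X t \<in> borel_measurable P"
  by (rule measurable_F[OF _ X_adapt])

lemma A_meas: "0 \<le> t \<Longrightarrow> A t \<in> borel_measurable P"
  by (rule measurable_F[OF _ A_adapt])

lemma N_int: "0 \<le> t \<Longrightarrow> integrable P (N t)"
  using N_mart by (simp add: martingale_def)

lemma A_int:
  assumes "0 \<le> t"
  shows "integrable P (A t)"
proof -
  have "integrable P (\<lambda>x. X t x - N t x)" using X_int N_int assms by auto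
  moreover have "X t x - N t x = A t x" if "x \<in> space P" for x using X_eq[OF assms that] by simp
  ultimately show ?thesis by (simp cong: Bochner_Integration.integrable_cong)
qed

text \<open>The martingale part has the same integral over \<open>C\<close> at both times, so the
  whole growth of \<open>X\<close> comes from \<open>A\<close>.\<close>

lemma set_nn_integral_X_increment:
  assumes v: "0 \<le> v" "v \<le> w" and C: "C \<in> sets (F v)"
  shows "(\<integral>\<^sup>+x\<in>C. ennreal (X w x) \<partial>P) =
    (\<integral>\<^sup>+x\<in>C. ennreal (X v x) \<partial>P) + (\<integral>\<^sup>+x\<in>C. ennreal (A w x - A v x) \<partial>P)"
proof -
  have w: "0 \<le> w" using v by simp
  have CP [measurable]: "C \<in> sets P" using sets_F[OF v(1) C] .
  have [measurable]: "X v \<in> borel_measurable P" "A v \<in> borel_measurable P" "A w \<in> borel_measurable P"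
    using X_meas A_meas v w by auto
  interpret Fv: sigma_finite_subalgebra P "F v" by (rule sigma_finite_subalgebra_F[OF v(1)])
  have ind: "integrable P (\<lambda>x. indicator C x * f x)" if "integrable P f" for f :: "'a \<Rightarrow> real"
    using integrable_mult_indicator[OF CP that] by simp
  have NN: "(\<integral>x. indicator C x * N w x \<partial>P) = (\<integral>x. indicator C x * N v x \<partial>P)"
  proof -
    have "(\<integral>x\<in>C. N w x \<partial>P) = (\<integral>x\<in>C. real_cond_exp P (F v) (N w) x \<partial>P)"
      by (rule Fv.real_cond_exp_intA[OF N_int[OF w] C])
    also have "\<dots> = (\<integral>x\<in>C. N v x \<partial>P)"
    proof -
      have [measurable]: "N v \<in> borel_measurable P" using N_int[OF v(1)] by auto
      have "AE x in P. real_cond_exp P (F v) (N w) x = N v x"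
        using N_mart v by (simp add: martingale_def)
      then have "AE x in P. indicator C x *\<^sub>R real_cond_exp P (F v) (N w) x = indicator C x *\<^sub>R N v x"
        by eventually_elim simp
      then show ?thesis unfolding set_lebesgue_integral_def by (intro integral_cong_AE) auto
    qed
    finally show ?thesis by (simp add: set_lebesgue_integral_def)
  qed
  have eqX: "(\<integral>x. indicator C x * X u x \<partial>P) = (\<integral>x. indicator C x * N u x \<partial>P) + (\<integral>x. indicator C x * A u x \<partial>P)"
    if "0 \<le> u" for u
  proof -
    have "(\<integral>x. indicator C x * X u x \<partial>P) = (\<integral>x. indicator C x * N u x + indicator C x * A u x \<partial>P)"
      by (intro Bochner_Integration.integral_cong refl) (simp add: X_eq[OF that] distrib_left)
    then show ?thesis using ind[OF N_int[OF that]] ind[OF A_int[OF that]] by simp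
  qed
  have iX: "integrable P (\<lambda>x. indicator C x * X v x)" "integrable P (\<lambda>x. indicator C x * X w x)"
    and iA: "integrable P (\<lambda>x. indicator C x * (A w x - A v x))"
    using ind X_int A_int v w by auto
  have "(\<integral>x. indicator C x * (A w x - A v x) \<partial>P) =
      (\<integral>x. indicator C x * A w x \<partial>P) - (\<integral>x. indicator C x * A v x \<partial>P)"
    using ind[OF A_int[OF v(1)]] ind[OF A_int[OF w]] by (simp add: right_diff_distrib)
  then have real: "(\<integral>x. indicator C x * X w x \<partial>P) =
      (\<integral>x. indicator C x * X v x \<partial>P) + (\<integral>x. indicator C x * (A w x - A v x) \<partial>P)"
    unfolding eqX[OF v(1)] eqX[OF w] NN by simp
  have nn: "(\<integral>\<^sup>+x\<in>C. ennreal (f x) \<partial>P) = ennreal (\<integral>x. indicator C x * f x \<partial>P)"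
    "0 \<le> (\<integral>x. indicator C x * f x \<partial>P)"
    if "integrable P (\<lambda>x. indicator C x * f x)" "\<And>x. x \<in> space P \<Longrightarrow> 0 \<le> f x" for f
  proof -
    have "(\<integral>\<^sup>+x\<in>C. ennreal (f x) \<partial>P) = (\<integral>\<^sup>+x. ennreal (indicator C x * f x) \<partial>P)"
      by (intro nn_integral_cong) (auto simp: indicator_def)
    also have "\<dots> = ennreal (\<integral>x. indicator C x * f x \<partial>P)"
      using that by (intro nn_integral_eq_integral AE_I2) auto
    finally show "(\<integral>\<^sup>+x\<in>C. ennreal (f x) \<partial>P) = ennreal (\<integral>x. indicator C x * f x \<partial>P)" .
    show "0 \<le> (\<integral>x. indicator C x * f x \<partial>P)"
      using that by (intro integral_nonneg_AE AE_I2) auto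
  qed
  have pos: "\<And>x. x \<in> space P \<Longrightarrow> 0 \<le> A w x - A v x" using A_mono v by simp
  show ?thesis
    using nn[OF iX(1) X_nonneg[OF v(1)]] nn[OF iX(2) X_nonneg[OF w]] nn[OF iA pos] real
    by (simp add: ennreal_plus)
qed

text \<open>Up to the next increase of \<open>A\<close>, the submartingale \<open>X\<close> behaves as a martingale. Along a
  partition, the mass lost by killing \<open>X\<close> at the first increase of \<open>A\<close> is controlled by a single
  increment of \<open>A\<close>, hence by the modulus of continuity of \<open>A\<close>.\<close>

lemma set_nn_integral_X_killed_le:
  assumes s: "0 \<le> s" "s \<le> u" "u \<le> t" and B: "B \<in> sets (F u)"
  shows "(\<integral>\<^sup>+x\<in>B \<inter> {x\<in>space P. A t x = A s x}. ennreal (X t x) \<partial>P) \<le>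
    (\<integral>\<^sup>+x\<in>B \<inter> {x\<in>space P. A u x = A s x}. ennreal (X u x) \<partial>P)"
proof -
  define E where "E v = B \<inter> {x\<in>space P. A v x = A s x}" for v
  have u: "0 \<le> u" and t: "0 \<le> t" using s by auto
  have EF: "E v \<in> sets (F v)" if v: "u \<le> v" for v
  proof -
    have "A v \<in> borel_measurable (F v)" "A s \<in> borel_measurable (F v)" "B \<in> sets (F v)"
      using s v A_adapt[of v] measurable_F_mono[OF _ _ A_adapt, of s v] sets_F_mono[OF u v B] by auto
    then have "B \<inter> {x\<in>space (F v). A v x = A s x} \<in> sets (F v)" by measurable
    then show ?thesis using u v by (simp add: E_def space_F)
  qed
  have EP [measurable]: "E v \<in> sets P" if "u \<le> v" for v using sets_F[OF _ EF[OF that]] u that by simp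
  \<comment> \<open>Increments of \<open>A\<close> out of grid points where \<open>A\<close> still
    has the value \<open>A s\<close>. By monotonicity at most one of them is nonzero.\<close>
  define D where "D a m = (\<lambda>x. \<Sum>i<m. if A (a i) x = A s x then A (a (Suc i)) x - A (a i) x else 0)"
    for a :: "nat \<Rightarrow> real" and m
  have step: "(\<integral>\<^sup>+x\<in>E (a k). ennreal (X (a k) x) \<partial>P) \<le>
      (\<integral>\<^sup>+x\<in>E u. ennreal (X u x) \<partial>P) + (\<integral>\<^sup>+x. ennreal (D a k x) \<partial>P)"
    if a: "mono a" "a 0 = u" for a :: "nat \<Rightarrow> real" and k
  proof (induction k)
    case 0
    show ?case by (simp add: a D_def)
  next
    case (Suc k)
    have ua: "u \<le> a i" for i using monoD[OF a(1), of 0 i] a(2) by simp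
    then have a0: "0 \<le> a i" for i using u by (meson order_trans)
    have ak: "a k \<le> a (Suc k)" using a by (simp add: monoD)
    have [measurable]: "A (a i) \<in> borel_measurable P" "A s \<in> borel_measurable P" "X (a i) \<in> borel_measurable P" for i
      using A_meas X_meas a0 s by auto
    have D_nonneg: "0 \<le> D a m x" if "x \<in> space P" for m x
    proof -
      have "A (a i) x \<le> A (a (Suc i)) x" for i
        using a(1) by (intro A_mono[OF that a0]) (simp add: monoD)
      then show ?thesis unfolding D_def by (intro sum_nonneg) (metis diff_ge_0_iff_ge order_refl)
    qed
    \<comment> \<open>The event is enlarged to the one at the earlier grid time, where it is
      measurable and the increment formula applies; the price is one more summand of
      \<open>D\<close>.\<close>
    have "(\<integral>\<^sup>+x\<in>E (a (Suc k)). ennreal (X (a (Suc k)) x) \<partial>P) \<le> (\<integral>\<^sup>+x\<in>E (a k). ennreal (X (a (Suc k)) x) \<partial>P)"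
    proof (intro nn_integral_mono)
      fix x assume x: "x \<in> space P"
      have "A s x \<le> A (a k) x" "A (a k) x \<le> A (a (Suc k)) x"
        using A_mono[OF x s(1)] A_mono[OF x a0 ak] s(2) ua[of k] by auto
      then show "ennreal (X (a (Suc k)) x) * indicator (E (a (Suc k))) x \<le> ennreal (X (a (Suc k)) x) * indicator (E (a k)) x"
        by (auto simp: E_def indicator_def)
    qed
    also have "\<dots> = (\<integral>\<^sup>+x\<in>E (a k). ennreal (X (a k) x) \<partial>P) +
        (\<integral>\<^sup>+x\<in>E (a k). ennreal (A (a (Suc k)) x - A (a k) x) \<partial>P)"
      by (rule set_nn_integral_X_increment[OF a0 ak EF[OF ua]])
    also have "\<dots> \<le> ((\<integral>\<^sup>+x\<in>E u. ennreal (X u x) \<partial>P) + (\<integral>\<^sup>+x. ennreal (D a k x) \<partial>P)) +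
        (\<integral>\<^sup>+x. ennreal (if A (a k) x = A s x then A (a (Suc k)) x - A (a k) x else 0) \<partial>P)"
      by (intro add_mono Suc.IH nn_integral_mono) (auto simp: E_def indicator_def)
    also have "\<dots> = (\<integral>\<^sup>+x\<in>E u. ennreal (X u x) \<partial>P) + ((\<integral>\<^sup>+x. ennreal (D a k x) \<partial>P) +
        (\<integral>\<^sup>+x. ennreal (if A (a k) x = A s x then A (a (Suc k)) x - A (a k) x else 0) \<partial>P))"
      by (simp add: add.assoc)
    also have "(\<integral>\<^sup>+x. ennreal (D a k x) \<partial>P) +
        (\<integral>\<^sup>+x. ennreal (if A (a k) x = A s x then A (a (Suc k)) x - A (a k) x else 0) \<partial>P) =
        (\<integral>\<^sup>+x. ennreal (D a k x) + ennreal (if A (a k) x = A s x then A (a (Suc k)) x - A (a k) x else 0) \<partial>P)"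
      by (rule nn_integral_add[symmetric]) (simp_all add: D_def)
    also have "\<dots> = (\<integral>\<^sup>+x. ennreal (D a (Suc k) x) \<partial>P)"
    proof (intro nn_integral_cong)
      fix x assume x: "x \<in> space P"
      show "ennreal (D a k x) + ennreal (if A (a k) x = A s x then A (a (Suc k)) x - A (a k) x else 0) =
        ennreal (D a (Suc k) x)"
        using D_nonneg[OF x, of k] A_mono[OF x a0 ak]
        by (subst ennreal_plus[symmetric]) (auto simp: D_def)
    qed
    finally show ?case .
  qed
  \<comment> \<open>The uniform grid from \<open>u\<close> to \<open>t\<close> with
    \<open>Suc m\<close> steps. The minimum keeps it at \<open>t\<close> afterwards, so that it is
    monotone on all of \<open>nat\<close>.\<close>
  define a where "a m i = u + (t - u) * min 1 (real i / real (Suc m))" for m i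
  have a: "mono (a m)" "a m 0 = u" "a m (Suc m) = t" for m
    using s(3) by (auto simp: a_def mono_def intro!: mult_left_mono min.mono divide_right_mono)
  have ua: "u \<le> a m i" and at: "a m i \<le> t" for m i
    using s(3) mult_left_mono[of "min 1 (real i / real (Suc m))" 1 "t - u"]
    by (auto simp: a_def)
  have a0: "0 \<le> a m i" for m i using ua[of m i] u by simp
  have inc: "a m i \<le> a m (Suc i)" for m i using a(1)[of m] by (simp add: monoD)
  have width: "a m (Suc i) - a m i \<le> (t - u) / real (Suc m)" for m i
  proof -
    have "min 1 (real (Suc i) / real (Suc m)) - min 1 (real i / real (Suc m)) \<le> 1 / real (Suc m)"
    proof -
      have "min 1 (y + d) - min 1 y \<le> d" if "0 \<le> d" for y d :: real using that by auto
      moreover have "real (Suc i) / real (Suc m) = real i / real (Suc m) + 1 / real (Suc m)"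
        by (simp add: add_divide_distrib)
      ultimately show ?thesis by simp
    qed
    from mult_left_mono[OF this, of "t - u"] show ?thesis
      using s(3) by (simp add: a_def right_diff_distrib)
  qed
  have [measurable]: "A (a m i) \<in> borel_measurable P" "A s \<in> borel_measurable P" "A t \<in> borel_measurable P" for m i
    using A_meas a0 s t by auto
  \<comment> \<open>With a single increment in play, uniform continuity of the path of
    \<open>A\<close> sends the error to zero, and \<open>A t\<close> is an integrable bound for
    it.\<close>
  have D_lim: "(\<lambda>m. D (a m) (Suc m) x) \<longlonglongrightarrow> 0" and D_le: "D (a m) (Suc m) x \<le> A t x" and D_nonneg: "0 \<le> D (a m) (Suc m) x"
    if x: "x \<in> space P" for x m
  proof -
    have A_inc: "A (a m i) x \<le> A (a m (Suc i)) x" for m i by (rule A_mono[OF x a0 inc])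
    have As: "A s x \<le> A (a m 0) x" for m using A_mono[OF x s(1) s(2)] a(2) by simp
    show nonneg: "0 \<le> D (a m) (Suc m) x" for m
      unfolding D_def by (intro sum_nonneg) (metis A_inc diff_ge_0_iff_ge order_refl)
    show "D (a m) (Suc m) x \<le> A t x"
      unfolding D_def
    proof (rule sum_constant_increments_le(1))
      show "A (a m (Suc i)) x - A (a m i) x \<le> A t x" for i
        using A_mono[OF x a0 at, of m "Suc i"] A_nonneg[OF x a0, of m i] by simp
    qed (use A_inc As A_nonneg[OF x t] in auto)
    show "(\<lambda>m. D (a m) (Suc m) x) \<longlonglongrightarrow> 0"
    proof (rule LIMSEQ_I)
      fix e :: real assume e: "0 < e"
      have "uniformly_continuous_on {u..t} (\<lambda>v. A v x)"
        using A_cont[OF x] u by (intro compact_uniformly_continuous continuous_on_subset[OF A_cont[OF x]]) auto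
      then obtain d where d: "d > 0" "\<And>v w. v \<in> {u..t} \<Longrightarrow> w \<in> {u..t} \<Longrightarrow> dist w v < d \<Longrightarrow> dist (A w x) (A v x) < e / 2"
        using e unfolding uniformly_continuous_on_def by (metis half_gt_zero)
      have "(\<lambda>m. (t - u) / real (Suc m)) \<longlonglongrightarrow> 0" by (rule LIMSEQ_Suc[OF lim_const_over_n])
      then obtain M where M: "\<And>m. m \<ge> M \<Longrightarrow> norm ((t - u) / real (Suc m) - 0) < d"
        using LIMSEQ_D[OF _ d(1)] by blast
      have "norm (D (a m) (Suc m) x - 0) < e" if m: "m \<ge> M" for m
      proof -
        have "D (a m) (Suc m) x \<le> e / 2"
          unfolding D_def
        proof (rule sum_constant_increments_le(1))
          fix i
          have "dist (a m (Suc i)) (a m i) < d"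
            using M[OF m] width[of m i] inc[of m i] s(3) by (simp add: dist_real_def)
          then have "dist (A (a m (Suc i)) x) (A (a m i) x) < e / 2"
            using ua at by (intro d(2)) auto
          then show "A (a m (Suc i)) x - A (a m i) x \<le> e / 2"
            unfolding dist_real_def by linarith
        qed (use A_inc As e in auto)
        then show ?thesis using nonneg[of m] e by simp
      qed
      then show "\<exists>no. \<forall>m\<ge>no. norm (D (a m) (Suc m) x - 0) < e" by blast
    qed
  qed
  have "(\<lambda>m. \<integral>\<^sup>+x. ennreal (D (a m) (Suc m) x) \<partial>P) \<longlonglongrightarrow> (\<integral>\<^sup>+x. ennreal 0 \<partial>P)"
  proof (rule nn_integral_dominated_convergence[where w = "\<lambda>x. ennreal (A t x)"])
    show "(\<integral>\<^sup>+x. ennreal (A t x) \<partial>P) < \<infinity>"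
      using A_nonneg[OF _ t] by (subst nn_integral_eq_integral[OF A_int[OF t]]) auto
    show "AE x in P. (\<lambda>m. ennreal (D (a m) (Suc m) x)) \<longlonglongrightarrow> ennreal 0"
      using D_lim by (intro AE_I2 tendsto_ennrealI)
    show "AE x in P. ennreal (D (a m) (Suc m) x) \<le> ennreal (A t x)" for m
      using D_le by (intro AE_I2 ennreal_leI)
    show "(\<lambda>x. ennreal (D (a m) (Suc m) x)) \<in> borel_measurable P" for m
      unfolding D_def by measurable
  qed measurable
  then have "(\<lambda>m. (\<integral>\<^sup>+x\<in>E u. ennreal (X u x) \<partial>P) + (\<integral>\<^sup>+x. ennreal (D (a m) (Suc m) x) \<partial>P)) \<longlonglongrightarrow>
      (\<integral>\<^sup>+x\<in>E u. ennreal (X u x) \<partial>P) + 0"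
    by (intro tendsto_add) auto
  moreover have "(\<integral>\<^sup>+x\<in>E t. ennreal (X t x) \<partial>P) \<le>
      (\<integral>\<^sup>+x\<in>E u. ennreal (X u x) \<partial>P) + (\<integral>\<^sup>+x. ennreal (D (a m) (Suc m) x) \<partial>P)" for m
    using step[OF a(1,2), of m "Suc m"] a(3) by simp
  ultimately have "(\<integral>\<^sup>+x\<in>E t. ennreal (X t x) \<partial>P) \<le> (\<integral>\<^sup>+x\<in>E u. ennreal (X u x) \<partial>P) + 0"
    by (intro LIMSEQ_le_const) auto
  then show ?thesis by (simp add: E_def)
qed

lemma A_eq_sets:
  assumes "0 \<le> s" "s \<le> t"
  shows "{x\<in>space P. A t x = A s x} \<in> sets (F t)"
proof -
  have [measurable]: "A t \<in> borel_measurable (F t)" "A s \<in> borel_measurable (F t)"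
    using assms A_adapt[of t] measurable_F_mono[OF _ _ A_adapt, of s t] by auto
  have "{x\<in>space (F t). A t x = A s x} \<in> sets (F t)" by measurable
  then show ?thesis using assms by (simp add: space_F)
qed

lemma X_nonzero_sets:
  assumes "0 \<le> t"
  shows "{x\<in>space P. X t x \<noteq> 0} \<in> sets (F t)"
proof -
  have [measurable]: "X t \<in> borel_measurable (F t)" by (rule X_adapt[OF assms])
  have "{x\<in>space (F t). X t x \<noteq> 0} \<in> sets (F t)" by measurable
  then show ?thesis using assms by (simp add: space_F)
qed

lemma emeasure_Q_G_finite: "0 \<le> t \<Longrightarrow> emeasure Q (G t) < \<infinity>"
proof -
  assume t: "0 \<le> t"
  have "emeasure Q (G t) = (\<integral>\<^sup>+x\<in>space P. ennreal (X t x) \<partial>P)"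
    using emeasure_Q_G[OF t space_in_F[OF t]] by (simp add: G_def Int_def)
  also have "\<dots> = (\<integral>\<^sup>+x. ennreal (X t x) \<partial>P)" by (intro nn_integral_cong) auto
  also have "\<dots> < \<infinity>"
    using X_nonneg[OF t] by (subst nn_integral_eq_integral[OF X_int[OF t]]) auto
  finally show ?thesis .
qed

text \<open>One inclusion holds everywhere, since \<open>A\<close> is constant after the last zero.
  The event on the right has mass equal to the integral of \<open>X t\<close> over
  \<open>A t = A s\<close>, which is at most that of \<open>X s\<close>, namely the finite mass of
  \<open>G s\<close>; so the difference is negligible.\<close>

lemma AE_Q_G_iff:
  assumes s: "0 \<le> s" "s \<le> t"
  shows "AE x in Q. x \<in> G s \<longleftrightarrow> x \<in> G t \<and> A t x = A s x"
proof -
  have t: "0 \<le> t" using s by simp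
  define E where "E = {x\<in>space P. A t x = A s x}"
  have EF: "E \<in> sets (F t)" unfolding E_def by (rule A_eq_sets[OF s])
  have sub: "G s \<subseteq> E \<inter> G t"
    using A_constant[OF _ s] G_mono[OF s(2)] by (auto simp: E_def G_def)
  have meas: "G s \<in> sets Q" "E \<inter> G t \<in> sets Q"
    using G_sets s t sets_F[OF t EF] sets_Q by auto
  have "emeasure Q (E \<inter> G t) = (\<integral>\<^sup>+x\<in>E. ennreal (X t x) \<partial>P)" by (rule emeasure_Q_G[OF t EF])
  also have "\<dots> = (\<integral>\<^sup>+x\<in>space P \<inter> E. ennreal (X t x) \<partial>P)" by (simp add: E_def Int_def)
  also have "\<dots> \<le> (\<integral>\<^sup>+x\<in>space P \<inter> {x\<in>space P. A s x = A s x}. ennreal (X s x) \<partial>P)"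
    unfolding E_def by (rule set_nn_integral_X_killed_le[OF s(1) order_refl s(2) space_in_F[OF s(1)]])
  also have "\<dots> = emeasure Q (space P \<inter> G s)" using emeasure_Q_G[OF s(1) space_in_F[OF s(1)]] by simp
  also have "space P \<inter> G s = G s" by (auto simp: G_def)
  finally have le: "emeasure Q (E \<inter> G t) \<le> emeasure Q (G s)" .
  have "emeasure Q (E \<inter> G t - G s) = emeasure Q (E \<inter> G t) - emeasure Q (G s)"
    using emeasure_Q_G_finite[OF s(1)] meas sub by (intro emeasure_Diff) auto
  also have "\<dots> = 0" using le emeasure_Q_G_finite[OF s(1)]
    by (auto simp: diff_eq_0_iff_ennreal intro: le_less_trans)
  finally have "E \<inter> G t - G s \<in> null_sets Q" using meas by (intro null_setsI) auto
  then have "AE x in Q. x \<notin> E \<inter> G t - G s" by (rule AE_not_in)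
  then show ?thesis
    by (rule AE_mp, intro AE_I2 impI) (use sub in \<open>auto simp: E_def space_Q\<close>)
qed

end

subsection \<open>Ratios \<open>Z / X\<close> under \<open>\<Q>\<close>\<close>

text \<open>The value of \<^const>\<open>lim\<close> is unspecified for divergent sequences; the maximum with \<open>0\<close> makes the limits
  nonnegative everywhere, as \<^const>\<open>nonneg_integrable\<close> demands.\<close>

definition nat_limit :: "(real \<Rightarrow> 'a \<Rightarrow> real) \<Rightarrow> 'a \<Rightarrow> real" where
  "nat_limit Y x = max 0 (lim (\<lambda>n::nat. Y (real n) x))"

lemma nat_limit_nonneg: "0 \<le> nat_limit Y x"
  by (simp add: nat_limit_def)

lemma measurable_nat_limit [measurable]:
  assumes [measurable]: "\<And>n::nat. Y (real n) \<in> borel_measurable M"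
  shows "nat_limit Y \<in> borel_measurable M"
  unfolding nat_limit_def[abs_def] by measurable

lemma tendsto_nat_limit:
  assumes "\<exists>l. ((\<lambda>t. Y t x) \<longlongrightarrow> l) at_top" "\<And>t. 0 \<le> t \<Longrightarrow> 0 \<le> Y t x"
  shows "((\<lambda>t. Y t x) \<longlongrightarrow> nat_limit Y x) at_top"
proof -
  obtain l where l: "((\<lambda>t. Y t x) \<longlongrightarrow> l) at_top" using assms(1) by blast
  then have "(\<lambda>n::nat. Y (real n) x) \<longlonglongrightarrow> l"
    by (rule filterlim_compose[OF _ filterlim_real_sequentially])
  then have lim: "lim (\<lambda>n::nat. Y (real n) x) = l" by (rule limI)
  have "0 \<le> l"
    by (rule tendsto_lowerbound[OF l])
      (use assms(2) in \<open>auto intro!: eventually_mono[OF eventually_ge_at_top[of 0]]\<close>)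
  with l lim show ?thesis by (simp add: nat_limit_def)
qed

text \<open>Fatou's lemma for the counting measure on a set with two points.\<close>

lemma ennreal_liminf_add_le:
  fixes f g :: "nat \<Rightarrow> ennreal"
  shows "liminf f + liminf g \<le> liminf (\<lambda>n. f n + g n)"
  using nn_integral_liminf[of "\<lambda>n b. if b then f n else g n" "count_space (UNIV :: bool set)"]
  by (simp add: nn_integral_count_space_finite UNIV_bool add.commute)

lemma tendsto_at_top_real_sequence:
  "((\<lambda>t. f t) \<longlongrightarrow> l) at_top \<Longrightarrow> (\<lambda>n::nat. f (real n)) \<longlonglongrightarrow> l"
  by (rule filterlim_compose[OF _ filterlim_real_sequentially])

context nonneg_supermartingale
begin

lemma AE_tendsto_nat_limit:
  assumes "AE x in M. \<forall>t>s. ((\<lambda>u. Y u x) \<longlongrightarrow> Y t x) (at_right t)"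
    and "s \<le> 0"
  shows "AE x in M. ((\<lambda>t. Y t x) \<longlongrightarrow> nat_limit Y x) at_top"
  using AE_convergent[OF assms(1)]
  by (rule AE_mp, intro AE_I2 impI tendsto_nat_limit) (use nonneg assms(2) in auto)

end

context class_Sigma_measure
begin

text \<open>The restriction of \<open>Q\<close> to \<open>G s\<close>, written as a density so that
  the sigma-algebra stays that of \<open>P\<close>. It is finite, and the \<open>Qs n\<close>
  exhaust \<open>Q\<close>.\<close>

definition Qs :: "real \<Rightarrow> 'a measure" where
  "Qs s = density Q (indicator (G s))"

lemma sets_Qs [measurable_cong]: "sets (Qs s) = sets P"
  by (simp add: Qs_def sets_Q)

lemma space_Qs: "space (Qs s) = space P"
  by (rule sets_eq_imp_space_eq[OF sets_Qs])

lemma borel_measurable_Q: "f \<in> borel_measurable Q \<longleftrightarrow> f \<in> borel_measurable P"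
  by (simp add: measurable_cong_sets[OF sets_Q refl])

lemma G_sets_Q [measurable]: "0 \<le> t \<Longrightarrow> G t \<in> sets Q"
  using G_sets by (simp add: sets_Q)

lemma nn_integral_Qs:
  assumes "0 \<le> s" "f \<in> borel_measurable P"
  shows "(\<integral>\<^sup>+x. f x \<partial>Qs s) = (\<integral>\<^sup>+x\<in>G s. f x \<partial>Q)"
proof -
  have [measurable]: "f \<in> borel_measurable Q" "G s \<in> sets Q"
    using assms by (auto simp: borel_measurable_Q)
  show ?thesis unfolding Qs_def by (subst nn_integral_density) (auto simp: mult.commute)
qed

lemma AE_Qs_iff: "0 \<le> s \<Longrightarrow> (AE x in Qs s. R x) \<longleftrightarrow> (AE x in Q. x \<in> G s \<longrightarrow> R x)"
  unfolding Qs_def by (subst AE_density) (auto simp: indicator_def)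

lemma finite_measure_Qs:
  assumes "0 \<le> s"
  shows "finite_measure (Qs s)"
proof
  have "G s \<in> sets Q" using assms by measurable
  then have "emeasure (Qs s) (space (Qs s)) = (\<integral>\<^sup>+x. indicator (G s) x * indicator (space P) x \<partial>Q)"
    unfolding Qs_def by (subst emeasure_density) (auto simp: space_Q)
  also have "\<dots> = (\<integral>\<^sup>+x. indicator (G s) x \<partial>Q)"
    by (intro nn_integral_cong) (auto simp: space_Q)
  also have "\<dots> = emeasure Q (G s)" by (rule nn_integral_indicator) fact
  finally show "emeasure (Qs s) (space (Qs s)) \<noteq> \<infinity>" using emeasure_Q_G_finite[OF assms] by auto
qed

lemma AE_Q_of_AE_Qs:
  assumes "\<And>n::nat. AE x in Qs (real n). R x"
  shows "AE x in Q. R x"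
proof -
  have "AE x in Q. \<forall>n::nat. x \<in> G (real n) \<longrightarrow> R x"
    using assms by (intro AE_all_countable[THEN iffD2] allI) (simp add: AE_Qs_iff)
  with AE_Q_in_G show ?thesis by eventually_elim blast
qed

text \<open>An \<open>F t\<close>-measurable substitute for \<open>G s\<close>, containing it for
  \<open>t > s \<ge> 0\<close>. The zeros of \<open>X t\<close> are excluded because a quotient by
  \<open>X t\<close> has the value zero there.\<close>

definition K :: "real \<Rightarrow> real \<Rightarrow> 'a set" where
  "K s t = {x\<in>space P. A t x = A s x \<and> X t x \<noteq> 0}"

lemma K_sets: "0 \<le> s \<Longrightarrow> s \<le> t \<Longrightarrow> K s t \<in> sets (F t)"
proof -
  assume s: "0 \<le> s" "s \<le> t"
  have "K s t = {x\<in>space P. A t x = A s x} \<inter> {x\<in>space P. X t x \<noteq> 0}" by (auto simp: K_def)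
  then show ?thesis using A_eq_sets[OF s] X_nonzero_sets[of t] s by auto
qed

text \<open>Until \<open>A\<close> increases, \<open>X\<close> cannot leave zero: applied to the
  event \<open>X u = 0\<close>, the inequality for the killed process has right-hand side zero,
  which forces \<open>X t = 0\<close> where also \<open>A t = A s\<close>.\<close>

lemma AE_K_antimono:
  assumes s: "0 \<le> s" "s \<le> u" "u \<le> t"
  shows "AE x in P. x \<in> K s t \<longrightarrow> x \<in> K s u"
proof -
  define B where "B = {x\<in>space P. X u x = 0}"
  have u: "0 \<le> u" and t: "0 \<le> t" using s by auto
  have B: "B \<in> sets (F u)"
  proof -
    have "space P - {x\<in>space P. X u x \<noteq> 0} \<in> sets (F u)"
      using X_nonzero_sets[OF u] space_in_F[OF u] by auto
    moreover have "space P - {x\<in>space P. X u x \<noteq> 0} = B" by (auto simp: B_def)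
    ultimately show ?thesis by simp
  qed
  define C where "C = B \<inter> {x\<in>space P. A t x = A s x}"
  have [measurable]: "C \<in> sets P" "X t \<in> borel_measurable P"
    using sets_F[OF u B] sets_F[OF t A_eq_sets[OF s(1) order_trans[OF s(2,3)]]] X_meas[OF t] by (auto simp: C_def)
  have "(\<integral>\<^sup>+x\<in>C. ennreal (X t x) \<partial>P) \<le> (\<integral>\<^sup>+x\<in>B \<inter> {x\<in>space P. A u x = A s x}. ennreal (X u x) \<partial>P)"
    unfolding C_def by (rule set_nn_integral_X_killed_le[OF s B])
  also have "\<dots> = (\<integral>\<^sup>+x. 0 \<partial>P)" by (intro nn_integral_cong) (auto simp: B_def indicator_def)
  finally have "(\<integral>\<^sup>+x\<in>C. ennreal (X t x) \<partial>P) = 0" by simp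
  then have "AE x in P. ennreal (X t x) * indicator C x = 0" by (subst (asm) nn_integral_0_iff_AE) auto
  then show ?thesis
  proof (rule AE_mp, intro AE_I2 impI)
    fix x assume x: "x \<in> space P" "ennreal (X t x) * indicator C x = 0" "x \<in> K s t"
    have "A u x = A s x"
      using A_mono[OF x(1) s(1,2)] A_mono[OF x(1) u s(3)] x(3) by (simp add: K_def)
    moreover have "X u x \<noteq> 0"
    proof
      assume "X u x = 0"
      then have "x \<in> C" using x by (simp add: C_def B_def K_def)
      then have "X t x \<le> 0" using x(2) by (simp add: ennreal_eq_0_iff)
      then show False using X_nonneg[OF t x(1)] x(3) by (simp add: K_def)
    qed
    ultimately show "x \<in> K s u" using x(1) by (simp add: K_def)
  qed
qed

text \<open>Replacing \<open>G s\<close> by \<open>G t\<close> and \<open>A t = A s\<close> makes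
  \<open>X t\<close> the density, which cancels the denominator. At zeros of \<open>X t\<close> the
  left integrand vanishes, whence \<open>K s t\<close> on the right.\<close>

lemma set_nn_integral_ratio:
  assumes s: "0 \<le> s" "s \<le> t" and z: "z \<in> borel_measurable (F t)" "\<And>x. x \<in> space P \<Longrightarrow> 0 \<le> z x"
    and B: "B \<in> sets (F t)"
  shows "(\<integral>\<^sup>+x\<in>B. ennreal (z x / X t x) \<partial>Qs s) = (\<integral>\<^sup>+x\<in>B \<inter> K s t. ennreal (z x) \<partial>P)"
proof -
  have t: "0 \<le> t" using s by simp
  define E where "E = {x\<in>space P. A t x = A s x}"
  have [measurable]: "z \<in> borel_measurable (F t)" "X t \<in> borel_measurable (F t)" "B \<in> sets (F t)" "E \<in> sets (F t)"
    using z B X_adapt[OF t] A_eq_sets[OF s] by (auto simp: E_def)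
  have [measurable]: "z \<in> borel_measurable P" "X t \<in> borel_measurable P" "B \<in> sets P"
    using measurable_F[OF t z(1)] X_meas[OF t] sets_F[OF t B] by auto
  have "(\<integral>\<^sup>+x\<in>B. ennreal (z x / X t x) \<partial>Qs s) = (\<integral>\<^sup>+x\<in>G s. (ennreal (z x / X t x) * indicator B x) \<partial>Q)"
    by (rule nn_integral_Qs[OF s(1)]) measurable
  also have "\<dots> = (\<integral>\<^sup>+x\<in>G t. (ennreal (z x / X t x) * indicator B x * indicator E x) \<partial>Q)"
    by (intro nn_integral_cong_AE, rule AE_mp[OF AE_Q_G_iff[OF s]])
      (auto simp: indicator_def E_def space_Q)
  also have "\<dots> = (\<integral>\<^sup>+x. ennreal (z x / X t x) * indicator B x * indicator E x * ennreal (X t x) \<partial>P)"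
    by (rule nn_integral_Q_G[OF t]) measurable
  also have "\<dots> = (\<integral>\<^sup>+x\<in>B \<inter> K s t. ennreal (z x) \<partial>P)"
  proof (intro nn_integral_cong)
    fix x assume x: "x \<in> space P"
    have "ennreal (z x / X t x) * ennreal (X t x) = ennreal (z x)" if "X t x \<noteq> 0"
      using that X_nonneg[OF t x] z(2)[OF x] by (subst ennreal_mult[symmetric]) auto
    then show "ennreal (z x / X t x) * indicator B x * indicator E x * ennreal (X t x) =
        ennreal (z x) * indicator (B \<inter> K s t) x"
      using x by (cases "X t x = 0") (auto simp: indicator_def E_def K_def)
  qed
  finally show ?thesis .
qed

text \<open>Rewritten under \<open>P\<close>, the integrals of the ratio are integrals of
  \<open>Z\<close> over the events \<open>K s t\<close>. Both the shrinking of these events and the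
  supermartingale property of \<open>Z\<close> act in the right direction.\<close>

lemma ratio_supermartingale:
  assumes Z: "nonneg_supermartingale P F Z 0" and s: "0 \<le> s"
  shows "nonneg_supermartingale (Qs s) F (\<lambda>t x. Z t x / X t x) s"
proof -
  interpret Z: nonneg_supermartingale P F Z 0 by (rule Z)
  have t0: "0 \<le> t" if "s \<le> t" for t using s that by simp
  show ?thesis
  proof (intro nonneg_supermartingale.intro nonneg_supermartingale_axioms.intro finite_measure_Qs[OF s])
    fix t assume t: "s \<le> t"
    show "subalgebra (Qs s) (F t)" using subalg[OF t0[OF t]] by (simp add: subalgebra_def space_Qs sets_Qs)
    have [measurable]: "Z t \<in> borel_measurable (F t)" "X t \<in> borel_measurable (F t)"
      using Z.adapt X_adapt t0[OF t] by auto
    show "(\<lambda>x. Z t x / X t x) \<in> borel_measurable (F t)" by measurable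
    show "0 \<le> Z t x / X t x" if "x \<in> space (Qs s)" for x
      using that Z.nonneg X_nonneg t0[OF t] by (simp add: space_Qs)
  next
    fix u t assume ut: "s \<le> u" "u \<le> t"
    then show "subalgebra (F t) (F u)" using filt s by simp
  next
    fix u t B assume ut: "s \<le> u" "u \<le> t" and B: "B \<in> sets (F u)"
    have u: "0 \<le> u" and t: "0 \<le> t" and st: "s \<le> t" using ut s by auto
    have "(\<integral>\<^sup>+x\<in>B. ennreal (Z t x / X t x) \<partial>Qs s) = (\<integral>\<^sup>+x\<in>B \<inter> K s t. ennreal (Z t x) \<partial>P)"
      by (rule set_nn_integral_ratio[OF s st Z.adapt[OF t] Z.nonneg[OF t] sets_F_mono[OF u ut(2) B]])
    also have "\<dots> \<le> (\<integral>\<^sup>+x\<in>B \<inter> K s u. ennreal (Z t x) \<partial>P)"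
      by (intro nn_integral_mono_AE, rule AE_mp[OF AE_K_antimono[OF s ut]]) (auto simp: indicator_def)
    also have "\<dots> \<le> (\<integral>\<^sup>+x\<in>B \<inter> K s u. ennreal (Z u x) \<partial>P)"
      using B K_sets[OF s ut(1)] by (intro Z.super u ut(2)) auto
    also have "\<dots> = (\<integral>\<^sup>+x\<in>B. ennreal (Z u x / X u x) \<partial>Qs s)"
      by (rule set_nn_integral_ratio[OF s ut(1) Z.adapt[OF u] Z.nonneg[OF u] B, symmetric])
    finally show "(\<integral>\<^sup>+x\<in>B. ennreal (Z t x / X t x) \<partial>Qs s) \<le> (\<integral>\<^sup>+x\<in>B. ennreal (Z u x / X u x) \<partial>Qs s)" .
  next
    have "(\<integral>\<^sup>+x. ennreal (Z s x / X s x) \<partial>Qs s) = (\<integral>\<^sup>+x\<in>space P. ennreal (Z s x / X s x) \<partial>Qs s)"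
      by (intro nn_integral_cong) (auto simp: space_Qs)
    also have "\<dots> = (\<integral>\<^sup>+x\<in>space P \<inter> K s s. ennreal (Z s x) \<partial>P)"
      by (rule set_nn_integral_ratio[OF s order_refl Z.adapt[OF s] Z.nonneg[OF s] space_in_F[OF s]])
    also have "\<dots> \<le> (\<integral>\<^sup>+x\<in>space P. ennreal (Z s x) \<partial>P)"
      by (intro nn_integral_mono) (auto simp: indicator_def)
    also have "\<dots> \<le> (\<integral>\<^sup>+x\<in>space P. ennreal (Z 0 x) \<partial>P)"
      by (rule Z.super[OF order_refl s space_in_F[OF order_refl]])
    also have "\<dots> = (\<integral>\<^sup>+x. ennreal (Z 0 x) \<partial>P)" by (intro nn_integral_cong) auto
    also have "\<dots> < \<infinity>" by (rule Z.fin)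
    finally show "(\<integral>\<^sup>+x. ennreal (Z s x / X s x) \<partial>Qs s) < \<infinity>" .
  qed
qed

definition ratio_limit :: "(real \<Rightarrow> 'a \<Rightarrow> real) \<Rightarrow> 'a \<Rightarrow> real" where
  "ratio_limit Z = nat_limit (\<lambda>t x. Z t x / X t x)"

lemma AE_Q_ratio_tendsto:
  assumes Z: "nonneg_supermartingale P F Z 0" and cad: "cadlag P Z"
  shows "AE x in Q. ((\<lambda>t. Z t x / X t x) \<longlongrightarrow> ratio_limit Z x) at_top"
proof (rule AE_Q_of_AE_Qs)
  fix n :: nat
  interpret Z: nonneg_supermartingale P F Z 0 by (rule Z)
  interpret R: nonneg_supermartingale "Qs (real n)" F "\<lambda>t x. Z t x / X t x" "real n"
    by (rule ratio_supermartingale[OF Z]) simp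
  \<comment> \<open>On \<open>G n\<close> the denominator has no zero after time \<open>n\<close>,
    so the quotient inherits right-continuity from \<open>Z\<close> and \<open>X\<close>
    there.\<close>
  have "AE x in Qs (real n). \<forall>t>real n. ((\<lambda>u. Z u x / X u x) \<longlongrightarrow> Z t x / X t x) (at_right t)"
    unfolding AE_Qs_iff[OF of_nat_0_le_iff]
  proof (intro AE_I2 impI allI)
    fix x t assume "x \<in> space Q" "x \<in> G (real n)" and t: "real n < t"
    have t0: "0 \<le> t" using t by (meson of_nat_0_le_iff order_trans less_imp_le)
    have x: "x \<in> space P" using \<open>x \<in> space Q\<close> by (simp add: space_Q)
    show "((\<lambda>u. Z u x / X u x) \<longlongrightarrow> Z t x / X t x) (at_right t)"
      using cad x t0 X_nonzero[OF \<open>x \<in> G (real n)\<close> t]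
      by (intro tendsto_divide X_right_continuous) (auto simp: cadlag_def)
  qed
  from R.AE_convergent[OF this]
  show "AE x in Qs (real n). ((\<lambda>t. Z t x / X t x) \<longlongrightarrow> ratio_limit Z x) at_top"
    unfolding ratio_limit_def
  proof (rule AE_mp, intro AE_I2 impI)
    fix x assume "x \<in> space (Qs (real n))" "\<exists>l. ((\<lambda>t. Z t x / X t x) \<longlongrightarrow> l) at_top"
    then show "((\<lambda>t. Z t x / X t x) \<longlongrightarrow> nat_limit (\<lambda>t x. Z t x / X t x) x) at_top"
      using Z.nonneg X_nonneg by (intro tendsto_nat_limit) (auto simp: space_Qs)
  qed
qed

lemma ratio_limit_nonneg: "0 \<le> ratio_limit Z x"
  by (simp add: ratio_limit_def nat_limit_nonneg)

lemma ratio_limit_measurable: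
  assumes "\<And>t. 0 \<le> t \<Longrightarrow> Z t \<in> borel_measurable P"
  shows "ratio_limit Z \<in> borel_measurable P"
proof -
  have [measurable]: "Z (real n) \<in> borel_measurable P" "X (real n) \<in> borel_measurable P" for n
    using assms X_meas by auto
  show ?thesis unfolding ratio_limit_def by (rule measurable_nat_limit) measurable
qed

text \<open>Mass of \<open>Z\<close> carried by \<open>{A t = A s}\<close> passes to \<open>Q\<close>, the remaining mass stays under \<open>P\<close>, since
  \<open>A\<close> eventually exceeds \<open>A s\<close>.\<close>

lemma ratio_limit_plus_limit_le:
  assumes Z: "nonneg_supermartingale P F Z 0" and cad: "cadlag P Z"
    and Ainf: "AE x in P. filterlim (\<lambda>t. A t x) at_top at_top"
    and lim: "AE x in P. ((\<lambda>t. Z t x) \<longlongrightarrow> Zinf x) at_top"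
    and t: "0 \<le> t" and B: "B \<in> sets (F t)"
  shows "(\<integral>\<^sup>+x\<in>B. ennreal (ratio_limit Z x) \<partial>Q) + (\<integral>\<^sup>+x\<in>B. ennreal (Zinf x) \<partial>P) \<le>
    (\<integral>\<^sup>+x\<in>B. ennreal (Z t x) \<partial>P)"
proof -
  interpret Z: nonneg_supermartingale P F Z 0 by (rule Z)
  have [measurable]: "B \<in> sets P" "B \<in> sets Q" using sets_F[OF t B] by (auto simp: sets_Q)
  have Zm [measurable]: "Z (real n) \<in> borel_measurable P" for n using Z.adapt_M by simp
  have [measurable]: "X (real n) \<in> borel_measurable P" for n using X_meas by simp
  have rP [measurable]: "ratio_limit Z \<in> borel_measurable P" by (rule ratio_limit_measurable[OF Z.adapt_M])
  have rQ [measurable]: "ratio_limit Z \<in> borel_measurable Q" using rP by (simp add: borel_measurable_Q)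
  have partial: "(\<integral>\<^sup>+x\<in>B. ennreal (ratio_limit Z x) \<partial>Qs (real k)) + (\<integral>\<^sup>+x\<in>B. ennreal (Zinf x) \<partial>P) \<le>
    (\<integral>\<^sup>+x\<in>B. ennreal (Z t x) \<partial>P)" for k :: nat
  proof -
    let ?r = "\<lambda>n x. Z (real (n + k)) x / X (real (n + k)) x"
    \<comment> \<open>The part of \<open>Z\<close> that stays under \<open>P\<close>. The shift by
      \<open>k\<close> keeps the time at or after \<open>k\<close>, as the events \<open>K\<close>
      require.\<close>
    let ?h = "\<lambda>n x. ennreal (Z (real (n + k)) x) * indicator (space P - K (real k) (real (n + k))) x"
    let ?R = "\<lambda>n. \<integral>\<^sup>+x\<in>B. ennreal (?r n x) \<partial>Qs (real k)"
    let ?H = "\<lambda>n. \<integral>\<^sup>+x\<in>B. ?h n x \<partial>P"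
    have KP [measurable]: "K (real k) (real (n + k)) \<in> sets P" for n
      using sets_F[OF _ K_sets] by simp
    have "AE x in Q. (\<lambda>n. Z (real n) x / X (real n) x) \<longlonglongrightarrow> ratio_limit Z x"
      using AE_Q_ratio_tendsto[OF Z cad] by eventually_elim (rule tendsto_at_top_real_sequence)
    then have "AE x in Qs (real k). (\<lambda>n. Z (real n) x / X (real n) x) \<longlonglongrightarrow> ratio_limit Z x"
      unfolding AE_Qs_iff[OF of_nat_0_le_iff] by eventually_elim simp
    then have "AE x in Qs (real k). (\<lambda>n. ennreal (?r n x)) \<longlonglongrightarrow> ennreal (ratio_limit Z x)"
      by eventually_elim (intro tendsto_ennrealI LIMSEQ_ignore_initial_segment)
    then have "(\<integral>\<^sup>+x\<in>B. ennreal (ratio_limit Z x) \<partial>Qs (real k)) \<le>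
        liminf ?R"
    proof (rule set_nn_integral_liminf_le[rotated 2])
      show "B \<in> sets (Qs (real k))" using \<open>B \<in> sets P\<close> by (simp only: sets_Qs)
      fix n
      have "(\<lambda>x. ennreal (?r n x)) \<in> borel_measurable P" by measurable
      then show "(\<lambda>x. ennreal (?r n x)) \<in> borel_measurable (Qs (real k))"
        by (simp only: measurable_cong_sets[OF sets_Qs refl])
    qed
    moreover have "(\<integral>\<^sup>+x\<in>B. ennreal (Zinf x) \<partial>P) \<le>
        liminf ?H"
    proof (rule set_nn_integral_liminf_le)
      have "AE x in P. x \<in> space P" by simp
      with lim Ainf show "AE x in P. (\<lambda>n. ?h n x)
          \<longlonglongrightarrow> ennreal (Zinf x)"
      proof eventually_elim
        fix x assume 1: "((\<lambda>t. Z t x) \<longlongrightarrow> Zinf x) at_top" and 2: "filterlim (\<lambda>t. A t x) at_top at_top"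
          and x: "x \<in> space P"
        have "(\<lambda>n. ennreal (Z (real (n + k)) x)) \<longlonglongrightarrow> ennreal (Zinf x)"
          using tendsto_at_top_real_sequence[OF 1]
          by (intro tendsto_ennrealI LIMSEQ_ignore_initial_segment[where f = "\<lambda>n. Z (real n) x"])
        moreover have "filterlim (\<lambda>n. A (real n) x) at_top sequentially"
          by (rule filterlim_compose[OF 2 filterlim_real_sequentially])
        \<comment> \<open>Divergence of \<open>A\<close> enters at this point:
          \<open>P\<close>-almost every point eventually leaves the event \<open>K\<close>, so the
          part outside it recovers the full limit of \<open>Z\<close>.\<close>
        then have "\<forall>\<^sub>F n in sequentially. A (real k) x < A (real n) x"
          by (simp add: filterlim_at_top_dense)
        then have "\<forall>\<^sub>F n in sequentially. A (real k) x < A (real (n + k)) x"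
          by (subst eventually_sequentially_seg)
        then have "\<forall>\<^sub>F n in sequentially. ennreal (Z (real (n + k)) x) =
            ?h n x"
          by eventually_elim (use x in \<open>auto simp: K_def\<close>)
        ultimately show "(\<lambda>n. ?h n x)
          \<longlonglongrightarrow> ennreal (Zinf x)"
          by (rule Lim_transform_eventually)
      qed
    qed measurable
    ultimately have "(\<integral>\<^sup>+x\<in>B. ennreal (ratio_limit Z x) \<partial>Qs (real k)) + (\<integral>\<^sup>+x\<in>B. ennreal (Zinf x) \<partial>P) \<le>
      liminf ?R + liminf ?H"
      by (rule add_mono)
    also have "\<dots> \<le> liminf (\<lambda>n. ?R n + ?H n)"
      by (rule ennreal_liminf_add_le)
    also have "\<dots> \<le> (\<integral>\<^sup>+x\<in>B. ennreal (Z t x) \<partial>P)"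
    proof (rule Liminf_le)
      have "?R n + ?H n \<le>
        (\<integral>\<^sup>+x\<in>B. ennreal (Z t x) \<partial>P)" if n: "t \<le> real n" for n
      proof -
        have tn: "t \<le> real (n + k)" using n by simp
        have "?R n =
          (\<integral>\<^sup>+x\<in>B \<inter> K (real k) (real (n + k)). ennreal (Z (real (n + k)) x) \<partial>P)"
          by (rule set_nn_integral_ratio) (use Z.adapt Z.nonneg sets_F_mono[OF t tn B] in auto)
        then have "?R n + ?H n =
          (\<integral>\<^sup>+x\<in>B \<inter> K (real k) (real (n + k)). ennreal (Z (real (n + k)) x) \<partial>P) + ?H n"
          by simp
        also have "\<dots> = (\<integral>\<^sup>+x. ennreal (Z (real (n + k)) x) * indicator (B \<inter> K (real k) (real (n + k))) x +
          ?h n x * indicator B x \<partial>P)"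
          by (rule nn_integral_add[symmetric]) measurable
        also have "\<dots> = (\<integral>\<^sup>+x\<in>B. ennreal (Z (real (n + k)) x) \<partial>P)"
          by (intro nn_integral_cong) (auto simp: indicator_def)
        also have "\<dots> \<le> (\<integral>\<^sup>+x\<in>B. ennreal (Z t x) \<partial>P)" by (rule Z.super[OF t tn B])
        finally show ?thesis .
      qed
      moreover obtain n0 :: nat where "t \<le> real n0" using real_arch_simple by blast
      ultimately have "\<forall>n\<ge>n0. ?R n + ?H n \<le>
        (\<integral>\<^sup>+x\<in>B. ennreal (Z t x) \<partial>P)" by (meson of_nat_le_iff order_trans)
      then show "\<forall>\<^sub>F n in sequentially. ?R n + ?H n \<le>
        (\<integral>\<^sup>+x\<in>B. ennreal (Z t x) \<partial>P)" unfolding eventually_sequentially by blast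
    qed simp
    finally show ?thesis .
  qed
  \<comment> \<open>The right-hand side of \<open>partial\<close> does not involve \<open>k\<close>,
    so the sets \<open>G k\<close> may grow and monotone convergence restores all of
    \<open>Q\<close>.\<close>
  have "(\<lambda>k. \<integral>\<^sup>+x\<in>B. ennreal (ratio_limit Z x) \<partial>Qs (real k)) \<longlonglongrightarrow> (\<integral>\<^sup>+x\<in>B. ennreal (ratio_limit Z x) \<partial>Q)"
  proof -
    have "(\<integral>\<^sup>+x\<in>B. ennreal (ratio_limit Z x) \<partial>Qs (real k)) =
      (\<integral>\<^sup>+x. ennreal (ratio_limit Z x) * indicator B x * indicator (G (real k)) x \<partial>Q)" for k
      by (rule nn_integral_Qs) measurable
    moreover have "(\<lambda>k. \<integral>\<^sup>+x. ennreal (ratio_limit Z x) * indicator B x * indicator (G (real k)) x \<partial>Q) \<longlonglongrightarrow>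
      (\<integral>\<^sup>+x. ennreal (ratio_limit Z x) * indicator B x * indicator (\<Union>k. G (real k)) x \<partial>Q)"
    proof (rule nn_integral_LIMSEQ)
      have inc: "incseq (\<lambda>k. G (real k))" by (intro incseq_SucI G_mono) simp
      show "incseq (\<lambda>k x. ennreal (ratio_limit Z x) * indicator B x * indicator (G (real k)) x)"
        by (intro incseq_SucI le_funI mult_left_mono) (use incseq_SucD[OF inc] in \<open>auto simp: indicator_def\<close>)
      show "(\<lambda>k. ennreal (ratio_limit Z x) * indicator B x * indicator (G (real k)) x) \<longlonglongrightarrow>
        ennreal (ratio_limit Z x) * indicator B x * indicator (\<Union>k. G (real k)) x" for x
      proof (cases "x \<in> (\<Union>k. G (real k))")
        case True
        then obtain k0 where "x \<in> G (real k0)" by blast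
        then have "\<forall>k\<ge>k0. x \<in> G (real k)" using inc by (auto simp: incseq_def)
        then show ?thesis using True
          by (intro tendsto_eventually) (auto simp: eventually_sequentially indicator_def)
      qed (auto simp: indicator_def)
    qed measurable
    moreover have "(\<integral>\<^sup>+x. ennreal (ratio_limit Z x) * indicator B x * indicator (\<Union>k. G (real k)) x \<partial>Q) =
        (\<integral>\<^sup>+x\<in>B. ennreal (ratio_limit Z x) \<partial>Q)"
      by (intro nn_integral_cong_AE, rule AE_mp[OF AE_Q_in_G]) (auto simp: indicator_def)
    ultimately show ?thesis by simp
  qed
  then have "(\<lambda>k. (\<integral>\<^sup>+x\<in>B. ennreal (ratio_limit Z x) \<partial>Qs (real k)) + (\<integral>\<^sup>+x\<in>B. ennreal (Zinf x) \<partial>P)) \<longlonglongrightarrow>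
      (\<integral>\<^sup>+x\<in>B. ennreal (ratio_limit Z x) \<partial>Q) + (\<integral>\<^sup>+x\<in>B. ennreal (Zinf x) \<partial>P)"
    by (intro tendsto_add tendsto_const)
  then show ?thesis using partial by (intro LIMSEQ_le_const2) auto
qed

end

subsection \<open>Martingales representing an absolutely continuous measure\<close>

context natural_filtration
begin

text \<open>One notion for both martingale parts: \<open>R = Q\<close> gives the nonnegative version
  of \<open>M(f)\<close>, and \<open>R = P\<close> that of the conditional expectations of
  \<open>f\<close>.\<close>

definition density_martingale :: "'a measure \<Rightarrow> ('a \<Rightarrow> real) \<Rightarrow> (real \<Rightarrow> 'a \<Rightarrow> real) \<Rightarrow> bool" where
  "density_martingale R f Y \<longleftrightarrow> cadlag P Y \<and> adapted F Y \<and> nonneg_process P Y \<and>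
     (\<forall>t\<ge>0. \<forall>B\<in>sets (F t). (\<integral>\<^sup>+x\<in>B. ennreal (f x) \<partial>R) = (\<integral>\<^sup>+x\<in>B. ennreal (Y t x) \<partial>P))"

lemma set_nn_integral_space:
  "space R = space P \<Longrightarrow> (\<integral>\<^sup>+x\<in>space P. f x \<partial>R) = (\<integral>\<^sup>+x. f x \<partial>R)"
  by (intro nn_integral_cong) (auto simp: indicator_def)

text \<open>Absolute continuity is available only on each \<open>F t\<close>, so a Radon-Nikodym
  density is taken at each time separately. The resulting family has constant integrals and is then
  regularised.\<close>

lemma density_martingale_ex:
  assumes R: "sets R = sets P" and ac: "\<And>t B. 0 \<le> t \<Longrightarrow> B \<in> sets (F t) \<Longrightarrow> B \<in> null_sets P \<Longrightarrow> B \<in> null_sets R"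
    and f: "nonneg_integrable R f"
  obtains Y where "density_martingale R f Y"
proof -
  have sp: "space R = space P" by (rule sets_eq_imp_space_eq[OF R])
  have fm [measurable]: "f \<in> borel_measurable R" using f by (auto simp: nonneg_integrable_def)
  have fin: "(\<integral>\<^sup>+x. ennreal (f x) \<partial>R) < \<infinity>"
    using f by (subst nn_integral_eq_integral) (auto simp: nonneg_integrable_def)
  have "\<exists>y. y \<in> borel_measurable (F t) \<and> (\<forall>x. 0 \<le> y x) \<and>
      (\<forall>B\<in>sets (F t). (\<integral>\<^sup>+x\<in>B. ennreal (f x) \<partial>R) = (\<integral>\<^sup>+x\<in>B. ennreal (y x) \<partial>P))" if t: "0 \<le> t" for t
  proof -
    define \<mu> where "\<mu> = restr_to_subalg P (F t)"
    define \<nu> where "\<nu> = restr_to_subalg (density R (\<lambda>x. ennreal (f x))) (F t)"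
    have sub: "subalgebra (density R (\<lambda>x. ennreal (f x))) (F t)"
      using subalg[OF t] R sp by (simp add: subalgebra_def)
    have sets_\<mu>: "sets \<mu> = sets (F t)" and sets_\<nu>: "sets \<nu> = sets (F t)"
      by (simp_all add: \<mu>_def \<nu>_def sets_restr_to_subalg subalg[OF t] sub)
    have em\<nu>: "emeasure \<nu> B = (\<integral>\<^sup>+x\<in>B. ennreal (f x) \<partial>R)" if B: "B \<in> sets (F t)" for B
    proof -
      have "B \<in> sets R" using sets_F[OF t B] R by simp
      then show ?thesis
        unfolding \<nu>_def by (subst emeasure_restr_to_subalg[OF sub B], subst emeasure_density) auto
    qed
    interpret \<mu>: sigma_finite_measure \<mu>
      unfolding \<mu>_def by (rule sigma_finite_subalgebra.sigma_fin_subalg[OF sigma_finite_subalgebra_F[OF t]])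
    have "absolutely_continuous \<mu> \<nu>"
      unfolding absolutely_continuous_def
    proof
      fix B assume "B \<in> null_sets \<mu>"
      then have B: "B \<in> sets (F t)" "B \<in> null_sets P"
        using null_sets_restr_to_subalg[OF subalg[OF t]] by (auto simp: \<mu>_def)
      then have "B \<in> null_sets R" by (rule ac[OF t])
      then have "(\<integral>\<^sup>+x\<in>B. ennreal (f x) \<partial>R) = 0" by (rule nn_integral_null_set)
      with B em\<nu> sets_\<nu> show "B \<in> null_sets \<nu>" by (intro null_setsI) auto
    qed
    then obtain g where g: "g \<in> borel_measurable \<mu>" "density \<mu> g = \<nu>"
      using \<mu>.Radon_Nikodym[of \<nu>] sets_\<mu> sets_\<nu> by auto
    have gF [measurable]: "g \<in> borel_measurable (F t)"
      using g(1) by (simp add: measurable_cong_sets[OF sets_\<mu> refl])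
    have gP [measurable]: "g \<in> borel_measurable P" by (rule measurable_F[OF t gF])
    have em: "(\<integral>\<^sup>+x\<in>B. ennreal (f x) \<partial>R) = (\<integral>\<^sup>+x\<in>B. g x \<partial>P)" if B: "B \<in> sets (F t)" for B
    proof -
      have "(\<integral>\<^sup>+x\<in>B. ennreal (f x) \<partial>R) = emeasure (density \<mu> g) B" using em\<nu>[OF B] g(2) by simp
      also have "\<dots> = (\<integral>\<^sup>+x\<in>B. g x \<partial>\<mu>)"
        using B sets_\<mu> g(1) by (subst emeasure_density) auto
      also have "\<dots> = (\<integral>\<^sup>+x\<in>B. g x \<partial>P)"
        unfolding \<mu>_def using B by (intro nn_integral_subalgebra2 subalg[OF t]) auto
      finally show ?thesis .
    qed
    have "(\<integral>\<^sup>+x. g x \<partial>P) \<noteq> \<infinity>"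
      using em[OF space_in_F[OF t]] fin by (simp add: set_nn_integral_space[OF sp] set_nn_integral_space[OF refl])
    then have "AE x in P. g x \<noteq> \<infinity>" by (intro nn_integral_noteq_infinite gP) auto
    then have ae: "AE x in P. ennreal (enn2real (g x)) = g x" by eventually_elim (simp add: less_top)
    show ?thesis
    proof (intro exI[of _ "\<lambda>x. enn2real (g x)"] conjI ballI)
      fix B assume B: "B \<in> sets (F t)"
      have "(\<integral>\<^sup>+x\<in>B. ennreal (enn2real (g x)) \<partial>P) = (\<integral>\<^sup>+x\<in>B. g x \<partial>P)"
        by (intro nn_integral_cong_AE, rule AE_mp[OF ae]) auto
      with em[OF B] show "(\<integral>\<^sup>+x\<in>B. ennreal (f x) \<partial>R) = (\<integral>\<^sup>+x\<in>B. ennreal (enn2real (g x)) \<partial>P)" by simp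
    qed (auto, measurable)
  qed
  then obtain y where y: "\<And>t. 0 \<le> t \<Longrightarrow> y t \<in> borel_measurable (F t)" "\<And>t x. 0 \<le> t \<Longrightarrow> 0 \<le> y t x"
    "\<And>t B. 0 \<le> t \<Longrightarrow> B \<in> sets (F t) \<Longrightarrow> (\<integral>\<^sup>+x\<in>B. ennreal (f x) \<partial>R) = (\<integral>\<^sup>+x\<in>B. ennreal (y t x) \<partial>P)"
    by metis
  have "(\<integral>\<^sup>+x\<in>B. ennreal (y t x) \<partial>P) = (\<integral>\<^sup>+x\<in>B. ennreal (y u x) \<partial>P)"
    if "0 \<le> u" "u \<le> t" "B \<in> sets (F u)" for u t B
    using y(3)[OF that(1,3)] y(3)[OF _ sets_F_mono[OF that]] that by simp
  moreover have "(\<integral>\<^sup>+x. ennreal (y 0 x) \<partial>P) < \<infinity>"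
    using y(3)[OF order_refl space_in_F[OF order_refl]] fin
    by (simp add: set_nn_integral_space[OF sp] set_nn_integral_space[OF refl])
  ultimately obtain Y where Y: "cadlag P Y" "adapted F Y" "nonneg_process P Y"
    "\<And>t. 0 \<le> t \<Longrightarrow> AE x in P. Y t x = y t x"
    using cadlag_modification[OF y(1) y(2)] by blast
  have "(\<integral>\<^sup>+x\<in>B. ennreal (f x) \<partial>R) = (\<integral>\<^sup>+x\<in>B. ennreal (Y t x) \<partial>P)" if t: "0 \<le> t" and B: "B \<in> sets (F t)" for t B
    unfolding y(3)[OF t B] by (intro nn_integral_cong_AE, rule AE_mp[OF Y(4)[OF t]]) auto
  with Y(1-3) show thesis by (intro that[of Y]) (simp add: density_martingale_def)
qed

lemma density_martingale_cong:
  assumes eq: "AE x in R. f x = g x" and Y: "density_martingale R f Y"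
  shows "density_martingale R g Y"
proof -
  have "(\<integral>\<^sup>+x\<in>B. ennreal (g x) \<partial>R) = (\<integral>\<^sup>+x\<in>B. ennreal (f x) \<partial>R)" for B
    by (rule nn_integral_cong_AE) (use eq in \<open>eventually_elim, simp\<close>)
  with Y show ?thesis by (simp add: density_martingale_def)
qed

text \<open>Allows a version to be corrected on an exceptional set: membership in \<open>F 0\<close>
  keeps it adapted, and nullity keeps the integrals.\<close>

lemma density_martingale_zero_on_null:
  assumes Y: "density_martingale R f Y" and C: "C \<in> sets (F 0)" "C \<in> null_sets P"
  shows "density_martingale R f (\<lambda>t x. if x \<in> C then 0 else Y t x)"
  unfolding density_martingale_def
proof (intro conjI allI impI ballI)
  show "cadlag P (\<lambda>t x. if x \<in> C then 0 else Y t x)"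
    unfolding cadlag_def
  proof (intro ballI)
    fix x assume "x \<in> space P"
    then show "(\<forall>t\<ge>0. ((\<lambda>s. if x \<in> C then 0 else Y s x) \<longlongrightarrow> (if x \<in> C then 0 else Y t x)) (at_right t)) \<and>
      (\<forall>t>0. \<exists>l. ((\<lambda>s. if x \<in> C then 0 else Y s x) \<longlongrightarrow> l) (at_left t))"
      using Y by (cases "x \<in> C") (auto simp: density_martingale_def cadlag_def)
  qed
  show "adapted F (\<lambda>t x. if x \<in> C then 0 else Y t x)"
    unfolding adapted_def
  proof (intro allI impI)
    fix t :: real assume t: "0 \<le> t"
    have [measurable]: "Y t \<in> borel_measurable (F t)" "C \<in> sets (F t)"
      using Y t sets_F_mono[OF order_refl t C(1)] by (auto simp: density_martingale_def adapted_def)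
    show "(\<lambda>x. if x \<in> C then 0 else Y t x) \<in> borel_measurable (F t)" by measurable
  qed
  show "nonneg_process P (\<lambda>t x. if x \<in> C then 0 else Y t x)"
    using Y by (auto simp: density_martingale_def nonneg_process_def)
  fix t B assume t: "0 \<le> t" and B: "B \<in> sets (F t)"
  have "(\<integral>\<^sup>+x\<in>B. ennreal (if x \<in> C then 0 else Y t x) \<partial>P) = (\<integral>\<^sup>+x\<in>B. ennreal (Y t x) \<partial>P)"
    by (intro nn_integral_cong_AE, rule AE_mp[OF AE_not_in[OF C(2)]]) auto
  then show "(\<integral>\<^sup>+x\<in>B. ennreal (f x) \<partial>R) = (\<integral>\<^sup>+x\<in>B. ennreal (if x \<in> C then 0 else Y t x) \<partial>P)"
    using Y t B by (simp add: density_martingale_def)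
qed

context
  fixes R f Y
  assumes R: "sets R = sets P" and f: "nonneg_integrable R f" and Y: "density_martingale R f Y"
begin

lemma density_martingale_adapt: "0 \<le> t \<Longrightarrow> Y t \<in> borel_measurable (F t)"
  and density_martingale_nonneg: "0 \<le> t \<Longrightarrow> x \<in> space P \<Longrightarrow> 0 \<le> Y t x"
  and density_martingale_eq: "0 \<le> t \<Longrightarrow> B \<in> sets (F t) \<Longrightarrow>
    (\<integral>\<^sup>+x\<in>B. ennreal (f x) \<partial>R) = (\<integral>\<^sup>+x\<in>B. ennreal (Y t x) \<partial>P)"
  using Y unfolding density_martingale_def adapted_def nonneg_process_def by blast+

lemma density_martingale_nn_integral:
  assumes "0 \<le> t"
  shows "(\<integral>\<^sup>+x. ennreal (Y t x) \<partial>P) = (\<integral>\<^sup>+x. ennreal (f x) \<partial>R)"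
  using density_martingale_eq[OF assms space_in_F[OF assms]]
  by (simp add: set_nn_integral_space[OF sets_eq_imp_space_eq[OF R]] set_nn_integral_space[OF refl])

lemma density_martingale_finite: "(\<integral>\<^sup>+x. ennreal (f x) \<partial>R) < \<infinity>"
  using f by (subst nn_integral_eq_integral) (auto simp: nonneg_integrable_def)

lemma density_martingale_integrable: "0 \<le> t \<Longrightarrow> integrable P (Y t)"
  by (rule integrableI_nonneg)
    (use measurable_F[OF _ density_martingale_adapt] density_martingale_nonneg
      density_martingale_nn_integral density_martingale_finite in auto)

lemma density_martingale_supermartingale: "nonneg_supermartingale P F Y 0"
proof unfold_locales
  fix u t B assume ut: "(0::real) \<le> u" "u \<le> t" and B: "B \<in> sets (F u)"
  show "(\<integral>\<^sup>+x\<in>B. ennreal (Y t x) \<partial>P) \<le> (\<integral>\<^sup>+x\<in>B. ennreal (Y u x) \<partial>P)"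
    using density_martingale_eq[OF ut(1) B] density_martingale_eq[OF _ sets_F_mono[OF ut B]] ut by simp
next
  show "(\<integral>\<^sup>+x. ennreal (Y 0 x) \<partial>P) < \<infinity>"
    using density_martingale_nn_integral[of 0] density_martingale_finite by simp
qed (fact subalg filt density_martingale_adapt density_martingale_nonneg)+

text \<open>Both sides integrate \<open>\<Gamma>\<close> against the same measure on
  \<open>F t\<close>, so the identity on events extends to functions without approximation.\<close>

lemma density_martingale_integral:
  assumes t: "0 \<le> t" and \<Gamma>: "\<Gamma> \<in> borel_measurable (F t)"
  shows "(\<integral>x. f x * \<Gamma> x \<partial>R) = (\<integral>x. \<Gamma> x * Y t x \<partial>P)"
proof -
  have sp: "space R = space P" by (rule sets_eq_imp_space_eq[OF R])
  have fR [measurable]: "f \<in> borel_measurable R" using f by (auto simp: nonneg_integrable_def)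
  define \<nu> where "\<nu> = density R (\<lambda>x. ennreal (f x))"
  have sub: "subalgebra \<nu> (F t)"
    using subalg[OF t] R sp by (simp add: \<nu>_def subalgebra_def)
  have [measurable]: "Y t \<in> borel_measurable (F t)" "\<Gamma> \<in> borel_measurable (F t)"
    using density_martingale_adapt[OF t] \<Gamma> by auto
  have YR: "Y t \<in> borel_measurable (restr_to_subalg P (F t))" and \<Gamma>R: "\<Gamma> \<in> borel_measurable (restr_to_subalg P (F t))"
    by (rule measurable_in_subalg[OF subalg[OF t]], measurable)+
  have [measurable]: "\<Gamma> \<in> borel_measurable R"
    using measurable_F[OF t \<Gamma>] by (simp add: measurable_cong_sets[OF R refl])
  have eq: "restr_to_subalg \<nu> (F t) = density (restr_to_subalg P (F t)) (\<lambda>x. ennreal (Y t x))"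
  proof (rule restr_to_subalg_eq_density[OF sub subalg[OF t]])
    fix B assume B: "B \<in> sets (F t)"
    then have "B \<in> sets R" using sets_F[OF t] R by auto
    then have "emeasure \<nu> B = (\<integral>\<^sup>+x\<in>B. ennreal (f x) \<partial>R)"
      unfolding \<nu>_def by (subst emeasure_density) auto
    then show "emeasure \<nu> B = (\<integral>\<^sup>+x\<in>B. ennreal (Y t x) \<partial>P)"
      by (simp add: density_martingale_eq[OF t B])
  qed measurable
  have "(\<integral>x. f x * \<Gamma> x \<partial>R) = (\<integral>x. \<Gamma> x \<partial>\<nu>)"
    unfolding \<nu>_def using f by (subst integral_density) (auto simp: nonneg_integrable_def)
  also have "\<dots> = (\<integral>x. \<Gamma> x \<partial>restr_to_subalg \<nu> (F t))"
    by (rule integral_subalgebra2[OF sub \<Gamma>, symmetric])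
  also have "\<dots> = (\<integral>x. Y t x * \<Gamma> x \<partial>restr_to_subalg P (F t))"
    unfolding eq using YR \<Gamma>R density_martingale_nonneg[OF t]
    by (subst integral_density) (auto simp: space_restr_to_subalg)
  also have "\<dots> = (\<integral>x. Y t x * \<Gamma> x \<partial>P)"
    by (rule integral_subalgebra2[OF subalg[OF t]]) measurable
  finally show ?thesis by (simp add: mult.commute)
qed

lemma density_martingale_real_cond_exp:
  assumes s: "0 \<le> s" and g: "integrable P g"
    and eq: "\<And>B. B \<in> sets (F s) \<Longrightarrow> (\<integral>x. f x * indicator B x \<partial>R) = (\<integral>x. indicator B x * g x \<partial>P)"
  shows "AE x in P. real_cond_exp P (F s) g x = Y s x"
proof -
  interpret Fs: sigma_finite_subalgebra P "F s" by (rule sigma_finite_subalgebra_F[OF s])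
  show ?thesis
  proof (rule Fs.real_cond_exp_charact[OF _ g density_martingale_integrable[OF s] density_martingale_adapt[OF s]])
    fix B assume B: "B \<in> sets (F s)"
    have "(\<integral>x. f x * indicator B x \<partial>R) = (\<integral>x. indicator B x * Y s x \<partial>P)"
      using B by (intro density_martingale_integral[OF s]) auto
    then show "(\<integral>x\<in>B. g x \<partial>P) = (\<integral>x\<in>B. Y s x \<partial>P)"
      using eq[OF B] by (simp add: set_lebesgue_integral_def)
  qed
qed

lemma density_martingale_martingale: "martingale P F Y"
  unfolding martingale_def
proof (intro conjI allI impI)
  show "adapted F Y" using Y by (simp add: density_martingale_def)
  show "integrable P (Y t)" if "0 \<le> t" for t by (rule density_martingale_integrable[OF that])
  fix s t :: real assume st: "0 \<le> s \<and> s \<le> t"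
  then have t: "0 \<le> t" by simp
  show "AE x in P. real_cond_exp P (F s) (Y t) x = Y s x"
  proof (rule density_martingale_real_cond_exp)
    fix B assume "B \<in> sets (F s)"
    then have "B \<in> sets (F t)" using st sets_F_mono by blast
    then show "(\<integral>x. f x * indicator B x \<partial>R) = (\<integral>x. indicator B x * Y t x \<partial>P)"
      by (intro density_martingale_integral[OF t]) auto
  qed (use st density_martingale_integrable in auto)
qed

lemma density_martingale_M_martingale: "M_martingale P F R f Y"
  unfolding M_martingale_def using density_martingale_martingale density_martingale_integral Y
  by (simp add: density_martingale_def bounded_measurable_def)

text \<open>Testing with indicators of events of \<open>F t\<close> identifies \<open>Y t\<close> as
  the conditional expectation of \<open>Y' t\<close>. The case \<open>R = P\<close> also compares
  versions of conditional expectations.\<close>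

lemma M_martingale_AE_eq:
  assumes M: "M_martingale P F R f Y'" and t: "0 \<le> t"
  shows "AE x in P. Y' t x = Y t x"
proof -
  interpret Ft: sigma_finite_subalgebra P "F t" by (rule sigma_finite_subalgebra_F[OF t])
  have Y': "integrable P (Y' t)" "Y' t \<in> borel_measurable (F t)"
    using M t by (auto simp: M_martingale_def martingale_def adapted_def)
  have "AE x in P. real_cond_exp P (F t) (Y' t) x = Y t x"
  proof (rule density_martingale_real_cond_exp[OF t Y'(1)])
    fix B assume B: "B \<in> sets (F t)"
    then have "bounded_measurable (F t) (indicator B)"
      by (auto simp: bounded_measurable_def intro!: boundedI[of _ 1] simp: indicator_def)
    then show "(\<integral>x. f x * indicator B x \<partial>R) = (\<integral>x. indicator B x * Y' t x \<partial>P)"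
      using M t unfolding M_martingale_def by blast
  qed
  moreover have "AE x in P. real_cond_exp P (F t) (Y' t) x = Y' t x"
    by (rule Ft.real_cond_exp_F_meas[OF Y'])
  ultimately show ?thesis by eventually_elim simp
qed

end

lemma density_martingale_cond_exp_AE:
  assumes f: "nonneg_integrable P f" and Y: "density_martingale P f Y" and t: "0 \<le> t"
  shows "AE x in P. Y t x = real_cond_exp P (F t) f x"
proof -
  have "AE x in P. real_cond_exp P (F t) f x = Y t x"
    by (rule density_martingale_real_cond_exp[OF refl f Y t])
      (use f in \<open>auto simp: nonneg_integrable_def mult.commute\<close>)
  then show ?thesis by eventually_elim simp
qed

lemma density_martingale_cadlag_cond_exp:
  assumes f: "nonneg_integrable P f" and Y: "density_martingale P f Y"
  shows "cadlag_cond_exp P F f Y"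
  using density_martingale_cond_exp_AE[OF f Y] Y
  by (simp add: cadlag_cond_exp_def density_martingale_def)

section \<open>Path properties outside null sets of \<open>F 0\<close>\<close>

lemma cadlag_diff:
  assumes "cadlag P Y" "cadlag P Y'"
  shows "cadlag P (\<lambda>t x. Y t x - Y' t x)"
  unfolding cadlag_def
proof (intro ballI conjI allI impI)
  fix x and t :: real assume x: "x \<in> space P"
  show "((\<lambda>s. Y s x - Y' s x) \<longlongrightarrow> Y t x - Y' t x) (at_right t)" if "0 \<le> t"
    using assms x that by (intro tendsto_diff) (simp_all add: cadlag_def)
  show "\<exists>l. ((\<lambda>s. Y s x - Y' s x) \<longlongrightarrow> l) (at_left t)" if t: "0 < t"
  proof -
    obtain l where "((\<lambda>s. Y s x) \<longlongrightarrow> l) (at_left t)" using assms(1) x t unfolding cadlag_def by blast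
    moreover obtain l' where "((\<lambda>s. Y' s x) \<longlongrightarrow> l') (at_left t)"
      using assms(2) x t unfolding cadlag_def by blast
    ultimately have "((\<lambda>s. Y s x - Y' s x) \<longlongrightarrow> l - l') (at_left t)" by (rule tendsto_diff)
    then show ?thesis ..
  qed
qed

lemma adapted_diff:
  "adapted F Y \<Longrightarrow> adapted F Y' \<Longrightarrow> adapted F (\<lambda>t x. Y t x - Y' t x)"
  unfolding adapted_def by (auto intro!: borel_measurable_diff)

text \<open>Right-continuity reduces all times to rational ones. The failure at a rational time is a
  null event of the sigma-algebra at that time, so the union belongs to \<open>F 0\<close> and can
  be discarded under \<open>Q\<close> too.\<close>

lemma exceptional_null_set_nonneg:
  assumes cad: "cadlag P Y" and ad: "adapted F Y" and ae: "\<And>t. 0 \<le> t \<Longrightarrow> AE x in P. 0 \<le> Y t x"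
  shows "\<exists>C\<in>sets (F 0) \<inter> null_sets P. \<forall>x\<in>space P - C. \<forall>t\<ge>0. 0 \<le> Y t x"
proof -
  define S :: "real set" where "S = \<rat> \<inter> {0..}"
  have S: "countable S" "S \<noteq> {}" by (auto simp: S_def countable_rat intro: countable_Int1)
  define q where "q = from_nat_into S"
  have q: "range q = S" unfolding q_def by (rule range_from_nat_into[OF S(2,1)])
  then have q0: "0 \<le> q n" for n by (auto simp: S_def)
  define B where "B n = {x\<in>space P. \<not> 0 \<le> Y (q n) x}" for n
  have BF: "B n \<in> sets (F (q n))" for n
  proof -
    have [measurable]: "Y (q n) \<in> borel_measurable (F (q n))" using ad q0[of n] by (simp add: adapted_def)
    have "{x\<in>space (F (q n)). \<not> 0 \<le> Y (q n) x} \<in> sets (F (q n))" by measurable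
    then show ?thesis by (simp add: B_def space_F q0)
  qed
  have BN: "B n \<in> null_sets P" for n
    using ae[OF q0[of n]] sets_F[OF q0 BF[of n]] unfolding B_def by (subst (asm) AE_iff_null) auto
  note C = null_sets_F0[of q B, OF q0 BF BN order_refl]
  show ?thesis
  proof (intro bexI[of _ "\<Union>n. B n"] IntI C ballI allI impI)
    fix x t assume x: "x \<in> space P - (\<Union>n. B n)" and t: "(0::real) \<le> t"
    have nonneg: "0 \<le> Y u x" if u: "u \<in> S" for u
    proof -
      obtain n where "u = q n" using u q by auto
      with x show ?thesis by (auto simp: B_def)
    qed
    have "((\<lambda>u. Y u x) \<longlongrightarrow> Y t x) (at t within \<rat> \<inter> {t<..})"
      using cad x t by (auto simp: cadlag_def intro: tendsto_within_subset)
    moreover have "\<forall>\<^sub>F u in at t within \<rat> \<inter> {t<..}. 0 \<le> Y u x"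
      unfolding eventually_at_filter using t by (intro always_eventually) (auto simp: S_def intro!: nonneg)
    ultimately show "0 \<le> Y t x"
      by (rule tendsto_lowerbound[OF _ _ at_within_Rats_greater_neq_bot])
  qed
qed

lemma exceptional_null_set_eq:
  assumes "cadlag P Y" "adapted F Y" "cadlag P Y'" "adapted F Y'"
    and ae: "\<And>t. 0 \<le> t \<Longrightarrow> AE x in P. Y t x = Y' t x"
  shows "\<exists>C\<in>sets (F 0) \<inter> null_sets P. \<forall>x\<in>space P - C. \<forall>t\<ge>0. Y t x = Y' t x"
proof -
  have "AE x in P. 0 \<le> Y t x - Y' t x" if "0 \<le> t" for t using ae[OF that] by eventually_elim simp
  from exceptional_null_set_nonneg[OF cadlag_diff[OF assms(1,3)] adapted_diff[OF assms(2,4)] this]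
  obtain C where C: "C \<in> sets (F 0) \<inter> null_sets P" "\<forall>x\<in>space P - C. \<forall>t\<ge>0. 0 \<le> Y t x - Y' t x"
    by auto
  have "AE x in P. 0 \<le> Y' t x - Y t x" if "0 \<le> t" for t using ae[OF that] by eventually_elim simp
  from exceptional_null_set_nonneg[OF cadlag_diff[OF assms(3,1)] adapted_diff[OF assms(4,2)] this]
  obtain D where D: "D \<in> sets (F 0) \<inter> null_sets P" "\<forall>x\<in>space P - D. \<forall>t\<ge>0. 0 \<le> Y' t x - Y t x"
    by auto
  show ?thesis
  proof (intro bexI[of _ "C \<union> D"] ballI allI impI)
    show "C \<union> D \<in> sets (F 0) \<inter> null_sets P" using C D by auto
    fix x and t :: real assume "x \<in> space P - (C \<union> D)" "0 \<le> t"
    then have "0 \<le> Y t x - Y' t x" "0 \<le> Y' t x - Y t x" using C(2) D(2) by blast+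
    then show "Y t x = Y' t x" by simp
  qed
qed

lemma nonneg_supermartingaleI:
  assumes Z: "nonneg_process P Z" "supermartingale P F Z"
  shows "nonneg_supermartingale P F Z 0"
proof unfold_locales
  have int: "integrable P (Z t)" if "0 \<le> t" for t using Z(2) that by (simp add: supermartingale_def)
  have nn: "0 \<le> Z t x" if "0 \<le> t" "x \<in> space P" for t x using Z(1) that by (simp add: nonneg_process_def)
  show "Z t \<in> borel_measurable (F t)" if "0 \<le> t" for t
    using Z(2) that by (simp add: supermartingale_def adapted_def)
  show "0 \<le> Z t x" if "0 \<le> t" "x \<in> space P" for t x using nn that .
  show "(\<integral>\<^sup>+x. ennreal (Z 0 x) \<partial>P) < \<infinity>"
    using nn by (subst nn_integral_eq_integral[OF int]) auto
  fix u t B assume ut: "(0::real) \<le> u" "u \<le> t" and B: "B \<in> sets (F u)"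
  have t: "0 \<le> t" using ut by simp
  have BP: "B \<in> sets P" by (rule sets_F[OF ut(1) B])
  interpret Fu: sigma_finite_subalgebra P "F u" by (rule sigma_finite_subalgebra_F[OF ut(1)])
  have ind: "integrable P (\<lambda>x. indicator B x *\<^sub>R g x)" if "integrable P g" for g :: "'a \<Rightarrow> real"
    by (rule integrable_mult_indicator[OF BP that])
  have nni: "(\<integral>\<^sup>+x\<in>B. ennreal (Z v x) \<partial>P) = ennreal (\<integral>x\<in>B. Z v x \<partial>P)" if v: "0 \<le> v" for v
  proof -
    have "(\<integral>\<^sup>+x\<in>B. ennreal (Z v x) \<partial>P) = (\<integral>\<^sup>+x. ennreal (indicator B x *\<^sub>R Z v x) \<partial>P)"
      by (intro nn_integral_cong) (auto simp: indicator_def)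
    also have "\<dots> = ennreal (\<integral>x. indicator B x *\<^sub>R Z v x \<partial>P)"
      by (intro nn_integral_eq_integral ind int v AE_I2) (auto intro!: mult_nonneg_nonneg nn v)
    finally show ?thesis by (simp add: set_lebesgue_integral_def)
  qed
  have "(\<integral>x\<in>B. Z t x \<partial>P) = (\<integral>x\<in>B. real_cond_exp P (F u) (Z t) x \<partial>P)"
    by (rule Fu.real_cond_exp_intA[OF int[OF t] B])
  also have "\<dots> \<le> (\<integral>x\<in>B. Z u x \<partial>P)"
    unfolding set_lebesgue_integral_def
  proof (rule integral_mono_AE[OF ind[OF Fu.real_cond_exp_int(1)[OF int[OF t]]] ind[OF int[OF ut(1)]]])
    have "AE x in P. real_cond_exp P (F u) (Z t) x \<le> Z u x"
      using Z(2) ut by (simp add: supermartingale_def)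
    then show "AE x in P. indicator B x *\<^sub>R real_cond_exp P (F u) (Z t) x \<le> indicator B x *\<^sub>R Z u x"
      by eventually_elim (auto simp: indicator_def)
  qed
  finally show "(\<integral>\<^sup>+x\<in>B. ennreal (Z t x) \<partial>P) \<le> (\<integral>\<^sup>+x\<in>B. ennreal (Z u x) \<partial>P)"
    by (simp add: nni ut t ennreal_leI)
qed (fact subalg filt)+

end

subsection \<open>Limits of the representing martingales\<close>

lemma ennreal_add_le_self_imp_eq_0:
  fixes a b :: ennreal
  assumes "a + b \<le> a" "a < \<infinity>"
  shows "b = 0"
proof -
  have "a + b \<le> a + 0" using assms(1) by simp
  then have "b \<le> 0" using assms(2) by (subst (asm) ennreal_add_left_cancel_le) auto
  then show ?thesis by simp
qed

context class_Sigma_measure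
begin

lemma generated_sequence:
  assumes "0 \<le> a"
  shows "sets P = sigma_sets (space P) (\<Union>n. sets (F (real n + a)))"
proof -
  have "(\<Union>t\<in>{0..}. sets (F t)) = (\<Union>n. sets (F (real n + a)))"
  proof (intro equalityI subsetI)
    fix B assume "B \<in> (\<Union>t\<in>{0..}. sets (F t))"
    then obtain t where t: "0 \<le> t" "B \<in> sets (F t)" by auto
    obtain n :: nat where "t \<le> real n" using real_arch_simple by blast
    then have "B \<in> sets (F (real n + a))" using sets_F_mono[OF t(1) _ t(2)] assms by simp
    then show "B \<in> (\<Union>n. sets (F (real n + a)))" by blast
  next
    fix B assume "B \<in> (\<Union>n. sets (F (real n + a)))"
    then obtain n where n: "B \<in> sets (F (real n + a))" by blast
    have "real n + a \<in> {0..}" using assms by simp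
    with n show "B \<in> (\<Union>t\<in>{0..}. sets (F t))" by blast
  qed
  with generated show ?thesis by simp
qed

lemma AE_tendsto_nat_limit:
  assumes Z: "nonneg_supermartingale P F Z 0" and cad: "cadlag P Z"
  shows "AE x in P. ((\<lambda>t. Z t x) \<longlongrightarrow> nat_limit Z x) at_top"
  by (rule nonneg_supermartingale.AE_tendsto_nat_limit[OF Z _ order_refl])
    (use cad in \<open>auto simp: cadlag_def\<close>)

lemma density_martingale_tendsto:
  assumes f: "nonneg_integrable P f" and Y: "density_martingale P f Y"
  shows "AE x in P. ((\<lambda>t. Y t x) \<longlongrightarrow> f x) at_top"
proof -
  have sup: "nonneg_supermartingale P F Y 0"
    by (rule density_martingale_supermartingale[OF refl f Y])
  have cad: "cadlag P Y" using Y by (simp add: density_martingale_def)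
  note lim = AE_tendsto_nat_limit[OF sup cad]
  have [measurable]: "f \<in> borel_measurable P" using f by (auto simp: nonneg_integrable_def)
  have ad: "Y (real n) \<in> borel_measurable (F (real n))" for n
    by (rule density_martingale_adapt[OF refl f Y]) simp
  have [measurable]: "Y (real n) \<in> borel_measurable P" for n
    by (rule measurable_F[OF _ ad]) simp
  have "AE x in P. ennreal (nat_limit Y x) = ennreal (f x)"
  proof (rule AE_eq_levy_limit[where G = "\<lambda>n. F (real n)" and Y = "\<lambda>n x. ennreal (Y (real n) x)"])
    show "subalgebra P (F (real n))" for n by (rule subalg) simp
    show "sets (F (real k)) \<subseteq> sets (F (real n))" if "k \<le> n" for k n
      using sets_F_mono[of "real k" "real n"] that by auto
    show "sets P = sigma_sets (space P) (\<Union>n. sets (F (real n)))"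
      using generated_sequence[of 0] by simp
    show "(\<lambda>x. ennreal (Y (real n) x)) \<in> borel_measurable (F (real n))" for n
      using ad by measurable
    show "(\<integral>\<^sup>+x. ennreal (f x) \<partial>P) < \<infinity>" by (rule density_martingale_finite[OF refl f Y])
    show "AE x in P. (\<lambda>n. ennreal (Y (real n) x)) \<longlonglongrightarrow> ennreal (nat_limit Y x)"
      using lim by eventually_elim (intro tendsto_ennrealI tendsto_at_top_real_sequence)
    show "(\<integral>\<^sup>+x\<in>C. ennreal (f x) \<partial>P) \<le> (\<integral>\<^sup>+x\<in>C. ennreal (Y (real n) x) \<partial>P)"
      if "C \<in> sets (F (real n))" for n C
      using density_martingale_eq[OF refl f Y _ that] by simp
    show "liminf (\<lambda>n. \<integral>\<^sup>+x\<in>C. ennreal (Y (real n) x) \<partial>P) \<le> (\<integral>\<^sup>+x\<in>C. ennreal (f x) \<partial>P)"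
      if C: "C \<in> sets (F (real k))" for k C
    proof (rule Liminf_le)
      have "(\<integral>\<^sup>+x\<in>C. ennreal (Y (real n) x) \<partial>P) \<le> (\<integral>\<^sup>+x\<in>C. ennreal (f x) \<partial>P)" if "k \<le> n" for n
        using density_martingale_eq[OF refl f Y, of "real n" C] sets_F_mono[OF _ _ C, of "real n"] that by simp
      then show "\<forall>\<^sub>F n in sequentially. (\<integral>\<^sup>+x\<in>C. ennreal (Y (real n) x) \<partial>P) \<le> (\<integral>\<^sup>+x\<in>C. ennreal (f x) \<partial>P)"
        unfolding eventually_sequentially by blast
    qed simp
  qed measurable
  with lim AE_space show ?thesis
  proof eventually_elim
    fix x assume "((\<lambda>t. Y t x) \<longlongrightarrow> nat_limit Y x) at_top" "x \<in> space P" "ennreal (nat_limit Y x) = ennreal (f x)"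
    moreover from this have "nat_limit Y x = f x"
      using f nat_limit_nonneg[of Y x] by (simp add: nonneg_integrable_def)
    ultimately show "((\<lambda>t. Y t x) \<longlongrightarrow> f x) at_top" by simp
  qed
qed

text \<open>Under \<open>Qs k\<close> the integral of the ratio over \<open>C\<close> equals the
  \<open>Q\<close>-integral of \<open>f\<close> over the part of \<open>C\<close> in
  \<open>K\<close>. This exceeds the part in \<open>G k\<close>, and the excess tends to zero since
  \<open>K\<close> shrinks to \<open>G k\<close>; so Levy's theorem with slack applies.\<close>

lemma density_martingale_ratio_tendsto:
  assumes f: "nonneg_integrable Q f" and Y: "density_martingale Q f Y"
  shows "AE x in Q. ((\<lambda>t. Y t x / X t x) \<longlongrightarrow> f x) at_top"
proof -
  have sup: "nonneg_supermartingale P F Y 0"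
    by (rule density_martingale_supermartingale[OF sets_Q f Y])
  have cad: "cadlag P Y" using Y by (simp add: density_martingale_def)
  note lim = AE_Q_ratio_tendsto[OF sup cad]
  have fQ [measurable]: "f \<in> borel_measurable Q" using f by (auto simp: nonneg_integrable_def)
  then have [measurable]: "f \<in> borel_measurable P" by (simp add: borel_measurable_Q)
  have fin: "(\<integral>\<^sup>+x. ennreal (f x) \<partial>Q) < \<infinity>" by (rule density_martingale_finite[OF sets_Q f Y])
  have YF: "\<And>t. 0 \<le> t \<Longrightarrow> Y t \<in> borel_measurable (F t)" by (rule density_martingale_adapt[OF sets_Q f Y])
  have YP: "\<And>t. 0 \<le> t \<Longrightarrow> Y t \<in> borel_measurable P" by (rule measurable_F[OF _ YF])
  have Y0: "\<And>t x. 0 \<le> t \<Longrightarrow> x \<in> space P \<Longrightarrow> 0 \<le> Y t x" by (rule density_martingale_nonneg[OF sets_Q f Y])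
  have rl [measurable]: "ratio_limit Y \<in> borel_measurable P" by (rule ratio_limit_measurable[OF YP])
  have "AE x in Q. ennreal (ratio_limit Y x) = ennreal (f x)"
  proof (rule AE_Q_of_AE_Qs)
    fix k :: nat
    interpret Qk: finite_measure "Qs (real k)" by (rule finite_measure_Qs) simp
    \<comment> \<open>The offset \<open>k + 1\<close> makes all times strictly larger than
      \<open>k\<close>: on \<open>G k\<close> the process \<open>X\<close> may still vanish at time
      \<open>k\<close>, but not later.\<close>
    define a where "a n = real n + (real k + 1)" for n
    have a: "0 \<le> a n" "real k \<le> a n" "real k < a n" for n by (simp_all add: a_def)
    have amono: "a i \<le> a j" if "i \<le> j" for i j using that by (simp add: a_def)
    have meas_Qs: "g \<in> borel_measurable (Qs (real k)) \<longleftrightarrow> g \<in> borel_measurable P" for g :: "'a \<Rightarrow> ennreal"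
      by (simp add: measurable_cong_sets[OF sets_Qs refl])
    have ratio: "(\<integral>\<^sup>+x\<in>C. ennreal (Y (a n) x / X (a n) x) \<partial>Qs (real k)) =
        (\<integral>\<^sup>+x\<in>C \<inter> K (real k) (a n). ennreal (f x) \<partial>Q)" if C: "C \<in> sets (F (a n))" for n C
    proof -
      have "C \<inter> K (real k) (a n) \<in> sets (F (a n))" using C K_sets[OF _ a(2)] by auto
      from density_martingale_eq[OF sets_Q f Y a(1) this] show ?thesis
        using set_nn_integral_ratio[OF _ a(2) YF[OF a(1)] Y0[OF a(1)] C] by simp
    qed
    have intQs: "(\<integral>\<^sup>+x\<in>C. ennreal (f x) \<partial>Qs (real k)) = (\<integral>\<^sup>+x\<in>C \<inter> G (real k). ennreal (f x) \<partial>Q)"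
      if C: "C \<in> sets P" for C
    proof -
      have "(\<integral>\<^sup>+x\<in>C. ennreal (f x) \<partial>Qs (real k)) = (\<integral>\<^sup>+x\<in>G (real k). (ennreal (f x) * indicator C x) \<partial>Q)"
        using C by (intro nn_integral_Qs) auto
      also have "\<dots> = (\<integral>\<^sup>+x\<in>C \<inter> G (real k). ennreal (f x) \<partial>Q)"
        by (intro nn_integral_cong) (auto simp: indicator_def)
      finally show ?thesis .
    qed
    have CP: "C \<in> sets P" if "C \<in> sets (F (a n))" for C n by (rule sets_F[OF a(1) that])
    have XP [measurable]: "X (a n) \<in> borel_measurable P" and YaP [measurable]: "Y (a n) \<in> borel_measurable P" for n
      using X_meas YP a by auto
    have XF: "X (a n) \<in> borel_measurable (F (a n))" and YaF: "Y (a n) \<in> borel_measurable (F (a n))" for n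
      using X_adapt YF a by auto
    show "AE x in Qs (real k). ennreal (ratio_limit Y x) = ennreal (f x)"
    proof (rule Qk.AE_eq_levy_limit[where G = "\<lambda>n. F (a n)" and Y = "\<lambda>n x. ennreal (Y (a n) x / X (a n) x)"])
      show "subalgebra (Qs (real k)) (F (a n))" for n
        using subalg[OF a(1)] by (simp add: subalgebra_def space_Qs sets_Qs)
      show "sets (F (a i)) \<subseteq> sets (F (a j))" if "i \<le> j" for i j
        using sets_F_mono[OF a(1) amono[OF that]] by auto
      show "sets (Qs (real k)) = sigma_sets (space (Qs (real k))) (\<Union>n. sets (F (a n)))"
        using generated_sequence[of "real k + 1"] by (simp add: sets_Qs space_Qs a_def)
      show "(\<lambda>x. ennreal (Y (a n) x / X (a n) x)) \<in> borel_measurable (F (a n))" for n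
        using XF[of n] YaF[of n] by measurable
      show "(\<lambda>x. ennreal (f x)) \<in> borel_measurable (Qs (real k))"
        "(\<lambda>x. ennreal (ratio_limit Y x)) \<in> borel_measurable (Qs (real k))"
        unfolding meas_Qs by measurable
      have "(\<integral>\<^sup>+x. ennreal (f x) \<partial>Qs (real k)) = (\<integral>\<^sup>+x\<in>G (real k). ennreal (f x) \<partial>Q)"
        by (rule nn_integral_Qs) auto
      also have "\<dots> \<le> (\<integral>\<^sup>+x. ennreal (f x) \<partial>Q)"
        by (intro nn_integral_mono) (auto simp: indicator_def)
      finally show "(\<integral>\<^sup>+x. ennreal (f x) \<partial>Qs (real k)) < \<infinity>" using fin by (rule le_less_trans)
      have "AE x in Qs (real k). ((\<lambda>t. Y t x / X t x) \<longlongrightarrow> ratio_limit Y x) at_top"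
        unfolding AE_Qs_iff[OF of_nat_0_le_iff] using lim by eventually_elim simp
      moreover have "filterlim a at_top sequentially"
        unfolding a_def
        by (intro filterlim_tendsto_add_at_top[OF tendsto_const filterlim_real_sequentially, THEN
              filterlim_cong[OF refl refl, THEN iffD1, rotated]]) (auto simp: add.commute)
      ultimately show "AE x in Qs (real k). (\<lambda>n. ennreal (Y (a n) x / X (a n) x)) \<longlonglongrightarrow> ennreal (ratio_limit Y x)"
        by (elim eventually_mono) (intro tendsto_ennrealI, erule filterlim_compose)
    next
      fix n C assume C: "C \<in> sets (F (a n))"
      have "G (real k) \<subseteq> K (real k) (a n)"
        using A_constant[OF _ _ a(2)] X_nonzero[OF _ a(3)] by (auto simp: K_def G_def)
      then show "(\<integral>\<^sup>+x\<in>C. ennreal (f x) \<partial>Qs (real k)) \<le> (\<integral>\<^sup>+x\<in>C. ennreal (Y (a n) x / X (a n) x) \<partial>Qs (real k))"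
        unfolding ratio[OF C] intQs[OF CP[OF C]] by (intro nn_integral_mono) (auto simp: indicator_def)
    next
      fix j C assume C: "C \<in> sets (F (a j))"
      have [measurable]: "C \<in> sets Q" using CP[OF C] by (simp add: sets_Q)
      have [measurable]: "K (real k) (a n) \<in> sets Q" for n
        using sets_F[OF a(1) K_sets[OF _ a(2)]] by (simp add: sets_Q)
      have "(\<lambda>n. \<integral>\<^sup>+x\<in>C \<inter> K (real k) (a n). ennreal (f x) \<partial>Q) \<longlonglongrightarrow> (\<integral>\<^sup>+x\<in>C \<inter> G (real k). ennreal (f x) \<partial>Q)"
      proof (rule nn_integral_dominated_convergence[where w = "\<lambda>x. ennreal (f x)"])
        have "AE x in Q. \<forall>n. x \<in> G (real k) \<longleftrightarrow> x \<in> G (a n) \<and> A (a n) x = A (real k) x"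
          by (intro AE_all_countable[THEN iffD2] allI AE_Q_G_iff a) simp
        with AE_Q_in_G show "AE x in Q. (\<lambda>n. ennreal (f x) * indicator (C \<inter> K (real k) (a n)) x) \<longlonglongrightarrow>
            ennreal (f x) * indicator (C \<inter> G (real k)) x"
        proof eventually_elim
          fix x assume "\<exists>n::nat. x \<in> G (real n)"
            and iff: "\<forall>n. x \<in> G (real k) \<longleftrightarrow> x \<in> G (a n) \<and> A (a n) x = A (real k) x"
          then obtain m :: nat where m: "x \<in> G (real m)" by blast
          \<comment> \<open>Once the last zero has passed, \<open>X (a n) \<noteq> 0\<close> holds
            for free, and constancy of \<open>A\<close> is equivalent to membership in
            \<open>G k\<close>.\<close>
          have "x \<in> K (real k) (a n) \<longleftrightarrow> x \<in> G (real k)" if "m \<le> n" for n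
          proof -
            have "real m < a n" using that by (simp add: a_def)
            then have "x \<in> G (a n)" "X (a n) x \<noteq> 0"
              using m G_mono[of "real m" "a n"] X_nonzero[OF m] by auto
            then show ?thesis using iff[rule_format, of n] by (auto simp: K_def G_def)
          qed
          then show "(\<lambda>n. ennreal (f x) * indicator (C \<inter> K (real k) (a n)) x) \<longlonglongrightarrow>
            ennreal (f x) * indicator (C \<inter> G (real k)) x"
            by (intro tendsto_eventually eventually_sequentiallyI[of m]) (simp add: indicator_def)
        qed
      qed (use fin in \<open>auto simp: indicator_def\<close>)
      moreover have "\<forall>\<^sub>F n in sequentially. (\<integral>\<^sup>+x\<in>C \<inter> K (real k) (a n). ennreal (f x) \<partial>Q) =
          (\<integral>\<^sup>+x\<in>C. ennreal (Y (a n) x / X (a n) x) \<partial>Qs (real k))"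
        by (intro eventually_sequentiallyI[of j] ratio[symmetric] sets_F_mono[OF a(1) amono C])
      ultimately have "(\<lambda>n. \<integral>\<^sup>+x\<in>C. ennreal (Y (a n) x / X (a n) x) \<partial>Qs (real k)) \<longlonglongrightarrow>
          (\<integral>\<^sup>+x\<in>C. ennreal (f x) \<partial>Qs (real k))"
        unfolding intQs[OF CP[OF C]] by (rule Lim_transform_eventually)
      then show "liminf (\<lambda>n. \<integral>\<^sup>+x\<in>C. ennreal (Y (a n) x / X (a n) x) \<partial>Qs (real k)) \<le>
          (\<integral>\<^sup>+x\<in>C. ennreal (f x) \<partial>Qs (real k))"
        by (simp add: lim_imp_Liminf)
    qed
  qed
  with lim AE_space show ?thesis
  proof eventually_elim
    fix x assume "((\<lambda>t. Y t x / X t x) \<longlongrightarrow> ratio_limit Y x) at_top" "x \<in> space Q"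
      "ennreal (ratio_limit Y x) = ennreal (f x)"
    moreover from this have "ratio_limit Y x = f x"
      using f ratio_limit_nonneg[of Y x] by (simp add: nonneg_integrable_def)
    ultimately show "((\<lambda>t. Y t x / X t x) \<longlongrightarrow> f x) at_top" by simp
  qed
qed

text \<open>The ratio limit is \<open>f\<close>, whose \<open>Q\<close>-integral already equals the
  initial mass of \<open>Y\<close>. The mass inequality leaves nothing for the limit under
  \<open>P\<close>.\<close>

lemma density_martingale_Q_tendsto_0:
  assumes Ainf: "AE x in P. filterlim (\<lambda>t. A t x) at_top at_top"
    and f: "nonneg_integrable Q f" and Y: "density_martingale Q f Y"
  shows "AE x in P. ((\<lambda>t. Y t x) \<longlongrightarrow> 0) at_top"
proof -
  have sup: "nonneg_supermartingale P F Y 0"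
    by (rule density_martingale_supermartingale[OF sets_Q f Y])
  have cad: "cadlag P Y" using Y by (simp add: density_martingale_def)
  note lim = AE_tendsto_nat_limit[OF sup cad]
  have YP [measurable]: "Y (real n) \<in> borel_measurable P" for n
    by (rule measurable_F[OF _ density_martingale_adapt[OF sets_Q f Y]]) simp_all
  have "AE x in Q. ratio_limit Y x = f x"
    using AE_Q_ratio_tendsto[OF sup cad] density_martingale_ratio_tendsto[OF f Y]
    by eventually_elim (rule tendsto_unique[OF trivial_limit_at_top_linorder])
  then have "AE x in Q. ennreal (f x) = ennreal (ratio_limit Y x)" by eventually_elim simp
  then have "(\<integral>\<^sup>+x. ennreal (f x) \<partial>Q) = (\<integral>\<^sup>+x. ennreal (ratio_limit Y x) \<partial>Q)"
    by (rule nn_integral_cong_AE)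
  then have "(\<integral>\<^sup>+x. ennreal (f x) \<partial>Q) + (\<integral>\<^sup>+x. ennreal (nat_limit Y x) \<partial>P) \<le> (\<integral>\<^sup>+x. ennreal (Y 0 x) \<partial>P)"
    using ratio_limit_plus_limit_le[OF sup cad Ainf lim order_refl space_in_F[OF order_refl]]
    by (simp add: set_nn_integral_space[OF space_Q] set_nn_integral_space[OF refl])
  also have "\<dots> = (\<integral>\<^sup>+x. ennreal (f x) \<partial>Q)" by (rule density_martingale_nn_integral[OF sets_Q f Y order_refl])
  finally have "(\<integral>\<^sup>+x. ennreal (nat_limit Y x) \<partial>P) = 0"
    by (rule ennreal_add_le_self_imp_eq_0) (rule density_martingale_finite[OF sets_Q f Y])
  then have "AE x in P. ennreal (nat_limit Y x) = 0" by (subst (asm) nn_integral_0_iff_AE) auto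
  with lim show ?thesis
  proof eventually_elim
    fix x assume "((\<lambda>t. Y t x) \<longlongrightarrow> nat_limit Y x) at_top" "ennreal (nat_limit Y x) = 0"
    moreover from this have "nat_limit Y x = 0"
      using nat_limit_nonneg[of Y x] by (simp add: ennreal_eq_0_iff)
    ultimately show "((\<lambda>t. Y t x) \<longlongrightarrow> 0) at_top" by simp
  qed
qed

text \<open>The mirror image: the limit \<open>f\<close> under \<open>P\<close> exhausts the initial
  mass of \<open>Y\<close>, so the ratio limit has \<open>Q\<close>-integral zero.\<close>

lemma density_martingale_P_ratio_tendsto_0:
  assumes Ainf: "AE x in P. filterlim (\<lambda>t. A t x) at_top at_top"
    and f: "nonneg_integrable P f" and Y: "density_martingale P f Y"
  shows "AE x in Q. ((\<lambda>t. Y t x / X t x) \<longlongrightarrow> 0) at_top"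
proof -
  have sup: "nonneg_supermartingale P F Y 0"
    by (rule density_martingale_supermartingale[OF refl f Y])
  have cad: "cadlag P Y" using Y by (simp add: density_martingale_def)
  have YP: "\<And>t. 0 \<le> t \<Longrightarrow> Y t \<in> borel_measurable P"
    by (rule measurable_F[OF _ density_martingale_adapt[OF refl f Y]])
  have [measurable]: "ratio_limit Y \<in> borel_measurable Q"
    using ratio_limit_measurable[OF YP] by (simp add: borel_measurable_Q)
  have "(\<integral>\<^sup>+x. ennreal (f x) \<partial>P) + (\<integral>\<^sup>+x. ennreal (ratio_limit Y x) \<partial>Q) \<le> (\<integral>\<^sup>+x. ennreal (Y 0 x) \<partial>P)"
    using ratio_limit_plus_limit_le[OF sup cad Ainf density_martingale_tendsto[OF f Y] order_refl space_in_F[OF order_refl]]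
    by (simp add: set_nn_integral_space[OF space_Q] set_nn_integral_space[OF refl] add.commute)
  also have "\<dots> = (\<integral>\<^sup>+x. ennreal (f x) \<partial>P)" by (rule density_martingale_nn_integral[OF refl f Y order_refl])
  finally have "(\<integral>\<^sup>+x. ennreal (ratio_limit Y x) \<partial>Q) = 0"
    by (rule ennreal_add_le_self_imp_eq_0) (rule density_martingale_finite[OF refl f Y])
  then have "AE x in Q. ennreal (ratio_limit Y x) = 0" by (subst (asm) nn_integral_0_iff_AE) auto
  with AE_Q_ratio_tendsto[OF sup cad] show ?thesis
  proof eventually_elim
    fix x assume "((\<lambda>t. Y t x / X t x) \<longlongrightarrow> ratio_limit Y x) at_top" "ennreal (ratio_limit Y x) = 0"
    moreover from this have "ratio_limit Y x = 0"
      using ratio_limit_nonneg[of Y x] by (simp add: ennreal_eq_0_iff)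
    ultimately show "((\<lambda>t. Y t x / X t x) \<longlongrightarrow> 0) at_top" by simp
  qed
qed

text \<open>Scheffe's lemma: almost sure convergence together with constant means.\<close>

lemma density_martingale_tendsto_L1:
  assumes f: "nonneg_integrable P f" and Y: "density_martingale P f Y"
  shows "((\<lambda>t. \<integral>\<^sup>+x. ennreal \<bar>Y t x - f x\<bar> \<partial>P) \<longlongrightarrow> 0) at_top"
proof (rule tendsto_at_topI_sequentially)
  fix u :: "nat \<Rightarrow> real" assume u: "filterlim u at_top sequentially"
  \<comment> \<open>An arbitrary sequence tending to infinity may start with negative times, at
    which nothing is known about \<open>Y\<close>.\<close>
  define v where "v n = max 0 (u n)" for n
  have v0: "0 \<le> v n" for n by (simp add: v_def)
  have ev: "\<forall>\<^sub>F n in sequentially. v n = u n"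
    using u[unfolded filterlim_at_top, rule_format, of 0] by eventually_elim (simp add: v_def)
  have v: "filterlim v at_top sequentially"
    using filterlim_cong[OF refl refl ev] u by simp
  have fi: "integrable P f" and f0: "\<And>x. x \<in> space P \<Longrightarrow> 0 \<le> f x" using f by (auto simp: nonneg_integrable_def)
  have Yi: "integrable P (Y (v n))" for n by (rule density_martingale_integrable[OF refl f Y v0])
  have Y0: "0 \<le> Y (v n) x" if "x \<in> space P" for n x by (rule density_martingale_nonneg[OF refl f Y v0 that])
  have lim: "AE x in P. (\<lambda>n. Y (v n) x) \<longlonglongrightarrow> f x"
    using density_martingale_tendsto[OF f Y] by eventually_elim (rule filterlim_compose[OF _ v])
  have "(\<lambda>n. \<integral>\<^sup>+x. norm (Y (v n) x - f x) \<partial>P) \<longlonglongrightarrow> 0"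
  proof (rule Scheffe_lemma1[OF Yi fi lim])
    have "(\<integral>\<^sup>+x. norm (Y (v n) x) \<partial>P) = (\<integral>\<^sup>+x. norm (f x) \<partial>P)" for n
    proof -
      have "(\<integral>\<^sup>+x. norm (Y (v n) x) \<partial>P) = (\<integral>\<^sup>+x. ennreal (Y (v n) x) \<partial>P)"
        by (intro nn_integral_cong) (simp add: Y0)
      also have "\<dots> = (\<integral>\<^sup>+x. ennreal (f x) \<partial>P)" by (rule density_martingale_nn_integral[OF refl f Y v0])
      also have "\<dots> = (\<integral>\<^sup>+x. norm (f x) \<partial>P)" by (intro nn_integral_cong) (simp add: f0)
      finally show ?thesis .
    qed
    then show "limsup (\<lambda>n. \<integral>\<^sup>+x. norm (Y (v n) x) \<partial>P) \<le> (\<integral>\<^sup>+x. norm (f x) \<partial>P)"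
      by (simp add: Limsup_const)
  qed
  then have "(\<lambda>n. \<integral>\<^sup>+x. ennreal \<bar>Y (v n) x - f x\<bar> \<partial>P) \<longlonglongrightarrow> 0" by simp
  then show "(\<lambda>n. \<integral>\<^sup>+x. ennreal \<bar>Y (u n) x - f x\<bar> \<partial>P) \<longlonglongrightarrow> 0"
    by (rule Lim_transform_eventually) (use ev in \<open>eventually_elim, simp\<close>)
qed

end

subsection \<open>The decomposition\<close>

theorem proposition4p1:
  fixes P Q :: "'a measure" and F :: "real \<Rightarrow> 'a measure"
    and X N A Z :: "real \<Rightarrow> 'a \<Rightarrow> real"
  assumes "filtered_prob_space P F"
    and "property_NP P F"
    and "class_Sigma P F X N A"
    and "associated_measure P F X Q"
    and "AE \<omega> in P. filterlim (\<lambda>t. A t \<omega>) at_top at_top"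
    and "nonneg_process P Z" and "cadlag P Z" and "supermartingale P F Z"
  shows "\<exists>Zinf zinf Mz E \<xi>.
    Zinf \<in> borel_measurable P \<and>
    (AE \<omega> in P. ((\<lambda>t. Z t \<omega>) \<longlongrightarrow> Zinf \<omega>) at_top) \<and>
    (AE \<omega> in Q. (\<forall>\<^sub>F t in at_top. X t \<omega> \<noteq> 0) \<and>
       ((\<lambda>t. Z t \<omega> / X t \<omega>) \<longlongrightarrow> zinf \<omega>) at_top) \<and>
    nonneg_integrable Q zinf \<and>
    M_martingale P F Q zinf Mz \<and>
    cadlag_cond_exp P F Zinf E \<and>
    nonneg_process P \<xi> \<and> cadlag P \<xi> \<and> supermartingale P F \<xi> \<and>
    (\<forall>\<omega>\<in>space P. \<forall>t\<ge>0. Z t \<omega> = Mz t \<omega> + E t \<omega> + \<xi> t \<omega>) \<and>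
    nonneg_integrable P Zinf \<and>
    (AE \<omega> in P. ((\<lambda>t. E t \<omega>) \<longlongrightarrow> Zinf \<omega>) at_top) \<and>
    ((\<lambda>t. \<integral>\<^sup>+\<omega>. ennreal \<bar>E t \<omega> - Zinf \<omega>\<bar> \<partial>P) \<longlongrightarrow> 0) at_top \<and>
    (AE \<omega> in Q. ((\<lambda>t. (E t \<omega> + \<xi> t \<omega>) / X t \<omega>) \<longlongrightarrow> 0) at_top) \<and>
    (AE \<omega> in P. ((\<lambda>t. Mz t \<omega> + \<xi> t \<omega>) \<longlongrightarrow> 0) at_top) \<and>
    (\<forall>z' Z' Mz' E' \<xi>'.
       nonneg_integrable Q z' \<and> nonneg_integrable P Z' \<and>
       M_martingale P F Q z' Mz' \<and> cadlag_cond_exp P F Z' E' \<and>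
       nonneg_process P \<xi>' \<and> cadlag P \<xi>' \<and> supermartingale P F \<xi>' \<and>
       (\<forall>t\<ge>0. AE \<omega> in P. Z t \<omega> = Mz' t \<omega> + E' t \<omega> + \<xi>' t \<omega>) \<and>
       (AE \<omega> in P. ((\<lambda>t. \<xi>' t \<omega>) \<longlongrightarrow> 0) at_top) \<and>
       (AE \<omega> in Q. ((\<lambda>t. \<xi>' t \<omega> / X t \<omega>) \<longlongrightarrow> 0) at_top) \<longrightarrow>
       (AE \<omega> in Q. z' \<omega> = zinf \<omega>) \<and>
       (AE \<omega> in P. Z' \<omega> = Zinf \<omega>) \<and>
       indistinguishable P \<xi>' \<xi>)"
proof -
  interpret prob_space P using assms(1) by (simp add: filtered_prob_space_def)
  interpret class_Sigma_measure P F X N A Q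
  proof unfold_locales
    show "filtered_measurable_space P F" using assms(1) by (simp add: filtered_prob_space_def)
    show "natural_conditions P F" by (rule property_NP_natural_conditions[OF assms(2)])
    show "sets P = sigma_sets (space P) (\<Union>t\<in>{0..}. sets (F t))" by (rule property_NP_generated[OF assms(2)])
  qed (fact assms)+
  note Ainf = assms(5) and Z_nonneg = assms(6) and Z_cadlag = assms(7) and Z_super = assms(8)
  have Zs: "nonneg_supermartingale P F Z 0" by (rule nonneg_supermartingaleI[OF Z_nonneg Z_super])
  have Z_adapted: "adapted F Z" and Z_int: "\<And>t. 0 \<le> t \<Longrightarrow> integrable P (Z t)"
    using Z_super by (auto simp: supermartingale_def)
  have ZF: "\<And>t. 0 \<le> t \<Longrightarrow> Z t \<in> borel_measurable (F t)" using Z_adapted by (simp add: adapted_def)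
  have ZP: "\<And>t. 0 \<le> t \<Longrightarrow> Z t \<in> borel_measurable P" by (rule measurable_F[OF _ ZF])

  \<comment> \<open>Existence of the decomposition\<close>
  define Zinf where "Zinf = nat_limit Z"
  define zinf where "zinf = ratio_limit Z"
  have limZ: "AE x in P. ((\<lambda>t. Z t x) \<longlongrightarrow> Zinf x) at_top"
    unfolding Zinf_def by (rule AE_tendsto_nat_limit[OF Zs Z_cadlag])
  have limR: "AE x in Q. ((\<lambda>t. Z t x / X t x) \<longlongrightarrow> zinf x) at_top"
    unfolding zinf_def by (rule AE_Q_ratio_tendsto[OF Zs Z_cadlag])
  have le: "(\<integral>\<^sup>+x\<in>B. ennreal (zinf x) \<partial>Q) + (\<integral>\<^sup>+x\<in>B. ennreal (Zinf x) \<partial>P) \<le> (\<integral>\<^sup>+x\<in>B. ennreal (Z t x) \<partial>P)"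
    if "0 \<le> t" "B \<in> sets (F t)" for t B
    unfolding zinf_def by (rule ratio_limit_plus_limit_le[OF Zs Z_cadlag Ainf limZ that])
  have ZinfP: "Zinf \<in> borel_measurable P"
    unfolding Zinf_def by (rule measurable_nat_limit) (simp add: ZP)
  have zinfQ: "zinf \<in> borel_measurable Q"
    using ratio_limit_measurable[OF ZP] by (simp add: zinf_def borel_measurable_Q)
  \<comment> \<open>The mass inequality at time zero over the whole space gives integrability of
    both limits.\<close>
  have "(\<integral>\<^sup>+x. ennreal (zinf x) \<partial>Q) + (\<integral>\<^sup>+x. ennreal (Zinf x) \<partial>P) \<le> (\<integral>\<^sup>+x. ennreal (Z 0 x) \<partial>P)"
    using le[OF order_refl space_in_F[OF order_refl]]
    by (simp add: set_nn_integral_space[OF space_Q] set_nn_integral_space[OF refl])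
  then have "(\<integral>\<^sup>+x. ennreal (zinf x) \<partial>Q) + (\<integral>\<^sup>+x. ennreal (Zinf x) \<partial>P) < \<infinity>"
    using nonneg_supermartingale.fin[OF Zs] by (rule le_less_trans)
  then have finz: "(\<integral>\<^sup>+x. ennreal (zinf x) \<partial>Q) < \<infinity>" and finZ: "(\<integral>\<^sup>+x. ennreal (Zinf x) \<partial>P) < \<infinity>"
    by (simp_all add: less_top[symmetric])
  have zinf: "nonneg_integrable Q zinf"
    unfolding nonneg_integrable_def
    using integrableI_nonneg[OF zinfQ _ finz] by (simp add: zinf_def ratio_limit_nonneg)
  have Zinf: "nonneg_integrable P Zinf"
    unfolding nonneg_integrable_def
    using integrableI_nonneg[OF ZinfP _ finZ] by (simp add: Zinf_def nat_limit_nonneg)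
  obtain M0 where M0: "density_martingale Q zinf M0"
    by (rule density_martingale_ex[OF sets_Q null_sets_Q zinf])
  obtain E0 where E0: "density_martingale P Zinf E0"
    by (rule density_martingale_ex[OF refl _ Zinf])
  note M0' = density_martingale_adapt[OF sets_Q zinf M0] density_martingale_nonneg[OF sets_Q zinf M0]
    and E0' = density_martingale_adapt[OF refl Zinf E0] density_martingale_nonneg[OF refl Zinf E0]
  \<comment> \<open>Over events of \<open>F t\<close>, \<open>M0 t\<close> and \<open>E0 t\<close>
    have the integrals of \<open>zinf\<close> under \<open>Q\<close> and \<open>Zinf\<close> under
    \<open>P\<close>, so the mass inequality becomes a pointwise one.\<close>
  have rest_nonneg: "AE x in P. 0 \<le> Z t x - M0 t x - E0 t x" if t: "0 \<le> t" for t
  proof -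
    have [measurable]: "M0 t \<in> borel_measurable P" "E0 t \<in> borel_measurable P"
      "M0 t \<in> borel_measurable (F t)" "E0 t \<in> borel_measurable (F t)" "Z t \<in> borel_measurable (F t)"
      using measurable_F[OF t M0'(1)[OF t]] measurable_F[OF t E0'(1)[OF t]] M0'(1)[OF t] E0'(1)[OF t] ZF[OF t] by auto
    have "AE x in P. ennreal (M0 t x) + ennreal (E0 t x) \<le> ennreal (Z t x)"
    proof (rule AE_le_of_set_nn_integral_le[OF subalg[OF t]])
      fix B assume B: "B \<in> sets (F t)"
      then have [measurable]: "B \<in> sets P" by (rule sets_F[OF t])
      have "(\<integral>\<^sup>+x\<in>B. (ennreal (M0 t x) + ennreal (E0 t x)) \<partial>P) =
        (\<integral>\<^sup>+x\<in>B. ennreal (M0 t x) \<partial>P) + (\<integral>\<^sup>+x\<in>B. ennreal (E0 t x) \<partial>P)"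
        unfolding distrib_right by (rule nn_integral_add) measurable
      also have "\<dots> = (\<integral>\<^sup>+x\<in>B. ennreal (zinf x) \<partial>Q) + (\<integral>\<^sup>+x\<in>B. ennreal (Zinf x) \<partial>P)"
        by (simp only: density_martingale_eq[OF sets_Q zinf M0 t B] density_martingale_eq[OF refl Zinf E0 t B])
      also have "\<dots> \<le> (\<integral>\<^sup>+x\<in>B. ennreal (Z t x) \<partial>P)" by (rule le[OF t B])
      finally show "(\<integral>\<^sup>+x\<in>B. (ennreal (M0 t x) + ennreal (E0 t x)) \<partial>P) \<le> (\<integral>\<^sup>+x\<in>B. ennreal (Z t x) \<partial>P)" .
    next
      have "0 \<le> Z t x" if "x \<in> space P" for x using Z_nonneg t that by (simp add: nonneg_process_def)
      then show "(\<integral>\<^sup>+x. ennreal (Z t x) \<partial>P) < \<infinity>"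
        by (subst nn_integral_eq_integral[OF Z_int[OF t]]) auto
    qed measurable
    with AE_space show ?thesis
    proof eventually_elim
      fix x assume "x \<in> space P" "ennreal (M0 t x) + ennreal (E0 t x) \<le> ennreal (Z t x)"
      then have "M0 t x + E0 t x \<le> Z t x"
        using M0'(2)[OF t] E0'(2)[OF t] Z_nonneg t
        by (simp add: nonneg_process_def ennreal_plus[symmetric] del: ennreal_plus)
      then show "0 \<le> Z t x - M0 t x - E0 t x" by simp
    qed
  qed
  have rest: "cadlag P (\<lambda>t x. Z t x - M0 t x - E0 t x)" "adapted F (\<lambda>t x. Z t x - M0 t x - E0 t x)"
    using Z_cadlag Z_adapted M0 E0
    by (auto intro!: cadlag_diff adapted_diff simp: density_martingale_def)
  obtain C where C: "C \<in> sets (F 0)" "C \<in> null_sets P"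
    "\<And>x t. x \<in> space P - C \<Longrightarrow> 0 \<le> t \<Longrightarrow> 0 \<le> Z t x - M0 t x - E0 t x"
    using exceptional_null_set_nonneg[OF rest rest_nonneg] by auto
  \<comment> \<open>Both martingale parts are set to zero on \<open>C\<close>, where the remainder
    becomes \<open>Z\<close>. Thus the paths of \<open>\<xi>\<close> are nonnegative at every point,
    as \<open>nonneg_process\<close> demands.\<close>
  define Mz where "Mz = (\<lambda>t x. if x \<in> C then 0 else M0 t x)"
  define E where "E = (\<lambda>t x. if x \<in> C then 0 else E0 t x)"
  define \<xi> where "\<xi> = (\<lambda>t x. Z t x - Mz t x - E t x)"
  have Mz: "density_martingale Q zinf Mz"
    unfolding Mz_def by (rule density_martingale_zero_on_null[OF M0 C(1,2)])
  have E: "density_martingale P Zinf E"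
    unfolding E_def by (rule density_martingale_zero_on_null[OF E0 C(1,2)])
  have \<xi>_nonneg: "nonneg_process P \<xi>"
    unfolding nonneg_process_def
  proof (intro ballI allI impI)
    fix x and t :: real assume "x \<in> space P" "0 \<le> t"
    then show "0 \<le> \<xi> t x"
      using C(3)[of x t] Z_nonneg by (cases "x \<in> C") (auto simp: \<xi>_def Mz_def E_def nonneg_process_def)
  qed
  have \<xi>_cadlag: "cadlag P \<xi>" and \<xi>_adapted: "adapted F \<xi>"
    unfolding \<xi>_def using Z_cadlag Z_adapted Mz E
    by (auto intro!: cadlag_diff adapted_diff simp: density_martingale_def)
  have Mz_int: "\<And>t. 0 \<le> t \<Longrightarrow> integrable P (Mz t)" by (rule density_martingale_integrable[OF sets_Q zinf Mz])
  have E_int: "\<And>t. 0 \<le> t \<Longrightarrow> integrable P (E t)" by (rule density_martingale_integrable[OF refl Zinf E])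
  have \<xi>_super: "supermartingale P F \<xi>"
    unfolding supermartingale_def
  proof (intro conjI allI impI)
    show "integrable P (\<xi> t)" if "0 \<le> t" for t
      unfolding \<xi>_def using Z_int Mz_int E_int that by auto
    fix s t :: real assume st: "0 \<le> s \<and> s \<le> t"
    then have t: "0 \<le> t" and s: "0 \<le> s" by auto
    interpret Fs: sigma_finite_subalgebra P "F s" by (rule sigma_finite_subalgebra_F[OF s])
    have "AE x in P. real_cond_exp P (F s) (Z t) x \<le> Z s x"
      using Z_super st by (simp add: supermartingale_def)
    moreover have "AE x in P. real_cond_exp P (F s) (Mz t) x = Mz s x"
      using density_martingale_martingale[OF sets_Q zinf Mz] st by (simp add: martingale_def)
    moreover have "AE x in P. real_cond_exp P (F s) (E t) x = E s x"
      using density_martingale_martingale[OF refl Zinf E] st by (simp add: martingale_def)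
    moreover have "AE x in P. real_cond_exp P (F s) (\<lambda>x. Z t x - Mz t x) x =
        real_cond_exp P (F s) (Z t) x - real_cond_exp P (F s) (Mz t) x"
      by (rule Fs.real_cond_exp_diff[OF Z_int[OF t] Mz_int[OF t]])
    moreover have "AE x in P. real_cond_exp P (F s) (\<lambda>x. (Z t x - Mz t x) - E t x) x =
        real_cond_exp P (F s) (\<lambda>x. Z t x - Mz t x) x - real_cond_exp P (F s) (E t) x"
      using Z_int[OF t] Mz_int[OF t] E_int[OF t] by (intro Fs.real_cond_exp_diff) auto
    ultimately show "AE x in P. real_cond_exp P (F s) (\<xi> t) x \<le> \<xi> s x"
      unfolding \<xi>_def by eventually_elim simp
  qed (rule \<xi>_adapted)
  have decomp: "Z t x = Mz t x + E t x + \<xi> t x" for t x by (simp add: \<xi>_def)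
  have X_ev: "AE x in Q. \<forall>\<^sub>F t in at_top. X t x \<noteq> 0"
    using AE_Q_in_G
  proof eventually_elim
    fix x assume "\<exists>n::nat. x \<in> G (real n)"
    then obtain n :: nat where n: "x \<in> G (real n)" by blast
    show "\<forall>\<^sub>F t in at_top. X t x \<noteq> 0"
      by (rule eventually_mono[OF eventually_gt_at_top[of "real n"]]) (use X_nonzero[OF n] in auto)
  qed
  have limE: "AE x in P. ((\<lambda>t. E t x) \<longlongrightarrow> Zinf x) at_top" by (rule density_martingale_tendsto[OF Zinf E])
  have limMX: "AE x in Q. ((\<lambda>t. Mz t x / X t x) \<longlongrightarrow> zinf x) at_top"
    by (rule density_martingale_ratio_tendsto[OF zinf Mz])
  have lim_L1: "((\<lambda>t. \<integral>\<^sup>+x. ennreal \<bar>E t x - Zinf x\<bar> \<partial>P) \<longlongrightarrow> 0) at_top"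
    by (rule density_martingale_tendsto_L1[OF Zinf E])
  have lim_ii: "AE x in Q. ((\<lambda>t. (E t x + \<xi> t x) / X t x) \<longlongrightarrow> 0) at_top"
    using limR limMX
  proof eventually_elim
    fix x assume "((\<lambda>t. Z t x / X t x) \<longlongrightarrow> zinf x) at_top" "((\<lambda>t. Mz t x / X t x) \<longlongrightarrow> zinf x) at_top"
    then have "((\<lambda>t. Z t x / X t x - Mz t x / X t x) \<longlongrightarrow> zinf x - zinf x) at_top" by (rule tendsto_diff)
    moreover have "Z t x / X t x - Mz t x / X t x = (E t x + \<xi> t x) / X t x" for t
      by (simp add: \<xi>_def diff_divide_distrib)
    ultimately show "((\<lambda>t. (E t x + \<xi> t x) / X t x) \<longlongrightarrow> 0) at_top" by simp
  qed
  have lim_iii: "AE x in P. ((\<lambda>t. Mz t x + \<xi> t x) \<longlongrightarrow> 0) at_top"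
    using limZ limE
  proof eventually_elim
    fix x assume "((\<lambda>t. Z t x) \<longlongrightarrow> Zinf x) at_top" "((\<lambda>t. E t x) \<longlongrightarrow> Zinf x) at_top"
    then have "((\<lambda>t. Z t x - E t x) \<longlongrightarrow> Zinf x - Zinf x) at_top" by (rule tendsto_diff)
    then show "((\<lambda>t. Mz t x + \<xi> t x) \<longlongrightarrow> 0) at_top" by (simp add: \<xi>_def algebra_simps)
  qed

  \<comment> \<open>Uniqueness of the decomposition\<close>
  have unique: "(AE x in Q. z' x = zinf x) \<and> (AE x in P. Z' x = Zinf x) \<and> indistinguishable P \<xi>' \<xi>"
    if z': "nonneg_integrable Q z'" and Z': "nonneg_integrable P Z'"
      and Mz': "M_martingale P F Q z' Mz'" and E': "cadlag_cond_exp P F Z' E'"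
      and \<xi>': "cadlag P \<xi>'" "supermartingale P F \<xi>'"
      and dec: "\<forall>t\<ge>0. AE x in P. Z t x = Mz' t x + E' t x + \<xi>' t x"
      and \<xi>'_0: "AE x in P. ((\<lambda>t. \<xi>' t x) \<longlongrightarrow> 0) at_top"
      and \<xi>'_X: "AE x in Q. ((\<lambda>t. \<xi>' t x / X t x) \<longlongrightarrow> 0) at_top" for z' Z' Mz' E' \<xi>'
  proof -
    \<comment> \<open>The given versions are exchanged for nonnegative density martingales, to which
      the limit theorems apply.\<close>
    obtain M1 where M1: "density_martingale Q z' M1" by (rule density_martingale_ex[OF sets_Q null_sets_Q z'])
    obtain E1 where E1: "density_martingale P Z' E1" by (rule density_martingale_ex[OF refl _ Z'])
    have dec1: "AE x in P. \<xi>' t x = Z t x - M1 t x - E1 t x" if t: "0 \<le> t" for t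
    proof -
      have "AE x in P. Z t x = Mz' t x + E' t x + \<xi>' t x" using dec t by blast
      moreover have "AE x in P. E' t x = real_cond_exp P (F t) Z' x"
        using E' t by (simp add: cadlag_cond_exp_def)
      ultimately show ?thesis
        using M_martingale_AE_eq[OF sets_Q z' M1 Mz' t] density_martingale_cond_exp_AE[OF Z' E1 t]
        by eventually_elim simp
    qed
    have rest1: "cadlag P (\<lambda>t x. Z t x - M1 t x - E1 t x)" "adapted F (\<lambda>t x. Z t x - M1 t x - E1 t x)"
      using Z_cadlag Z_adapted M1 E1
      by (auto intro!: cadlag_diff adapted_diff simp: density_martingale_def)
    have \<xi>'_adapted: "adapted F \<xi>'" using \<xi>'(2) by (simp add: supermartingale_def)
    obtain D where D: "D \<in> sets (F 0)" "D \<in> null_sets P"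
      "\<And>x t. x \<in> space P - D \<Longrightarrow> 0 \<le> t \<Longrightarrow> \<xi>' t x = Z t x - M1 t x - E1 t x"
      using exceptional_null_set_eq[OF \<xi>'(1) \<xi>'_adapted rest1 dec1] by auto
    have DP: "AE x in P. x \<in> space P - D" using AE_not_in[OF D(2)] AE_space by eventually_elim simp
    \<comment> \<open>Since \<open>D\<close> lies in \<open>F 0\<close>, the decomposition also
      holds path by path under \<open>Q\<close> and may be divided by \<open>X\<close> in the
      limit.\<close>
    have DQ: "AE x in Q. x \<in> space P - D"
      using AE_not_in[OF null_sets_Q[OF order_refl D(1,2)]] AE_space[of Q] by eventually_elim (simp add: space_Q)
    have z'_eq: "AE x in Q. z' x = zinf x"
      using DQ limR \<xi>'_X density_martingale_ratio_tendsto[OF z' M1] density_martingale_P_ratio_tendsto_0[OF Ainf Z' E1]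
    proof eventually_elim
      fix x assume x: "x \<in> space P - D"
        and 1: "((\<lambda>t. Z t x / X t x) \<longlongrightarrow> zinf x) at_top" and 2: "((\<lambda>t. \<xi>' t x / X t x) \<longlongrightarrow> 0) at_top"
        and 3: "((\<lambda>t. M1 t x / X t x) \<longlongrightarrow> z' x) at_top" and 4: "((\<lambda>t. E1 t x / X t x) \<longlongrightarrow> 0) at_top"
      have "((\<lambda>t. Z t x / X t x - E1 t x / X t x - \<xi>' t x / X t x) \<longlongrightarrow> zinf x - 0 - 0) at_top"
        by (intro tendsto_diff 1 2 4)
      moreover have "\<forall>\<^sub>F t in at_top. Z t x / X t x - E1 t x / X t x - \<xi>' t x / X t x = M1 t x / X t x"
        by (rule eventually_mono[OF eventually_ge_at_top[of 0]])
          (simp add: D(3)[OF x] diff_divide_distrib)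
      ultimately have "((\<lambda>t. M1 t x / X t x) \<longlongrightarrow> zinf x - 0 - 0) at_top" by (rule Lim_transform_eventually)
      from tendsto_unique[OF trivial_limit_at_top_linorder 3 this] show "z' x = zinf x" by simp
    qed
    have Z'_eq: "AE x in P. Z' x = Zinf x"
      using DP limZ \<xi>'_0 density_martingale_Q_tendsto_0[OF Ainf z' M1] density_martingale_tendsto[OF Z' E1]
    proof eventually_elim
      fix x assume x: "x \<in> space P - D"
        and 1: "((\<lambda>t. Z t x) \<longlongrightarrow> Zinf x) at_top" and 2: "((\<lambda>t. \<xi>' t x) \<longlongrightarrow> 0) at_top"
        and 3: "((\<lambda>t. M1 t x) \<longlongrightarrow> 0) at_top" and 4: "((\<lambda>t. E1 t x) \<longlongrightarrow> Z' x) at_top"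
      have "((\<lambda>t. Z t x - M1 t x - \<xi>' t x) \<longlongrightarrow> Zinf x - 0 - 0) at_top"
        by (intro tendsto_diff 1 2 3)
      moreover have "\<forall>\<^sub>F t in at_top. Z t x - M1 t x - \<xi>' t x = E1 t x"
        by (rule eventually_mono[OF eventually_ge_at_top[of 0]]) (simp add: D(3)[OF x])
      ultimately have "((\<lambda>t. E1 t x) \<longlongrightarrow> Zinf x - 0 - 0) at_top" by (rule Lim_transform_eventually)
      from tendsto_unique[OF trivial_limit_at_top_linorder 4 this] show "Z' x = Zinf x" by simp
    qed
    \<comment> \<open>With the terminal values identified, \<open>M1\<close> and \<open>E1\<close>
      represent the same functionals as \<open>Mz\<close> and \<open>E\<close>, so the remainders
      agree at each time, and then along whole paths.\<close>
    have M1': "density_martingale Q zinf M1" by (rule density_martingale_cong[OF z'_eq M1])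
    have E1': "density_martingale P Zinf E1" by (rule density_martingale_cong[OF Z'_eq E1])
    have \<xi>_eq: "AE x in P. \<xi>' t x = \<xi> t x" if t: "0 \<le> t" for t
      using dec1[OF t] M_martingale_AE_eq[OF sets_Q zinf M1' density_martingale_M_martingale[OF sets_Q zinf Mz] t]
        M_martingale_AE_eq[OF refl Zinf E1' density_martingale_M_martingale[OF refl Zinf E] t]
      by eventually_elim (simp add: \<xi>_def)
    obtain D' where D': "D' \<in> sets (F 0)" "D' \<in> null_sets P"
      "\<And>x t. x \<in> space P - D' \<Longrightarrow> 0 \<le> t \<Longrightarrow> \<xi>' t x = \<xi> t x"
      using exceptional_null_set_eq[OF \<xi>'(1) \<xi>'_adapted \<xi>_cadlag \<xi>_adapted \<xi>_eq] by auto
    have "indistinguishable P \<xi>' \<xi>"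
      unfolding indistinguishable_def using AE_not_in[OF D'(2)] AE_space
      by eventually_elim (use D'(3) in simp)
    with z'_eq Z'_eq show ?thesis by blast
  qed
  have ratio_lim: "AE x in Q. (\<forall>\<^sub>F t in at_top. X t x \<noteq> 0) \<and> ((\<lambda>t. Z t x / X t x) \<longlongrightarrow> zinf x) at_top"
    using X_ev limR by eventually_elim simp
  show ?thesis
  proof (rule exI[of _ Zinf], rule exI[of _ zinf], rule exI[of _ Mz], rule exI[of _ E], rule exI[of _ \<xi>],
      intro conjI)
    show "\<forall>x\<in>space P. \<forall>t\<ge>0. Z t x = Mz t x + E t x + \<xi> t x"
      by (intro ballI allI impI decomp)
    show "\<forall>z' Z' Mz' E' \<xi>'.
       nonneg_integrable Q z' \<and> nonneg_integrable P Z' \<and>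
       M_martingale P F Q z' Mz' \<and> cadlag_cond_exp P F Z' E' \<and>
       nonneg_process P \<xi>' \<and> cadlag P \<xi>' \<and> supermartingale P F \<xi>' \<and>
       (\<forall>t\<ge>0. AE x in P. Z t x = Mz' t x + E' t x + \<xi>' t x) \<and>
       (AE x in P. ((\<lambda>t. \<xi>' t x) \<longlongrightarrow> 0) at_top) \<and>
       (AE x in Q. ((\<lambda>t. \<xi>' t x / X t x) \<longlongrightarrow> 0) at_top) \<longrightarrow>
       (AE x in Q. z' x = zinf x) \<and>
       (AE x in P. Z' x = Zinf x) \<and>
       indistinguishable P \<xi>' \<xi>"
      by (intro allI impI, elim conjE, rule unique; assumption)
  qed (fact ZinfP limZ ratio_lim zinf Zinf density_martingale_M_martingale[OF sets_Q zinf Mz]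
      density_martingale_cadlag_cond_exp[OF Zinf E] \<xi>_nonneg \<xi>_cadlag \<xi>_super limE lim_L1 lim_ii lim_iii)+
qed

end
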